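(* Let $(g_n)_{n\ge1}$ be real numbers, $(\sigma_n)_{n\ge1}$ positive numbers, and $(q_n^\pm)_{n\ge1}$ real numbers with $q_{n+1}^++q_n^-=1$, $0<q_n^\pm<1$ for $n\ge1$. Consider any version (not necessarily approximative, with any initial condition) $Y$ of the infinite ranked system of competing Brownian particles with parameters $(g_n)_{n\ge1}$, $(\sigma_n^2)_{n\ge1}$, $(q_n^\pm)_{n\ge1}$, and let $Z$ be its gap process. Suppose that there is a sequence of integers $N_j\ge2$, $N_j\to\infty$, such that for every $j\ge1$ the gap process of the ranked system of $N_j$ competing Brownian particles with parameters $(g_n)_{1\le n\le N_j}$, $(\sigma_n^2)_{1\le n\le N_j}$, $(q_n^\pm)_{1\le n\le N_j}$ has a stationary distribution $\pi^{(N_j)}$. Let $\pi$ be the limiting distribution on $\mathbb{R}_+^\infty$ of the $\pi^{(N_j)}$, i.e. $[\pi^{(N_j)}]_M\Rightarrow[\pi]_M$ as $j\to\infty$ for every $M\ge1$. Then: (i) the family of $\mathbb{R}_+^\infty$-valued random variables $Z(t)$, $t\ge0$, is tight in $\mathbb{R}_+^\infty$ (with the topology of componentwise convergence); (ii) if for some sequence $t_j\uparrow\infty$ we have $Z(t_j)\Rightarrow\nu$ as $j\to\infty$, where $\nu$ is some probability measure on $\mathbb{R}_+^\infty$, then $\nu\preceq\pi$; (iii) suppose in addition that $\inf_{n\ge1}g_n>-\infty$, $\sup_{n\ge1}\sigma_n^2<\infty$, there is $n_0\ge1$ with $q_n^+\ge\frac12$ for all $n\ge n_0$, and $\pi$-almost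 every $z=(z_1,z_2,\dots)$ satisfies $\sum_{n=1}^\infty\exp(-\alpha(z_1+\dots+z_n)^2)<\infty$ for all $\alpha>0$; then every stationary distribution $\pi'$ for the gap process satisfies $\pi'\preceq\pi$.
   Context: The setting is a filtered probability space satisfying the usual conditions. For a distribution $\pi$ on $\mathbb{R}^N$ (with $N\le\infty$) and $M\le N$, $[\pi]_M$ is the marginal of the first $M$ components. $\Rightarrow$ denotes weak convergence. Stochastic domination: for $x,y\in\mathbb{R}^\infty$, $x\le y$ means $x_i\le y_i$ for all $i$; $[y,\infty):=\{x\in\mathbb{R}^\infty: x\ge y\}$. For probability measures, $\nu_1\preceq\nu_2$ (equivalently $\nu_2\succeq\nu_1$; $\nu_1$ is stochastically dominated by $\nu_2$) means $\nu_1[y,\infty)\le\nu_2[y,\infty)$ for every $y\in\mathbb{R}^\infty$. Infinite ranked system with drift coefficients $(g_k)$, diffusion coefficients $(\sigma_k^2)$, parameters of collision $(q_k^\pm)$ and driving Brownian motions $B_1,B_2,\dots$ (i.i.d. standard): an $\mathbb{R}^\infty$-valued process $Y=(Y_k)_{k\ge1}$ with continuous adapted components, together with continuous adapted real-valued processes $L_{(k,k+1)}$, $k\ge1$ (and $L_{(0,1)}\equiv0$), such that: (i) $Y_1(t)\le Y_2(t)\le\dots$ for $t\ge0$; (ii) $Y_k(t)=Y_k(0)+g_kt+\sigma_kB_k(t)+q_k^+L_{(k-1,k)}(t)-q_k^-L_{(k,k+1)}(t)$; (iii) each $L_{(k,k+1)}$ is nondecreasing, $L_{(k,k+1)}(0)=0$,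 and $\int_0^\infty(Y_{k+1}(t)-Y_k(t))\,dL_{(k,k+1)}(t)=0$. The finite ranked system of $N$ particles is defined in the same way with $k=1,\dots,N$ and $L_{(0,1)}\equiv L_{(N,N+1)}\equiv0$ (strong existence and pathwise uniqueness are known for it). The gap process is $Z=(Z_k)$, $Z_k(t)=Y_{k+1}(t)-Y_k(t)$. For a finite system the stationary distribution of the gap process is unique when it exists. The limiting distribution $\pi$ exists and is uniquely determined: under the stated assumption on $(N_j)$, for each $M$ the marginals $[\pi^{(N_j)}]_M$ converge weakly as $j\to\infty$ to consistent probability measures on $\mathbb{R}_+^M$, and $\pi$ is the measure on $\mathbb{R}_+^\infty$ with these marginals. A probability measure $\pi'$ on $\mathbb{R}_+^\infty$ is a stationary distribution for the gap process of the infinite system if there exists a version $Y$ of the system such that $Z(t)\sim\pi'$ for every $t\ge0$. *)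

theory Defs
  imports "HOL-Probability.Probability" "HOL-Library.Extended_Nat"
begin

text \<open>
  Indices are 1-based.  For an index set I of natural numbers, the space R^I is
  \<open>space (PiM I (\<lambda>_. borel))\<close>: its points are functions \<open>nat \<Rightarrow> real\<close> that equal \<open>undefined\<close>
  outside I, so the product topology of \<open>nat \<Rightarrow> real\<close> induces on it the topology of
  componentwise convergence.  R^M is the case \<open>I = {1..M}\<close> and R^\<open>\<infinity>\<close> the case \<open>I = {1..}\<close>.
  A probability measure on the closed orthant R_+^I is represented as a Borel probability
  measure on R^I that gives the orthant full mass.
\<close>

definition orthant :: "nat set \<Rightarrow> (nat \<Rightarrow> real) set" where
  "orthant I = (\<Pi>\<^sub>E i\<in>I. {0..})"

definition orthant_distribution :: "nat set \<Rightarrow> (nat \<Rightarrow> real) measure \<Rightarrow> bool" where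
  "orthant_distribution I \<mu> \<longleftrightarrow>
     prob_space \<mu> \<and> sets \<mu> = sets (PiM I (\<lambda>_. borel)) \<and> (AE z in \<mu>. z \<in> orthant I)"

text \<open>
  The marginal of the first m components; it is meaningful only for measures on R^I with
  \<open>{1..m} \<subseteq> I\<close>.
\<close>

definition marginal :: "(nat \<Rightarrow> real) measure \<Rightarrow> nat \<Rightarrow> (nat \<Rightarrow> real) measure" where
  "marginal \<mu> m = distr \<mu> (PiM {1..m} (\<lambda>_. borel)) (\<lambda>z. restrict z {1..m})"

text \<open>Weak convergence of measures on the topological (sub)space S that carries them.\<close>

definition weakly_converges ::
  "'b::topological_space set \<Rightarrow> (nat \<Rightarrow> 'b measure) \<Rightarrow> 'b measure \<Rightarrow> bool" where
  "weakly_converges S \<mu> \<nu> \<longleftrightarrow>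
     (\<forall>f :: 'b \<Rightarrow> real. continuous_on S f \<and> bounded (f ` S) \<longrightarrow>
        (\<lambda>j. LINT z:S|\<mu> j. f z) \<longlonglongrightarrow> (LINT z:S|\<nu>. f z))"

definition tight_on ::
  "'b::topological_space set \<Rightarrow> 'i set \<Rightarrow> ('i \<Rightarrow> 'b measure) \<Rightarrow> bool" where
  "tight_on S T \<mu> \<longleftrightarrow>
     (\<forall>\<epsilon>>0. \<exists>K. compact K \<and> K \<subseteq> S \<and> (\<forall>t\<in>T. measure (\<mu> t) K \<ge> 1 - \<epsilon>))"

definition upper_orthant :: "nat set \<Rightarrow> (nat \<Rightarrow> real) \<Rightarrow> (nat \<Rightarrow> real) set" where
  "upper_orthant I y = (\<Pi>\<^sub>E i\<in>I. {y i..})"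

definition stochastically_dominated ::
  "nat set \<Rightarrow> (nat \<Rightarrow> real) measure \<Rightarrow> (nat \<Rightarrow> real) measure \<Rightarrow> bool" where
  "stochastically_dominated I \<nu>1 \<nu>2 \<longleftrightarrow>
     (\<forall>y. measure \<nu>1 (upper_orthant I y) \<le> measure \<nu>2 (upper_orthant I y))"

text \<open>
  Time is \<open>t \<ge> 0\<close>; the members of the filtration at negative times exist only because the
  library's locale indexes by a whole type, and they play no role (they may all be \<open>F 0\<close>).
\<close>

locale usual_conditions = prob_space M + complete_measure M + filtration "space M" F
  for M :: "'a measure" and F :: "real \<Rightarrow> 'a measure" +
  assumes sets_F_subset: "\<And>t. 0 \<le> t \<Longrightarrow> sets (F t) \<subseteq> sets M"
    and null_sets_subset_F0: "null_sets M \<subseteq> sets (F 0)"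
    and right_continuous_F: "\<And>t. 0 \<le> t \<Longrightarrow> (\<Inter>s\<in>{t<..}. sets (F s)) = sets (F t)"
begin

definition adapted :: "(real \<Rightarrow> 'a \<Rightarrow> real) \<Rightarrow> bool" where
  "adapted X \<longleftrightarrow> (\<forall>t\<ge>0. X t \<in> borel_measurable (F t))"

definition brownian_motion :: "(real \<Rightarrow> 'a \<Rightarrow> real) \<Rightarrow> bool" where
  "brownian_motion W \<longleftrightarrow>
     adapted W \<and>
     (AE \<omega> in M. W 0 \<omega> = 0 \<and> continuous_on {0..} (\<lambda>t. W t \<omega>)) \<and>
     (\<forall>s t. 0 \<le> s \<and> s < t \<longrightarrow>
        distributed M lborel (\<lambda>\<omega>. W t \<omega> - W s \<omega>) (normal_density 0 (sqrt (t - s))) \<and>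
        indep_set (sets (F s)) {(\<lambda>\<omega>. W t \<omega> - W s \<omega>) -` A \<inter> space M |A. A \<in> sets borel})"

end

text \<open>
  The number N of particles is finite or \<open>\<infinity>\<close>.  The k-th gap lies between the particles
  k and k + 1.
\<close>

definition particles :: "enat \<Rightarrow> nat set" where
  "particles N = {k. 1 \<le> k \<and> enat k \<le> N}"

definition gaps :: "enat \<Rightarrow> nat set" where
  "gaps N = {k. 1 \<le> k \<and> enat (Suc k) \<le> N}"

lemma gaps_infinity: "gaps \<infinity> = {1..}"
  by (auto simp: gaps_def)

lemma gaps_finite: "gaps (enat n) = {1..<n}"
  by (auto simp: gaps_def)

text \<open>
  \<open>L k\<close> is the collision local time of the particles k and k + 1, with the convention
  \<open>L 0 = 0\<close> and, for finite N, \<open>L N = 0\<close>.  All pathwise conditions are required almost surely.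
  The integral with respect to \<open>dL k\<close> is taken with respect to the Lebesgue-Stieltjes measure
  of \<open>L k\<close>, extended by the constant value \<open>L k 0\<close> to negative times, so that this measure
  does not charge the negative half-line.
\<close>

locale ranked_system = usual_conditions M F
  for M :: "'a measure" and F :: "real \<Rightarrow> 'a measure" +
  fixes N :: enat and g \<sigma> qp qm :: "nat \<Rightarrow> real"
    and B Y L :: "nat \<Rightarrow> real \<Rightarrow> 'a \<Rightarrow> real"
  assumes brownian: "\<And>k. k \<in> particles N \<Longrightarrow> brownian_motion (B k)"
    and independent:
      "indep_vars (\<lambda>_. PiM {0..} (\<lambda>_. borel)) (\<lambda>k \<omega>. \<lambda>t\<in>{0..}. B k t \<omega>) (particles N)"
    and adapted_Y: "\<And>k. k \<in> particles N \<Longrightarrow> adapted (Y k)"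
    and continuous_Y: "\<And>k. k \<in> particles N \<Longrightarrow> AE \<omega> in M. continuous_on {0..} (\<lambda>t. Y k t \<omega>)"
    and adapted_L: "\<And>k. k \<in> gaps N \<Longrightarrow> adapted (L k)"
    and continuous_L: "\<And>k. k \<in> gaps N \<Longrightarrow> AE \<omega> in M. continuous_on {0..} (\<lambda>t. L k t \<omega>)"
    and L_boundary: "\<And>k. k = 0 \<or> enat k = N \<Longrightarrow> AE \<omega> in M. \<forall>t\<ge>0. L k t \<omega> = 0"
    and ranked: "\<And>k. k \<in> gaps N \<Longrightarrow> AE \<omega> in M. \<forall>t\<ge>0. Y k t \<omega> \<le> Y (Suc k) t \<omega>"
    and dynamics: "\<And>k. k \<in> particles N \<Longrightarrow> AE \<omega> in M. \<forall>t\<ge>0.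
      Y k t \<omega> = Y k 0 \<omega> + g k * t + \<sigma> k * B k t \<omega> + qp k * L (k - 1) t \<omega> - qm k * L k t \<omega>"
    and L_increasing:
      "\<And>k. k \<in> gaps N \<Longrightarrow> AE \<omega> in M. L k 0 \<omega> = 0 \<and> mono_on {0..} (\<lambda>t. L k t \<omega>)"
    and L_collision: "\<And>k. k \<in> gaps N \<Longrightarrow> AE \<omega> in M.
      (\<integral>\<^sup>+t\<in>{0..}. ennreal (Y (Suc k) t \<omega> - Y k t \<omega>)
         \<partial>interval_measure (\<lambda>t. L k (max 0 t) \<omega>)) = 0"

definition gap_process ::
  "nat set \<Rightarrow> (nat \<Rightarrow> real \<Rightarrow> 'a \<Rightarrow> real) \<Rightarrow> real \<Rightarrow> 'a \<Rightarrow> nat \<Rightarrow> real" where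
  "gap_process I Y t \<omega> = (\<lambda>k\<in>I. Y (Suc k) t \<omega> - Y k t \<omega>)"

definition gap_law ::
  "'a measure \<Rightarrow> nat set \<Rightarrow> (nat \<Rightarrow> real \<Rightarrow> 'a \<Rightarrow> real) \<Rightarrow> real \<Rightarrow> (nat \<Rightarrow> real) measure" where
  "gap_law M I Y t = distr M (PiM I (\<lambda>_. borel)) (gap_process I Y t)"

text \<open>
  HOL cannot quantify over the type of the sample space on which a version lives, so that type
  is an explicit argument.  Where stationarity is a hypothesis, a free type variable in this
  argument amounts to existence of a version on some probability space.
\<close>

definition stationary_gap_distribution ::
  "'a itself \<Rightarrow> enat \<Rightarrow> (nat \<Rightarrow> real) \<Rightarrow> (nat \<Rightarrow> real) \<Rightarrow> (nat \<Rightarrow> real) \<Rightarrow> (nat \<Rightarrow> real)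
     \<Rightarrow> (nat \<Rightarrow> real) measure \<Rightarrow> bool" where
  "stationary_gap_distribution (_ :: 'a itself) N g \<sigma> qp qm \<mu> \<longleftrightarrow>
     orthant_distribution (gaps N) \<mu> \<and>
     (\<exists>(M :: 'a measure) F B Y L.
        ranked_system M F N g \<sigma> qp qm B Y L \<and> (\<forall>t\<ge>0. gap_law M (gaps N) Y t = \<mu>))"

end

theory Submission
  imports Defs
begin

text \<open>
  The gaps of the first \<open>n\<close> particles solve a Skorokhod problem in the orthant whose reflection
  matrix \<open>1 - q\<close> has a nonnegative inverse, perturbed by a term that only shrinks them.  Solutions
  are least fixed points of the one-dimensional regulator, so they are monotone in the initial
  gaps and change by a bounded amount when the initial gaps change.  Hence the gaps \<open>Z\<close> of the
  infinite system lie below the reflection \<open>Z\<^sup>*\<close> of the same noise started from \<open>Z(0)\<close>, which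
  differs from the reflection \<open>Z\<^sup>0\<close> started from zero by a bounded amount.  The law of \<open>Z\<^sup>0\<close> is a
  functional of the law of the Brownian motions alone, so it is the same on the space that
  carries the stationary system of \<open>n\<close> particles, where \<open>Z\<^sup>0\<close> lies below the stationary gaps.
  This yields tightness.

  Moreover \<open>Z\<^sup>* - Z\<^sup>0\<close> tends to zero almost surely.  Otherwise some local time of \<open>Z\<^sup>*\<close> would stop
  growing, and a positive combination of the gaps would be a Brownian motion with drift from
  then on, contradicting tightness.  So every limit law of \<open>Z(t)\<close> is dominated by each finite
  stationary distribution, and therefore by their limit.  Part (iii) is the case of constant
  laws in part (ii).
\<close>

section \<open>Reflection in an orthant with an M-matrix\<close>

text \<open>Two difficulties shape the proof. Reflected paths are not monotone under the pointwise
  order of the free paths, so processes are compared in the stronger order in which the difference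
  is nonnegative and nondecreasing in time; one-dimensional reflection respects that order.
  Moreover, suprema over all times are not obviously measurable, so time runs through a countable
  set \<open>S\<close> containing the nonnegative rationals and the times of interest. Path
  continuity enters only where the given local times are identified with regulators over
  \<open>S\<close>.

  Neither ergodicity of the finite systems nor a coupling of two sample spaces is used. The process
  \<open>Z\<^sup>0\<close> is a path functional of the noise, so only its law travels between
  spaces, and it lies below the stationary law at every single time. The infinite system is compared
  with it path by path, for whatever version is given. The nonnegative inverse of the reflection
  matrix supplies both the bound on the effect of the initial gaps and the combination of gaps that
  isolates one local time.\<close>

definition regulator :: "real set \<Rightarrow> (real \<Rightarrow> real) \<Rightarrow> real \<Rightarrow> real" where
  "regulator S f t = enn2real (SUP s\<in>{s\<in>S. s \<le> t}. ennreal (- f s))"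

text \<open>\<open>enn2real\<close> sends an infinite supremum to 0. This condition keeps the
  supremum finite at all times of \<open>S\<close>, so that \<open>regulator\<close> is the running
  maximum of the positive part of \<open>- f\<close>; the positive part comes from
  \<open>ennreal\<close>.\<close>

definition locally_bounded_below :: "real set \<Rightarrow> (real \<Rightarrow> real) \<Rightarrow> bool" where
  "locally_bounded_below S f \<longleftrightarrow> (\<forall>t\<in>S. \<exists>c. \<forall>s\<in>S. s \<le> t \<longrightarrow> c \<le> f s)"

lemma locally_bounded_belowD:
  assumes "locally_bounded_below S f" "t \<in> S"
  shows "\<exists>c. \<forall>s\<in>S. s \<le> t \<longrightarrow> c \<le> f s"
  using assms unfolding locally_bounded_below_def by (rule bspec)

lemma locally_bounded_below_mono:
  assumes "locally_bounded_below S f" "\<And>s. s \<in> S \<Longrightarrow> f s \<le> g s"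
  shows "locally_bounded_below S g"
  using assms unfolding locally_bounded_below_def by (meson order_trans)

section \<open>One-dimensional reflection over a time set\<close>

lemma regulator_nonneg: "0 \<le> regulator S f t"
  by (simp add: regulator_def)

text \<open>Against a nonnegative \<open>r\<close> the positive part disappears, which leaves one
  linear constraint per time. The later estimates use the regulator through this
  equivalence.\<close>

lemma regulator_le_iff:
  assumes "locally_bounded_below S f" "t \<in> S" "0 \<le> r"
  shows "regulator S f t \<le> r \<longleftrightarrow> (\<forall>s\<in>S. s \<le> t \<longrightarrow> - f s \<le> r)"
proof -
  obtain c where c: "\<forall>s\<in>S. s \<le> t \<longrightarrow> c \<le> f s"
    using locally_bounded_belowD[OF assms(1,2)] ..
  define U where "U = (SUP s\<in>{s\<in>S. s \<le> t}. ennreal (- f s))"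
  have "U \<le> ennreal (- c)"
    unfolding U_def
  proof (rule SUP_least)
    fix s assume "s \<in> {s \<in> S. s \<le> t}"
    with c show "ennreal (- f s) \<le> ennreal (- c)" by (simp add: ennreal_leI)
  qed
  then have fin: "U < top"
    by (rule le_less_trans) simp
  have "regulator S f t \<le> r \<longleftrightarrow> ennreal (regulator S f t) \<le> ennreal r"
    using \<open>0 \<le> r\<close> by (simp add: ennreal_le_iff)
  also have "ennreal (regulator S f t) = U"
    unfolding regulator_def U_def[symmetric] using fin by simp
  also have "U \<le> ennreal r \<longleftrightarrow> (\<forall>s\<in>S. s \<le> t \<longrightarrow> ennreal (- f s) \<le> ennreal r)"
    by (auto simp: SUP_le_iff U_def)
  also have "\<dots> \<longleftrightarrow> (\<forall>s\<in>S. s \<le> t \<longrightarrow> - f s \<le> r)"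
    using \<open>0 \<le> r\<close> by (simp add: ennreal_le_iff)
  finally show ?thesis .
qed

lemma regulator_ge:
  assumes "locally_bounded_below S f" "t \<in> S" "s \<in> S" "s \<le> t"
  shows "- f s \<le> regulator S f t"
  using regulator_le_iff[OF assms(1,2) regulator_nonneg, of S f t] assms by auto

lemma regulator_mono:
  assumes "locally_bounded_below S f" "s \<in> S" "t \<in> S" "s \<le> t"
  shows "regulator S f s \<le> regulator S f t"
  using assms regulator_ge[OF assms(1) \<open>t \<in> S\<close>]
  by (subst regulator_le_iff) (auto simp: regulator_nonneg)

lemma regulator_antimono:
  assumes "locally_bounded_below S f" "t \<in> S" "\<And>s. s \<in> S \<Longrightarrow> s \<le> t \<Longrightarrow> f s \<le> g s"
    and "locally_bounded_below S g"
  shows "regulator S g t \<le> regulator S f t"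
proof -
  have "- g s \<le> regulator S f t" if "s \<in> S" "s \<le> t" for s
    using assms(3)[OF that] regulator_ge[OF assms(1,2) that] by simp
  then show ?thesis
    using assms(2,4) by (subst regulator_le_iff) (auto simp: regulator_nonneg)
qed

lemma reflected_nonneg:
  assumes "locally_bounded_below S f" "t \<in> S"
  shows "0 \<le> f t + regulator S f t"
  using regulator_ge[OF assms assms(2)] by simp

context
  fixes S :: "real set" and f g :: "real \<Rightarrow> real"
  assumes lbf: "locally_bounded_below S f"
    and le: "\<And>t. t \<in> S \<Longrightarrow> f t \<le> g t"
    and incr: "\<And>s t. s \<in> S \<Longrightarrow> t \<in> S \<Longrightarrow> s \<le> t \<Longrightarrow> g s - f s \<le> g t - f t"
begin

text \<open>Split \<open>- f s\<close> into \<open>- g s\<close> and \<open>g s - f s\<close>: the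
  first is at most the regulator of \<open>g\<close> at \<open>t\<close>, the second at most
  \<open>g t - f t\<close> because \<open>g - f\<close> is nondecreasing.\<close>

lemma reflected_compare:
  assumes t: "t \<in> S"
  shows "f t + regulator S f t \<le> g t + regulator S g t"
proof -
  have lbg: "locally_bounded_below S g"
    using locally_bounded_below_mono lbf le by blast
  have "regulator S f t \<le> g t - f t + regulator S g t"
    using le[OF t] regulator_nonneg[of S g t] regulator_ge[OF lbg t] incr t
    by (subst regulator_le_iff[OF lbf t]) force+
  then show ?thesis by simp
qed

text \<open>New minima of \<open>g\<close> after \<open>s\<close> are compared with those of
  \<open>f\<close>, whose excess is controlled by \<open>reflected_compare\<close> at time
  \<open>s\<close>; earlier minima are already counted at \<open>s\<close>.\<close>

lemma regulator_diff_mono: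
  assumes st: "s \<in> S" "t \<in> S" "s \<le> t"
  shows "regulator S f s - regulator S g s \<le> regulator S f t - regulator S g t"
proof -
  have lbg: "locally_bounded_below S g"
    using locally_bounded_below_mono lbf le by blast
  define r where "r = regulator S f t - regulator S f s + regulator S g s"
  have mono: "regulator S f s \<le> regulator S f t"
    by (rule regulator_mono[OF lbf st])
  then have "0 \<le> r"
    using regulator_nonneg[of S g s] by (simp add: r_def)
  moreover have "- g u \<le> r" if "u \<in> S" "u \<le> t" for u
  proof (cases "u \<le> s")
    case True
    with regulator_ge[OF lbg st(1) that(1)] mono show ?thesis by (simp add: r_def)
  next
    case False
    with reflected_compare[OF st(1)] incr[of s u] regulator_ge[OF lbf st(2) that] st that
    show ?thesis by (simp add: r_def)
  qed
  ultimately have "regulator S g t \<le> r"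
    by (subst regulator_le_iff[OF lbg st(2)]) auto
  then show ?thesis by (simp add: r_def)
qed

end

text \<open>The regulator grows only when the reflected path is at zero. Over a general time set the
  minimum need not be attained, hence the tolerance \<open>e\<close>.\<close>

lemma regulator_increase_near_zero:
  assumes lb: "locally_bounded_below S f" and st: "s \<in> S" "t \<in> S" "s \<le> t"
    and less: "regulator S f s < regulator S f t" and e: "0 < e"
  obtains u where "u \<in> S" "s \<le> u" "u \<le> t" "f u + regulator S f u \<le> e"
proof -
  \<comment> \<open>Exceeding the first entry forces the time to come after \<open>s\<close>;
    exceeding the second brings \<open>- f u\<close> within \<open>e\<close> of the regulator at
    \<open>t\<close>.\<close>
  define r where "r = max (regulator S f s) (regulator S f t - e)"
  have "0 \<le> r" using regulator_nonneg[of S f s] by (simp add: r_def)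
  moreover have "\<not> regulator S f t \<le> r" using less e by (simp add: r_def)
  ultimately obtain u where u: "u \<in> S" "u \<le> t" "r < - f u"
    using regulator_le_iff[OF lb st(2)] by (meson not_le)
  have "s \<le> u"
    using regulator_ge[OF lb st(1) u(1)] u(3) by (force simp: r_def)
  moreover have "f u + regulator S f u \<le> e"
    using regulator_mono[OF lb u(1) st(2) u(2)] u(3) by (simp add: r_def)
  ultimately show ?thesis using that u by blast
qed

lemma regulator_borel_measurable:
  assumes "countable S" "\<And>s. s \<in> S \<Longrightarrow> (\<lambda>\<omega>. f \<omega> s) \<in> borel_measurable M"
  shows "(\<lambda>\<omega>. regulator S (f \<omega>) t) \<in> borel_measurable M"
proof -
  have "(\<lambda>\<omega>. SUP s\<in>{s\<in>S. s \<le> t}. ennreal (- f \<omega> s)) \<in> borel_measurable M"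
    using assms by (intro borel_measurable_SUP) (auto intro: countable_subset[of _ S])
  then show ?thesis
    unfolding regulator_def by measurable
qed

text \<open>
  The Skorokhod problem in the orthant \<open>\<real>\<^sub>+\<^sup>I\<close> with reflection matrix \<open>1 - q\<close>: the matrix \<open>a\<close> is
  its inverse, and all times range over \<open>S\<close>.
\<close>

locale skorokhod_orthant =
  fixes I :: "'k set" and S :: "real set" and q a :: "'k \<Rightarrow> 'k \<Rightarrow> real"
  assumes finite_I: "finite I"
    and q_nonneg: "\<And>i j. i \<in> I \<Longrightarrow> j \<in> I \<Longrightarrow> 0 \<le> q i j"
    and a_nonneg: "\<And>i j. i \<in> I \<Longrightarrow> j \<in> I \<Longrightarrow> 0 \<le> a i j"
    and left_inverse: "\<And>k x. k \<in> I \<Longrightarrow> (\<Sum>i\<in>I. a k i * (x i - (\<Sum>j\<in>I. q i j * x j))) = x k"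
begin

text \<open>Applied to the unit vector at \<open>k\<close>, the inverse relation says that
  \<open>a k k\<close> is 1 plus a sum of nonnegative products.\<close>

lemma a_diagonal:
  assumes k: "k \<in> I"
  shows "1 \<le> a k k"
proof -
  have "1 = (\<Sum>i\<in>I. a k i * (of_bool (i = k) - (\<Sum>j\<in>I. q i j * of_bool (j = k))))"
    using left_inverse[OF k, of "\<lambda>i. of_bool (i = k)"] by simp
  also have "\<dots> = (\<Sum>i\<in>I. a k i * of_bool (i = k) - a k i * q i k)"
  proof -
    have "(\<Sum>j\<in>I. q i j * of_bool (j = k)) = (\<Sum>j\<in>I. if j = k then q i j else 0)" for i
      by (intro sum.cong) auto
    then have "(\<Sum>j\<in>I. q i j * of_bool (j = k)) = q i k" for i
      using k finite_I by simp
    then show ?thesis by (simp add: right_diff_distrib)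
  qed
  also have "\<dots> \<le> (\<Sum>i\<in>I. if i = k then a k k else 0)"
    using k by (intro sum_mono) (auto intro: mult_nonneg_nonneg a_nonneg q_nonneg)
  also have "\<dots> = a k k"
    using finite_I k by simp
  finally show ?thesis .
qed

text \<open>A maximum principle: nonnegativity of \<open>a\<close> lets an upper bound on
  \<open>(1 - q) x\<close> pass to \<open>x\<close>.\<close>

lemma inverse_positive:
  assumes "\<And>i. i \<in> I \<Longrightarrow> x i - (\<Sum>j\<in>I. q i j * x j) \<le> b" "k \<in> I"
  shows "x k \<le> (\<Sum>i\<in>I. a k i * b)"
  unfolding left_inverse[OF assms(2), of x, symmetric]
  using assms by (intro sum_mono mult_left_mono a_nonneg)

section \<open>The least solution by monotone iteration\<close>

definition push :: "('k \<Rightarrow> real \<Rightarrow> real) \<Rightarrow> 'k \<Rightarrow> real \<Rightarrow> real" where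
  "push l k t = (\<Sum>j\<in>I. q k j * l j t)"

text \<open>Starting from zero local times makes the iteration approach the least fixed point from
  below.\<close>

primrec iterate :: "nat \<Rightarrow> ('k \<Rightarrow> real \<Rightarrow> real) \<Rightarrow> 'k \<Rightarrow> real \<Rightarrow> real" where
  "iterate 0 X = (\<lambda>k t. 0)"
| "iterate (Suc n) X = (\<lambda>k t. regulator S (\<lambda>s. X k s - push (iterate n X) k s) t)"

definition local_time :: "('k \<Rightarrow> real \<Rightarrow> real) \<Rightarrow> 'k \<Rightarrow> real \<Rightarrow> real" where
  "local_time X k t = lim (\<lambda>n. iterate n X k t)"

definition reflected :: "('k \<Rightarrow> real \<Rightarrow> real) \<Rightarrow> 'k \<Rightarrow> real \<Rightarrow> real" where
  "reflected X k t = X k t - push (local_time X) k t + local_time X k t"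

text \<open>Applied to a difference, this is the order on processes used for all comparisons of
  local times and forcings.\<close>

definition increasing :: "('k \<Rightarrow> real \<Rightarrow> real) \<Rightarrow> bool" where
  "increasing l \<longleftrightarrow> (\<forall>k\<in>I. \<forall>t\<in>S. 0 \<le> l k t \<and> (\<forall>s\<in>S. s \<le> t \<longrightarrow> l k s \<le> l k t))"

definition bounded_forcing :: "('k \<Rightarrow> real \<Rightarrow> real) \<Rightarrow> bool" where
  "bounded_forcing X \<longleftrightarrow> (\<forall>k\<in>I. locally_bounded_below S (X k))"

text \<open>Solutions of the Skorokhod problem as fixed points: growth only at the boundary is
  encoded in each coordinate being a one-dimensional regulator.\<close>

definition is_regulator :: "('k \<Rightarrow> real \<Rightarrow> real) \<Rightarrow> ('k \<Rightarrow> real \<Rightarrow> real) \<Rightarrow> bool" where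
  "is_regulator X l \<longleftrightarrow> increasing l \<and>
     (\<forall>k\<in>I. \<forall>t\<in>S. l k t = regulator S (\<lambda>s. X k s - push l k s) t)"

lemma push_increasing:
  assumes "increasing l"
  shows "increasing (push l)"
  using assms unfolding increasing_def push_def
  by (auto intro!: sum_nonneg sum_mono mult_nonneg_nonneg mult_left_mono q_nonneg)

lemma bounded_forcing_minus_push:
  assumes X: "bounded_forcing X" and l: "increasing l" and k: "k \<in> I"
  shows "locally_bounded_below S (\<lambda>s. X k s - push l k s)"
  unfolding locally_bounded_below_def
proof
  fix t assume t: "t \<in> S"
  have "locally_bounded_below S (X k)" using X k by (simp add: bounded_forcing_def)
  then obtain c where c: "\<forall>s\<in>S. s \<le> t \<longrightarrow> c \<le> X k s"
    using locally_bounded_belowD[OF _ t] by blast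
  have "c - push l k t \<le> X k s - push l k s" if "s \<in> S" "s \<le> t" for s
    using c push_increasing[OF l] that t k by (fastforce simp: increasing_def)
  then show "\<exists>c. \<forall>s\<in>S. s \<le> t \<longrightarrow> c \<le> X k s - push l k s" by blast
qed

lemma regulator_increasing:
  assumes "bounded_forcing X" "increasing l"
  shows "increasing (\<lambda>k t. regulator S (\<lambda>s. X k s - push l k s) t)"
  using bounded_forcing_minus_push[OF assms]
  by (auto simp: increasing_def intro: regulator_mono regulator_nonneg)

lemma iterate_increasing: "bounded_forcing X \<Longrightarrow> increasing (iterate n X)"
proof (induction n)
  case (Suc n)
  then show ?case by (simp add: regulator_increasing)
qed (simp add: increasing_def)

lemma increasing_push_diff:
  assumes "increasing (\<lambda>k t. l k t - l' k t)"
  shows "increasing (\<lambda>k t. push l k t - push l' k t)"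
  using push_increasing[OF assms]
  by (simp add: push_def[abs_def] sum_subtractf right_diff_distrib)

lemma increasing_add: "increasing l \<Longrightarrow> increasing l' \<Longrightarrow> increasing (\<lambda>k t. l k t + l' k t)"
  by (auto simp: increasing_def intro: add_mono)

text \<open>More forcing and less pushing both enlarge the path \<open>X - push l\<close>, and they
  do so in the order that the one-dimensional comparison requires.\<close>

lemma step_compare:
  assumes X: "bounded_forcing X" and l: "increasing l"
    and D: "increasing (\<lambda>k t. X' k t - X k t)"
    and d: "increasing (\<lambda>k t. l k t - l' k t)"
  shows "increasing (\<lambda>k t. regulator S (\<lambda>s. X k s - push l k s) t
      - regulator S (\<lambda>s. X' k s - push l' k s) t)" (is ?A)
    and "k \<in> I \<Longrightarrow> t \<in> S \<Longrightarrow> X k t - push l k t + regulator S (\<lambda>s. X k s - push l k s) t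
      \<le> X' k t - push l' k t + regulator S (\<lambda>s. X' k s - push l' k s) t"
proof -
  have inc: "increasing (\<lambda>k t. (X' k t - push l' k t) - (X k t - push l k t))"
    using increasing_add[OF D increasing_push_diff[OF d]] by (simp add: algebra_simps)
  have lb: "locally_bounded_below S (\<lambda>s. X k s - push l k s)" if "k \<in> I" for k
    by (rule bounded_forcing_minus_push[OF X l that])
  have lb': "locally_bounded_below S (\<lambda>s. X' k s - push l' k s)" if "k \<in> I" for k
    by (rule locally_bounded_below_mono[OF lb[OF that]])
      (use inc that in \<open>fastforce simp: increasing_def\<close>)
  show ?A
    unfolding increasing_def
  proof (intro ballI conjI impI)
    fix k t assume kt: "k \<in> I" "t \<in> S"
    show "0 \<le> regulator S (\<lambda>s. X k s - push l k s) t - regulator S (\<lambda>s. X' k s - push l' k s) t"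
      using regulator_antimono[OF lb[OF kt(1)] kt(2) _ lb'[OF kt(1)]] inc kt
      by (fastforce simp: increasing_def)
    fix s assume "s \<in> S" "s \<le> t"
    with kt inc show "regulator S (\<lambda>s. X k s - push l k s) s - regulator S (\<lambda>s. X' k s - push l' k s) s
      \<le> regulator S (\<lambda>s. X k s - push l k s) t - regulator S (\<lambda>s. X' k s - push l' k s) t"
      by (intro regulator_diff_mono lb) (fastforce simp: increasing_def)+
  qed
  show "X k t - push l k t + regulator S (\<lambda>s. X k s - push l k s) t
      \<le> X' k t - push l' k t + regulator S (\<lambda>s. X' k s - push l' k s) t" if "k \<in> I" "t \<in> S"
    using inc that
    by (intro reflected_compare lb) (fastforce simp: increasing_def)+
qed

lemma iterate_mono:
  assumes "bounded_forcing X"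
  shows "increasing (\<lambda>k t. iterate (Suc n) X k t - iterate n X k t)"
proof (induction n)
  case 0
  show ?case using iterate_increasing[OF assms, of 1] by simp
next
  case (Suc n)
  have "increasing (\<lambda>k t. X k t - X k t)" by (simp add: increasing_def)
  from step_compare(1)[OF assms iterate_increasing[OF assms, of "Suc n"] this Suc]
  show ?case by simp
qed

text \<open>The a priori bound needs no contraction: the iterates increase, so each is at most a
  constant plus \<open>q\<close> times itself, and the maximum principle bounds it independently of
  \<open>n\<close>.\<close>

lemma iterate_tendsto:
  assumes X: "bounded_forcing X" and k: "k \<in> I" and t: "t \<in> S"
  shows "(\<lambda>n. iterate n X k t) \<longlonglongrightarrow> local_time X k t"
    and "iterate n X k t \<le> local_time X k t"
proof -
  have inc: "incseq (\<lambda>n. iterate n X i s)" if "i \<in> I" "s \<in> S" for i s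
    using iterate_mono[OF X] that by (intro incseq_SucI) (auto simp: increasing_def)
  have "\<exists>c. \<forall>s\<in>S. s \<le> t \<longrightarrow> (\<forall>i\<in>I. - c \<le> X i s)"
  proof -
    have "\<forall>i\<in>I. \<exists>c. \<forall>s\<in>S. s \<le> t \<longrightarrow> c \<le> X i s"
      using X t by (auto simp: bounded_forcing_def locally_bounded_below_def)
    then obtain c where c: "\<And>i s. i \<in> I \<Longrightarrow> s \<in> S \<Longrightarrow> s \<le> t \<Longrightarrow> c i \<le> X i s"
      by metis
    have "- (\<Sum>i\<in>I. \<bar>c i\<bar>) \<le> X i s" if "i \<in> I" "s \<in> S" "s \<le> t" for i s
      using c[OF that] member_le_sum[OF that(1), of "\<lambda>i. \<bar>c i\<bar>"] finite_I by force
    then show ?thesis by blast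
  qed
  then obtain c where c: "\<And>i s. i \<in> I \<Longrightarrow> s \<in> S \<Longrightarrow> s \<le> t \<Longrightarrow> - c \<le> X i s" by blast
  \<comment> \<open>The maximum with 0 is needed because a regulator is nonnegative even when the
    forcing never becomes negative.\<close>
  define b where "b = max 0 c"
  have bound: "iterate n X i t \<le> (\<Sum>j\<in>I. a i j * b)" if i: "i \<in> I" for i n
  proof (rule inverse_positive[OF _ i])
    fix i assume i: "i \<in> I"
    have "iterate n X i t \<le> iterate (Suc n) X i t"
      by (rule incseq_SucD[OF inc[OF i t]])
    also have "\<dots> \<le> b + push (iterate n X) i t"
    proof -
      have "- (X i s - push (iterate n X) i s) \<le> b + push (iterate n X) i t"
        if "s \<in> S" "s \<le> t" for s
        using c[OF i that] push_increasing[OF iterate_increasing[OF X, of n]] i t that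
        unfolding b_def increasing_def by fastforce
      moreover have "0 \<le> b + push (iterate n X) i t"
        using push_increasing[OF iterate_increasing[OF X, of n]] i t
        unfolding b_def increasing_def by force
      ultimately show ?thesis
        using regulator_le_iff[OF bounded_forcing_minus_push[OF X iterate_increasing[OF X] i] t]
        by simp
    qed
    finally show "iterate n X i t - (\<Sum>j\<in>I. q i j * iterate n X j t) \<le> b"
      by (simp add: push_def)
  qed
  obtain L where L: "(\<lambda>n. iterate n X k t) \<longlonglongrightarrow> L"
    using incseq_convergent[OF inc[OF k t]] bound[OF k] by blast
  then show lim: "(\<lambda>n. iterate n X k t) \<longlonglongrightarrow> local_time X k t"
    by (simp add: local_time_def limI)
  show "iterate n X k t \<le> local_time X k t"
    by (rule incseq_le[OF inc[OF k t] lim])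
qed

lemma push_tendsto:
  assumes X: "bounded_forcing X" and k: "k \<in> I" and t: "t \<in> S"
  shows "(\<lambda>n. push (iterate n X) k t) \<longlonglongrightarrow> push (local_time X) k t"
  unfolding push_def by (intro tendsto_sum tendsto_mult tendsto_const iterate_tendsto X t)

lemma increasing_limit:
  assumes "\<And>n. increasing (l n)"
    and "\<And>k t. k \<in> I \<Longrightarrow> t \<in> S \<Longrightarrow> (\<lambda>n. l n k t) \<longlonglongrightarrow> l' k t"
  shows "increasing l'"
  unfolding increasing_def
proof (intro ballI conjI impI)
  fix k t assume kt: "k \<in> I" "t \<in> S"
  show "0 \<le> l' k t"
    using assms(1) kt by (intro LIMSEQ_le_const[OF assms(2)]) (auto simp: increasing_def)
  fix s assume "s \<in> S" "s \<le> t"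
  then show "l' k s \<le> l' k t"
    using assms(1) kt by (intro LIMSEQ_le[OF assms(2) assms(2)]) (auto simp: increasing_def)
qed

lemma local_time_increasing:
  assumes X: "bounded_forcing X"
  shows "increasing (local_time X)"
  by (rule increasing_limit[OF iterate_increasing[OF X] iterate_tendsto(1)[OF X]])

text \<open>One inequality passes to the limit in each constraint separately; the other holds
  because pushing with the limit instead of an iterate only enlarges the regulator.\<close>

lemma is_regulator_local_time:
  assumes X: "bounded_forcing X"
  shows "is_regulator X (local_time X)"
  unfolding is_regulator_def
proof (intro conjI ballI local_time_increasing[OF X] antisym)
  fix k t assume k: "k \<in> I" and t: "t \<in> S"
  note lb = bounded_forcing_minus_push[OF X local_time_increasing[OF X] k]
  have nonneg: "0 \<le> local_time X k t"
    using local_time_increasing[OF X] k t by (auto simp: increasing_def)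
  have "- (X k s - push (local_time X) k s) \<le> local_time X k t" if s: "s \<in> S" "s \<le> t" for s
  proof (rule LIMSEQ_le_const2)
    show "(\<lambda>n. - (X k s - push (iterate n X) k s)) \<longlonglongrightarrow> - (X k s - push (local_time X) k s)"
      by (intro tendsto_intros push_tendsto X k s)
    have "- (X k s - push (iterate n X) k s) \<le> local_time X k t" for n
    proof -
      have "- (X k s - push (iterate n X) k s) \<le> iterate (Suc n) X k t"
        using regulator_ge[OF bounded_forcing_minus_push[OF X iterate_increasing[OF X] k] t s]
        by simp
      also have "\<dots> \<le> local_time X k t"
        by (rule iterate_tendsto(2)[OF X k t])
      finally show ?thesis .
    qed
    then show "\<exists>N. \<forall>n\<ge>N. - (X k s - push (iterate n X) k s) \<le> local_time X k t" by blast
  qed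
  then show "regulator S (\<lambda>s. X k s - push (local_time X) k s) t \<le> local_time X k t"
    by (subst regulator_le_iff[OF lb t nonneg]) auto
  have "iterate n X k t \<le> regulator S (\<lambda>s. X k s - push (local_time X) k s) t" for n
  proof (cases n)
    case (Suc m)
    have "push (iterate m X) k s \<le> push (local_time X) k s" if "s \<in> S" for s
      unfolding push_def using k that
      by (intro sum_mono mult_left_mono iterate_tendsto(2)[OF X] q_nonneg)
    then show ?thesis
      unfolding Suc iterate.simps
      by (intro regulator_antimono lb t bounded_forcing_minus_push[OF X iterate_increasing[OF X] k]) auto
  qed (simp add: regulator_nonneg)
  then show "local_time X k t \<le> regulator S (\<lambda>s. X k s - push (local_time X) k s) t"
    by (intro LIMSEQ_le_const2[OF iterate_tendsto(1)[OF X k t]]) blast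
qed

lemma reflected_nonneg':
  assumes X: "bounded_forcing X" and k: "k \<in> I" and t: "t \<in> S"
  shows "0 \<le> reflected X k t"
  using reflected_nonneg[OF bounded_forcing_minus_push[OF X local_time_increasing[OF X] k] t]
    is_regulator_local_time[OF X] k t
  by (simp add: is_regulator_def reflected_def)

section \<open>Comparison and uniqueness\<close>

lemma bounded_forcing_mono:
  assumes "bounded_forcing X" "increasing (\<lambda>k t. X' k t - X k t)"
  shows "bounded_forcing X'"
  using assms unfolding bounded_forcing_def increasing_def
  by (auto intro: locally_bounded_below_mono)

text \<open>Zero lies below \<open>l\<close>, and one step of the iteration for \<open>X'\<close>
  stays below one step for \<open>X\<close>, which reproduces \<open>l\<close>. Admitting an
  arbitrary solution \<open>l\<close> is what makes uniqueness a corollary.\<close>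

lemma comparison:
  assumes X: "bounded_forcing X" and l: "is_regulator X l"
    and D: "increasing (\<lambda>k t. X' k t - X k t)"
  shows "increasing (\<lambda>k t. l k t - local_time X' k t)" (is ?A)
    and "k \<in> I \<Longrightarrow> t \<in> S \<Longrightarrow> X k t - push l k t + l k t \<le> reflected X' k t"
proof -
  have X': "bounded_forcing X'" by (rule bounded_forcing_mono[OF X D])
  have inc: "increasing l" using l by (simp add: is_regulator_def)
  have step: "increasing (\<lambda>k t. l k t - iterate n X' k t)" for n
  proof (induction n)
    case (Suc n)
    have "increasing (\<lambda>k t. l k t - l' k t) \<longleftrightarrow>
        increasing (\<lambda>k t. regulator S (\<lambda>s. X k s - push l k s) t - l' k t)" for l'
      using l by (simp add: is_regulator_def increasing_def)
    with step_compare(1)[OF X inc D Suc] show ?case by simp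
  qed (simp add: inc)
  show ?A
    by (rule increasing_limit[of "\<lambda>n k t. l k t - iterate n X' k t", OF step])
      (intro tendsto_diff tendsto_const iterate_tendsto(1)[OF X'])
  assume k: "k \<in> I" and t: "t \<in> S"
  show "X k t - push l k t + l k t \<le> reflected X' k t"
  proof (rule LIMSEQ_le_const)
    show "(\<lambda>n. X' k t - push (iterate n X') k t + iterate (Suc n) X' k t) \<longlonglongrightarrow> reflected X' k t"
      unfolding reflected_def
      by (intro tendsto_intros push_tendsto X' k t LIMSEQ_Suc[OF iterate_tendsto(1)])
    show "\<exists>N. \<forall>n\<ge>N. X k t - push l k t + l k t
        \<le> X' k t - push (iterate n X') k t + iterate (Suc n) X' k t"
      using step_compare(2)[OF X inc D step k t] l k t by (simp add: is_regulator_def)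
  qed
qed

text \<open>Comparison of \<open>X\<close> with itself gives minimality of the local time and also
  \<open>(1 - q)(l - local_time X) \<le> 0\<close>; the maximum principle with bound 0 closes the
  gap.\<close>

lemma uniqueness:
  assumes X: "bounded_forcing X" and l: "is_regulator X l" and k: "k \<in> I" and t: "t \<in> S"
  shows "l k t = local_time X k t"
proof -
  have D: "increasing (\<lambda>k t. X k t - X k t)" by (simp add: increasing_def)
  have "l k t - local_time X k t \<le> (\<Sum>i\<in>I. a k i * 0)"
  proof (rule inverse_positive[OF _ k])
    fix i assume "i \<in> I"
    from comparison(2)[OF X l D this t]
    show "l i t - local_time X i t - (\<Sum>j\<in>I. q i j * (l j t - local_time X j t)) \<le> 0"
      by (simp add: reflected_def push_def sum_subtractf right_diff_distrib)
  qed
  moreover have "0 \<le> l k t - local_time X k t"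
    using comparison(1)[OF X l D] k t by (simp add: increasing_def)
  ultimately show ?thesis by simp
qed

lemma reflected_of_regulator:
  assumes "bounded_forcing X" "is_regulator X l" "k \<in> I" "t \<in> S"
  shows "X k t - push l k t + l k t = reflected X k t"
  unfolding reflected_def push_def
  using uniqueness[OF assms(1,2) _ assms(4)] assms(3) by simp

text \<open>Row \<open>k\<close> of the inverse cancels every local time except the
  \<open>k\<close>-th, which enters with coefficient 1.\<close>

lemma weighted_reflected:
  assumes "k \<in> I"
  shows "(\<Sum>i\<in>I. a k i * reflected X i t) = (\<Sum>i\<in>I. a k i * X i t) + local_time X k t"
proof -
  have "(\<Sum>i\<in>I. a k i * reflected X i t) = (\<Sum>i\<in>I. a k i * X i t
      + a k i * (local_time X i t - (\<Sum>j\<in>I. q i j * local_time X j t)))"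
    by (simp add: reflected_def push_def algebra_simps)
  then show ?thesis
    using left_inverse[OF assms, of "\<lambda>i. local_time X i t"] by (simp add: sum.distrib)
qed

section \<open>Dependence on the starting point\<close>

context
  fixes X :: "'k \<Rightarrow> real \<Rightarrow> real" and x :: "'k \<Rightarrow> real"
  assumes X: "bounded_forcing X" and x: "\<And>k. k \<in> I \<Longrightarrow> 0 \<le> x k"
begin

lemma bounded_forcing_shift: "bounded_forcing (\<lambda>k t. x k + X k t)"
  by (rule bounded_forcing_mono[OF X]) (simp add: increasing_def x)

lemma local_time_shift:
  "increasing (\<lambda>k t. local_time X k t - local_time (\<lambda>k t. x k + X k t) k t)"
  by (rule comparison(1)[OF X is_regulator_local_time[OF X]]) (simp add: increasing_def x)

lemma reflected_shift_mono:
  "k \<in> I \<Longrightarrow> t \<in> S \<Longrightarrow> reflected X k t \<le> reflected (\<lambda>k t. x k + X k t) k t"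
  using comparison(2)[OF X is_regulator_local_time[OF X], of "\<lambda>k t. x k + X k t"]
  by (simp add: increasing_def x reflected_def)

lemma weighted_reflected_shift:
  "k \<in> I \<Longrightarrow> (\<Sum>i\<in>I. a k i * (reflected (\<lambda>k t. x k + X k t) i t - reflected X i t)) =
     (\<Sum>i\<in>I. a k i * x i) - (local_time X k t - local_time (\<lambda>k t. x k + X k t) k t)"
  using weighted_reflected[of k X t] weighted_reflected[of k "\<lambda>k t. x k + X k t" t]
  by (simp add: right_diff_distrib sum_subtractf sum.distrib ring_distribs)

text \<open>The local time can only shrink when the starting point rises, so the weighted sum of
  differences is at most that of the initial values; all its terms are nonnegative and the diagonal
  weight is at least 1.\<close>

lemma reflected_shift_le:
  assumes k: "k \<in> I" and t: "t \<in> S"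
  shows "reflected (\<lambda>k t. x k + X k t) k t - reflected X k t \<le> (\<Sum>i\<in>I. a k i * x i)"
proof -
  let ?d = "\<lambda>i. reflected (\<lambda>k t. x k + X k t) i t - reflected X i t"
  have d: "0 \<le> ?d i" if "i \<in> I" for i
    using reflected_shift_mono[OF that t] by simp
  have "?d k \<le> a k k * ?d k"
    using a_diagonal[OF k] d[OF k] mult_right_mono[of 1 "a k k" "?d k"] by simp
  also have "\<dots> \<le> (\<Sum>i\<in>I. a k i * ?d i)"
    using finite_I k d by (intro member_le_sum[where f="\<lambda>i. a k i * ?d i"]) (auto intro: mult_nonneg_nonneg a_nonneg)
  also have "\<dots> \<le> (\<Sum>i\<in>I. a k i * x i)"
    unfolding weighted_reflected_shift[OF k]
    using local_time_shift k t by (auto simp: increasing_def)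
  finally show ?thesis .
qed

text \<open>
  The difference of the local times is monotone and bounded, so the difference of the reflected
  paths converges; it vanishes in the limit because the larger path keeps returning to the
  boundary, where the smaller one is squeezed to zero.
\<close>

lemma reflected_shift_tendsto:
  assumes grows: "\<And>k s. k \<in> I \<Longrightarrow> s \<in> S \<Longrightarrow>
      \<exists>t\<in>S. s \<le> t \<and> local_time (\<lambda>k t. x k + X k t) k s < local_time (\<lambda>k t. x k + X k t) k t"
    and cofinal: "\<And>c. \<exists>s\<in>S. c \<le> s" and k: "k \<in> I"
  shows "((\<lambda>t. reflected (\<lambda>k t. x k + X k t) k t - reflected X k t) \<longlongrightarrow> 0)
    (inf at_top (principal S))"
proof -
  let ?X = "\<lambda>k t. x k + X k t"
  let ?F = "inf at_top (principal S)"
  \<comment> \<open>The filter lets time tend to infinity through \<open>S\<close> only.\<close>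
  have ev: "eventually P ?F \<longleftrightarrow> (\<exists>s\<in>S. \<forall>t\<in>S. s \<le> t \<longrightarrow> P t)" for P
    unfolding eventually_inf_principal eventually_at_top_linorder
    using cofinal by (meson order_trans)
  define d where "d k t = local_time X k t - local_time ?X k t" for k t
  define z where "z k t = reflected ?X k t - reflected X k t" for k t
  have z: "0 \<le> z i t" if "i \<in> I" "t \<in> S" for i t
    using reflected_shift_mono[OF that] by (simp add: z_def)
  have d_bound: "d i t \<le> (\<Sum>j\<in>I. a i j * x j)" if i: "i \<in> I" "t \<in> S" for i t
  proof -
    have "0 \<le> (\<Sum>j\<in>I. a i j * z j t)"
      using z that by (auto intro!: sum_nonneg mult_nonneg_nonneg a_nonneg)
    then show ?thesis
      using weighted_reflected_shift[OF i(1), of t] by (simp add: d_def z_def)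
  qed
  \<comment> \<open>A nondecreasing bounded function converges along \<open>S\<close> to its
    supremum.\<close>
  have d_lim: "\<exists>D. (d i \<longlongrightarrow> D) ?F" if i: "i \<in> I" for i
  proof
    have ne: "S \<noteq> {}" using cofinal by blast
    have bdd: "bdd_above (d i ` S)" by (rule bdd_aboveI2) (rule d_bound[OF i])
    show "(d i \<longlongrightarrow> (SUP t\<in>S. d i t)) ?F"
    proof (rule order_tendstoI)
      fix c assume "c < (SUP t\<in>S. d i t)"
      then obtain s where s: "s \<in> S" "c < d i s"
        using less_cSUP_iff[OF ne bdd] by blast
      then show "eventually (\<lambda>t. c < d i t) ?F"
        using local_time_shift i unfolding ev d_def increasing_def
        by (meson less_le_trans)
    next
      fix c assume c: "(SUP t\<in>S. d i t) < c"
      have "d i t < c" if "t \<in> S" for t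
        using cSUP_upper[OF that bdd] c by simp
      then show "eventually (\<lambda>t. d i t < c) ?F"
        using ne unfolding ev by blast
    qed
  qed
  then obtain D where D: "\<And>i. i \<in> I \<Longrightarrow> (d i \<longlongrightarrow> D i) ?F" by metis
  \<comment> \<open>The difference of paths is an affine function of the differences of local times,
    so it inherits their convergence.\<close>
  have z_eq: "z i t = x i - (d i t - (\<Sum>j\<in>I. q i j * d j t))" for i t
    by (simp add: z_def d_def reflected_def push_def sum_subtractf right_diff_distrib)
  define L where "L = x k - (D k - (\<Sum>j\<in>I. q k j * D j))"
  have lim: "(z k \<longlongrightarrow> L) ?F"
    unfolding z_eq L_def by (intro tendsto_intros D k)
  have nt: "?F \<noteq> bot"
    using ev[of "\<lambda>_. False"] by (auto simp: trivial_limit_def)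
  have "0 \<le> L"
    using z[OF k] cofinal by (intro tendsto_lowerbound[OF lim _ nt]) (auto simp: ev)
  moreover have "\<not> 0 < L"
  proof
    assume "0 < L"
    then have "eventually (\<lambda>t. L / 2 < z k t) ?F"
      using order_tendstoD(1)[OF lim, of "L/2"] by simp
    then obtain s where s: "s \<in> S" "\<And>t. t \<in> S \<Longrightarrow> s \<le> t \<Longrightarrow> L / 2 < z k t"
      unfolding ev by blast
    obtain t where t: "t \<in> S" "s \<le> t" "local_time ?X k s < local_time ?X k t"
      using grows[OF k s(1)] by blast
    have reg: "local_time ?X k u = regulator S (\<lambda>v. ?X k v - push (local_time ?X) k v) u"
      if "u \<in> S" for u
      using is_regulator_local_time[OF bounded_forcing_shift] k that by (simp add: is_regulator_def)
    \<comment> \<open>Growth of the local time after \<open>s\<close> forces the larger path down to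
      \<open>L / 2\<close>, while the smaller path stays nonnegative.\<close>
    obtain u where u: "u \<in> S" "s \<le> u" "u \<le> t"
        "?X k u - push (local_time ?X) k u + regulator S (\<lambda>v. ?X k v - push (local_time ?X) k v) u \<le> L / 2"
      using regulator_increase_near_zero[OF bounded_forcing_minus_push[OF bounded_forcing_shift
          local_time_increasing[OF bounded_forcing_shift] k] s(1) t(1,2), of "L/2"] t(3) \<open>0 < L\<close>
      unfolding reg[OF t(1)] reg[OF s(1)] by auto
    then have "reflected ?X k u \<le> L / 2"
      by (simp add: reflected_def reg)
    then show False
      using s(2)[OF u(1,2)] reflected_nonneg'[OF X k u(1)] by (simp add: z_def)
  qed
  ultimately have "L = 0" by simp
  with lim show ?thesis by (simp add: z_def[abs_def])
qed

end

section \<open>Measurability of the reflection map\<close>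

lemma local_time_borel_measurable:
  assumes S: "countable S"
    and X: "\<And>k s. k \<in> I \<Longrightarrow> s \<in> S \<Longrightarrow> (\<lambda>\<omega>. X \<omega> k s) \<in> borel_measurable M"
    and k: "k \<in> I"
  shows "(\<lambda>\<omega>. local_time (X \<omega>) k t) \<in> borel_measurable M"
proof -
  have "(\<lambda>\<omega>. iterate n (X \<omega>) k t) \<in> borel_measurable M" if "k \<in> I" for n k t
    using that
  proof (induction n arbitrary: k t)
    case (Suc n)
    show ?case
      unfolding iterate.simps push_def
      by (intro regulator_borel_measurable[OF S] borel_measurable_diff borel_measurable_sum
          borel_measurable_times borel_measurable_const Suc X)
  qed simp
  then show ?thesis
    unfolding local_time_def using k by (intro borel_measurable_lim_metric)
qed

lemma reflected_borel_measurable: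
  assumes "countable S"
    and "\<And>k s. k \<in> I \<Longrightarrow> s \<in> S \<Longrightarrow> (\<lambda>\<omega>. X \<omega> k s) \<in> borel_measurable M"
    and "k \<in> I" "t \<in> S"
  shows "(\<lambda>\<omega>. reflected (X \<omega>) k t) \<in> borel_measurable M"
  unfolding reflected_def push_def
  by (intro borel_measurable_diff borel_measurable_add borel_measurable_sum
      borel_measurable_times borel_measurable_const local_time_borel_measurable assms)

end

section \<open>The collision matrix\<close>

text \<open>Row \<open>k\<close> lists how the neighbouring local times reduce gap \<open>k\<close>.
  Its own local time enters with \<open>qp (Suc k) + qm k = 1\<close>, which is the identity in
  \<open>1 - q\<close>; hence the zero diagonal.\<close>

definition collision_matrix :: "(nat \<Rightarrow> real) \<Rightarrow> (nat \<Rightarrow> real) \<Rightarrow> nat \<Rightarrow> nat \<Rightarrow> real" where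
  "collision_matrix qp qm k j = (if j = Suc k then qm j else 0) + (if k = Suc j then qp k else 0)"

lemma collision_matrix_sum:
  assumes "k \<in> {1..<n}"
  shows "(\<Sum>j\<in>{1..<n}. collision_matrix qp qm k j * x j) =
    (if Suc k < n then qm (Suc k) * x (Suc k) else 0) + (if 1 < k then qp k * x (k - 1) else 0)"
proof -
  have "(\<Sum>j\<in>{1..<n}. collision_matrix qp qm k j * x j) =
      (\<Sum>j\<in>{1..<n}. if j = Suc k then qm j * x j else 0)
      + (\<Sum>j\<in>{1..<n}. if j = k - 1 then qp k * x j else 0)"
    unfolding sum.distrib[symmetric] collision_matrix_def using assms
    by (intro sum.cong) (auto simp: algebra_simps)
  then show ?thesis
    using assms by auto
qed

text \<open>
  The weights \<open>w\<close> are chosen so that in \<open>\<Sum>j. w j * Y j\<close> all collision terms cancel.  The row \<open>k\<close>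
  of the inverse matrix expresses the difference of the weighted means of the particles
  \<open>k + 1, \<dots>, n\<close> and \<open>1, \<dots>, k\<close> through the gaps; this difference only feels the collisions
  of \<open>k\<close> with \<open>k + 1\<close>.
\<close>

lemma collision_matrix_inverse:
  fixes qp qm :: "nat \<Rightarrow> real"
  assumes q_sum: "\<And>n. n \<ge> 1 \<Longrightarrow> qp (Suc n) + qm n = 1"
    and qp: "\<And>n. n \<ge> 1 \<Longrightarrow> 0 < qp n" and qm: "\<And>n. n \<ge> 1 \<Longrightarrow> 0 < qm n"
  shows "\<exists>a. (\<forall>k\<in>{1..<n}. 0 < a k 1) \<and>
    skorokhod_orthant {1..<n} (collision_matrix qp qm) a"
proof -
  \<comment> \<open>\<open>w i\<close> is the weight of particle \<open>i + 1\<close>. The ratio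
    makes the pushes of one collision on its two particles cancel in the weighted sum.\<close>
  define w where "w = rec_nat (1::real) (\<lambda>i w. w * qm (Suc i) / qp (Suc (Suc i)))"
  define W where "W j = (\<Sum>i<j. w i)" for j
  have w_pos: "0 < w i" for i
    by (induction i) (auto simp: w_def qp qm)
  have w_Suc: "w (Suc i) * qp (Suc (Suc i)) = w i * qm (Suc i)" for i
    using qp[of "Suc (Suc i)"] by (simp add: w_def)
  have W_Suc: "W (Suc j) = W j + w j" for j
    by (simp add: W_def)
  have W_0: "W 0 = 0" by (simp add: W_def)
  have W_less: "W i < W j" if "i < j" for i j
    by (rule lift_Suc_mono_less[OF _ that]) (simp add: W_Suc w_pos)
  have W_le: "W i \<le> W j" if "i \<le> j" for i j
    using W_less[of i j] that by (cases "i = j") auto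
  \<comment> \<open>Normalizes the kink of row \<open>k\<close> at column \<open>k\<close> to
    1.\<close>
  define c where "c k = 1 / (w (k - 1) * qm k * (1 / (W n - W k) + 1 / W k))" for k
  \<comment> \<open>This is a Green function. \<open>W\<close> is harmonic for the walk that steps
    from \<open>j\<close> to \<open>j - 1\<close> with probability \<open>qm j\<close> and to
    \<open>j + 1\<close> with probability \<open>qp (Suc j)\<close>; row \<open>k\<close> is linear
    in \<open>W\<close> on either side of \<open>k\<close> and vanishes at 0 and
    \<open>n\<close>.\<close>
  define a where "a k i = c k * (if k \<le> i then (W n - W i) / (W n - W k) else W i / W k)" for k i
  have c_pos: "0 < c k" if "k \<in> {1..<n}" for k
    using that W_less[of k n] W_less[of 0 k] unfolding c_def W_0
    by (intro divide_pos_pos mult_pos_pos add_pos_pos w_pos qm) auto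
  have a_nonneg: "0 \<le> a k i" if "k \<in> {1..<n}" "i \<le> n" for k i
    using that W_less[of k n] W_less[of 0 k] W_le[of i n] W_le[of 0 i] c_pos[of k] unfolding a_def W_0
    by (auto intro!: mult_nonneg_nonneg divide_nonneg_nonneg)
  have a_n: "a k n = 0" if "k \<in> {1..<n}" for k
    using that by (simp add: a_def)
  have a_0: "a k 0 = 0" if "k \<in> {1..<n}" for k
    using that by (simp add: a_def W_0)
  \<comment> \<open>The columns of \<open>a (1 - q)\<close>. Since row \<open>k\<close> vanishes at
    0 and \<open>n\<close>, the same formula covers the first and the last column.\<close>
  have key: "a k j - a k (j - 1) * qm j - a k (Suc j) * qp (Suc j) = of_bool (j = k)"
    if k: "k \<in> {1..<n}" and j: "j \<in> {1..<n}" for k j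
  proof -
    obtain i where i: "j = Suc i" using j by (cases j) auto
    have qm_eq: "qm (Suc i) = 1 - qp (Suc (Suc i))" using q_sum[of "Suc i"] by simp
    have W1: "W n - W k > 0" "W k > 0" using k W_less[of k n] W_less[of 0 k] by (auto simp: W_0)
    consider "j < k" | "j > k" | "j = k" by linarith
    then show ?thesis
    proof cases
      case 1
      have eq: "W (Suc i) - W i * qm (Suc i) - W (Suc (Suc i)) * qp (Suc (Suc i)) = 0"
        using w_Suc[of i] by (simp add: W_Suc qm_eq algebra_simps)
      have "a k (Suc (Suc i)) = c k * (W (Suc (Suc i)) / W k)"
        using 1 i W1 by (cases "Suc (Suc i) = k") (auto simp: a_def)
      then have "a k j - a k (j - 1) * qm j - a k (Suc j) * qp (Suc j)
          = c k / W k * (W (Suc i) - W i * qm (Suc i) - W (Suc (Suc i)) * qp (Suc (Suc i)))"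
        using 1 i by (simp add: a_def algebra_simps diff_divide_distrib add_divide_distrib)
      with eq show ?thesis using 1 by simp
    next
      case 2
      have eq: "(W n - W (Suc i)) - (W n - W i) * qm (Suc i) - (W n - W (Suc (Suc i))) * qp (Suc (Suc i)) = 0"
        using w_Suc[of i] by (simp add: W_Suc qm_eq algebra_simps)
      have "a k j - a k (j - 1) * qm j - a k (Suc j) * qp (Suc j)
          = c k / (W n - W k) * ((W n - W (Suc i)) - (W n - W i) * qm (Suc i) - (W n - W (Suc (Suc i))) * qp (Suc (Suc i)))"
        using 2 i by (simp add: a_def algebra_simps diff_divide_distrib add_divide_distrib)
      with eq show ?thesis using 2 by simp
    next
      case 3
      have "a k j - a k (j - 1) * qm j - a k (Suc j) * qp (Suc j)
        = c k * (1 - W i / W k * qm j - (W n - W (Suc j)) / (W n - W k) * qp (Suc j))"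
      proof -
        have k_eq: "k = Suc i" using 3 i by simp
        show ?thesis
          unfolding i using W1 unfolding k_eq by (simp add: a_def algebra_simps)
      qed
      also have "1 - W i / W k * qm j - (W n - W (Suc j)) / (W n - W k) * qp (Suc j)
        = qm j * (w i / W k) + qp (Suc j) * (w (Suc i) / (W n - W k))"
      proof -
        have "1 - W i / W k * qm j - (W n - W (Suc j)) / (W n - W k) * qp (Suc j)
          = qm j * (1 - W i / W k) + qp (Suc j) * (1 - (W n - W (Suc j)) / (W n - W k))"
          using i by (simp add: qm_eq algebra_simps)
        also have "1 - W i / W k = w i / W k"
          using W1 3 i W_Suc[of i] by (simp add: field_simps)
        also have "1 - (W n - W (Suc j)) / (W n - W k) = w (Suc i) / (W n - W k)"
          using W1 3 i by (simp add: W_Suc field_simps)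
        finally show ?thesis .
      qed
      also have "\<dots> = w i * qm j * (1 / (W n - W k) + 1 / W k)"
        using w_Suc[of i] i by (simp add: algebra_simps add_divide_distrib)
      also have "c k * \<dots> = 1"
      proof -
        have k_eq: "k = Suc i" using 3 i by simp
        define e where "e = w i * qm k * (1 / (W n - W k) + 1 / W k)"
        have "0 < e"
          unfolding e_def using W1 k by (intro mult_pos_pos add_pos_pos w_pos qm) auto
        moreover have "c k = 1 / e" using k_eq by (simp add: c_def e_def)
        ultimately show ?thesis unfolding 3 e_def[symmetric] by simp
      qed
      finally show ?thesis using 3 by simp
    qed
  qed
  have "(\<Sum>i\<in>{1..<n}. a k i * (x i - (\<Sum>j\<in>{1..<n}. collision_matrix qp qm i j * x j))) = x k"
    if k: "k \<in> {1..<n}" for k x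
  proof -
    have transpose: "(\<Sum>i\<in>{1..<n}. a k i * collision_matrix qp qm i j) =
        a k (j - 1) * qm j + a k (Suc j) * qp (Suc j)" if j: "j \<in> {1..<n}" for j
    proof -
      have "(\<Sum>i\<in>{1..<n}. a k i * collision_matrix qp qm i j) =
        (\<Sum>i\<in>{1..<n}. if i = j - 1 then a k i * qm j else 0)
        + (\<Sum>i\<in>{1..<n}. if i = Suc j then a k i * qp i else 0)"
        unfolding sum.distrib[symmetric] collision_matrix_def using j
        by (intro sum.cong) (auto simp: algebra_simps)
      moreover have "j = 1 \<or> 1 < j" "Suc j = n \<or> Suc j < n" using j by auto
      ultimately show ?thesis using a_0[OF k] a_n[OF k] by auto
    qed
    have "(\<Sum>i\<in>{1..<n}. a k i * (x i - (\<Sum>j\<in>{1..<n}. collision_matrix qp qm i j * x j)))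
      = (\<Sum>i\<in>{1..<n}. a k i * x i) - (\<Sum>i\<in>{1..<n}. \<Sum>j\<in>{1..<n}. a k i * collision_matrix qp qm i j * x j)"
      by (simp add: right_diff_distrib sum_subtractf sum_distrib_left mult.assoc)
    also have "(\<Sum>i\<in>{1..<n}. \<Sum>j\<in>{1..<n}. a k i * collision_matrix qp qm i j * x j)
      = (\<Sum>j\<in>{1..<n}. (\<Sum>i\<in>{1..<n}. a k i * collision_matrix qp qm i j) * x j)"
      by (subst sum.swap) (simp add: sum_distrib_right)
    also have "(\<Sum>i\<in>{1..<n}. a k i * x i) - \<dots>
      = (\<Sum>j\<in>{1..<n}. (a k j - a k (j - 1) * qm j - a k (Suc j) * qp (Suc j)) * x j)"
      unfolding sum_subtractf[symmetric]
    proof (intro sum.cong refl)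
      fix j assume "j \<in> {1..<n}"
      show "a k j * x j - (\<Sum>i\<in>{1..<n}. a k i * collision_matrix qp qm i j) * x j =
          (a k j - a k (j - 1) * qm j - a k (Suc j) * qp (Suc j)) * x j"
        unfolding transpose[OF \<open>j \<in> {1..<n}\<close>] by (simp add: algebra_simps)
    qed
    also have "\<dots> = (\<Sum>j\<in>{1..<n}. if j = k then x j else 0)"
    proof (intro sum.cong refl)
      fix j assume "j \<in> {1..<n}"
      show "(a k j - a k (j - 1) * qm j - a k (Suc j) * qp (Suc j)) * x j = (if j = k then x j else 0)"
        unfolding key[OF k \<open>j \<in> {1..<n}\<close>] by simp
    qed
    finally show ?thesis using k by simp
  qed
  \<comment> \<open>This entry multiplies the noise of the first particle in the combination of
    gaps, so its positivity keeps the variance of that combination away from zero.\<close>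
  moreover have "0 < a k 1" if "k \<in> {1..<n}" for k
    using that c_pos[OF that] W_less[of k n] W_less[of 0 k] W_less[of 0 1]
    by (cases "k = 1") (auto simp: a_def W_0)
  moreover have "0 \<le> collision_matrix qp qm i j" if "i \<in> {1..<n}" "j \<in> {1..<n}" for i j
    using qp[of i] qm[of j] that by (auto simp: collision_matrix_def)
  ultimately show ?thesis
    using a_nonneg unfolding skorokhod_orthant_def by (intro exI[of _ a]) auto
qed

section \<open>Laws of Brownian paths\<close>

context usual_conditions
begin

lemma measurable_F:
  assumes "0 \<le> t" "f \<in> measurable (F t) N"
  shows "f \<in> measurable M N"
  using assms sets_F_subset[OF assms(1)] space_F[of t] 
  by (auto simp: measurable_def)

lemma adapted_measurable: "adapted X \<Longrightarrow> 0 \<le> t \<Longrightarrow> X t \<in> borel_measurable M"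
  by (auto simp: adapted_def intro: measurable_F)

lemma adapted_measurable_later:
  assumes "adapted X" "0 \<le> s" "s \<le> t"
  shows "X s \<in> borel_measurable (F t)"
proof -
  have "X s \<in> borel_measurable (F s)" using assms by (auto simp: adapted_def)
  then show ?thesis
    using sets_F_mono[OF assms(3)] by (auto simp: measurable_def space_F)
qed

text \<open>The values up to the latest time \<open>s\<close> are measurable for \<open>F s\<close>,
  and the next increment is independent of \<open>F s\<close>; hence the joint law is the image of a
  product.\<close>

lemma brownian_extend_law:
  assumes W: "brownian_motion W" and J: "finite J" "J \<subseteq> {0..b}" "s \<in> J" and sb: "\<And>u. u \<in> J \<Longrightarrow> u \<le> s" "s < b"
  shows "distr M (PiM (insert b J) (\<lambda>_. borel)) (\<lambda>\<omega>. \<lambda>u\<in>insert b J. W u \<omega>) =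
    distr (distr M (PiM J (\<lambda>_. borel)) (\<lambda>\<omega>. \<lambda>u\<in>J. W u \<omega>)
        \<Otimes>\<^sub>M density lborel (normal_density 0 (sqrt (b - s))))
      (PiM (insert b J) (\<lambda>_. borel)) (\<lambda>(x, v). x(b := x s + v))"
proof -
  let ?PJ = "PiM J (\<lambda>_. borel :: real measure)"
  let ?X = "\<lambda>\<omega>. \<lambda>u\<in>J. W u \<omega>" and ?D = "\<lambda>\<omega>. W b \<omega> - W s \<omega>"
  have s0: "0 \<le> s" using J by auto
  have ad: "adapted W" using W by (simp add: brownian_motion_def)
  have dist: "distributed M lborel ?D (normal_density 0 (sqrt (b - s)))"
    and ind: "indep_set (sets (F s)) {?D -` A \<inter> space M |A. A \<in> sets borel}"
    using W s0 sb(2) unfolding brownian_motion_def by auto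
  have XF: "?X \<in> measurable (F s) ?PJ"
    using J sb by (intro measurable_restrict adapted_measurable_later[OF ad]) auto
  then have X: "?X \<in> measurable M ?PJ" by (rule measurable_F[OF s0])
  have D: "?D \<in> borel_measurable M"
    using s0 sb(2) by (intro borel_measurable_diff adapted_measurable[OF ad]) auto
  interpret X: prob_space "distr M ?PJ ?X" by (rule prob_space_distr[OF X])
  interpret D: prob_space "distr M borel ?D" by (rule prob_space_distr[OF D])
  have joint: "distr M ?PJ ?X \<Otimes>\<^sub>M distr M borel ?D = distr M (?PJ \<Otimes>\<^sub>M borel) (\<lambda>\<omega>. (?X \<omega>, ?D \<omega>))"
  proof (rule pair_measure_eqI)
    fix A E assume A: "A \<in> sets (distr M ?PJ ?X)" and E: "E \<in> sets (distr M borel ?D)"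
    have "?X -` A \<inter> space M \<in> sets (F s)"
      using measurable_sets[OF XF, of A] A by (simp add: space_F)
    with ind E have "prob ((?X -` A \<inter> space M) \<inter> (?D -` E \<inter> space M))
        = prob (?X -` A \<inter> space M) * prob (?D -` E \<inter> space M)"
      by (intro indep_setD[where A="sets (F s)"]) auto
    moreover have "(\<lambda>\<omega>. (?X \<omega>, ?D \<omega>)) -` (A \<times> E) \<inter> space M
        = (?X -` A \<inter> space M) \<inter> (?D -` E \<inter> space M)" by auto
    moreover have "A \<times> E \<in> sets (?PJ \<Otimes>\<^sub>M borel)"
      using A E by (intro pair_measureI) auto
    ultimately show "emeasure (distr M ?PJ ?X) A * emeasure (distr M borel ?D) E
        = emeasure (distr M (?PJ \<Otimes>\<^sub>M borel) (\<lambda>\<omega>. (?X \<omega>, ?D \<omega>))) (A \<times> E)"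
      using A E X D measurable_Pair[OF X D]
      by (simp add: emeasure_distr emeasure_eq_measure ennreal_mult)
  qed (auto intro: X.sigma_finite_measure_axioms D.sigma_finite_measure_axioms)
  have Dlaw: "distr M borel ?D = density lborel (normal_density 0 (sqrt (b - s)))"
    using dist by (simp add: distributed_def cong: distr_cong)
  have f: "(\<lambda>(x, v). x(b := x s + v)) \<in> measurable (?PJ \<Otimes>\<^sub>M borel) (PiM (insert b J) (\<lambda>_. borel :: real measure))"
    using J by measurable
  have "(\<lambda>\<omega>. \<lambda>u\<in>insert b J. W u \<omega>) = (\<lambda>(x, v). x(b := x s + v)) \<circ> (\<lambda>\<omega>. (?X \<omega>, ?D \<omega>))"
    using J sb by (auto simp: fun_eq_iff restrict_def)
  then show ?thesis
    unfolding Dlaw[symmetric] joint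
    using distr_distr[OF f measurable_Pair[OF X D]] by simp
qed

lemma brownian_at_0: "brownian_motion W \<Longrightarrow> AE \<omega> in M. W 0 \<omega> = 0"
  by (auto simp: brownian_motion_def)

end

text \<open>Induction by adding the latest time. Time 0 stays in the index set, so that a previous
  time always exists and the base case is a point mass.\<close>

lemma brownian_finite_law_unique:
  assumes "usual_conditions M F" "usual_conditions.brownian_motion M F W"
    and "usual_conditions M' F'" "usual_conditions.brownian_motion M' F' W'"
    and "finite J" "J \<subseteq> {0..}"
  shows "distr M (PiM (insert 0 J) (\<lambda>_. borel)) (\<lambda>\<omega>. \<lambda>u\<in>insert 0 J. W u \<omega>) =
    distr M' (PiM (insert 0 J) (\<lambda>_. borel)) (\<lambda>\<omega>. \<lambda>u\<in>insert 0 J. W' u \<omega>)"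
proof -
  interpret A: usual_conditions M F by fact
  interpret B: usual_conditions M' F' by fact
  note W = assms(2) and W' = assms(4)
  have adW: "A.adapted W" "B.adapted W'"
    using W W' by (auto simp: A.brownian_motion_def B.brownian_motion_def)
  show ?thesis
    using assms(5,6)
  proof (induction J rule: finite_linorder_max_induct)
    case empty
    let ?P = "PiM {0} (\<lambda>_. borel :: real measure)"
    have "distr M ?P (\<lambda>\<omega>. \<lambda>u\<in>{0}. W u \<omega>) = distr M ?P (\<lambda>\<omega>. \<lambda>u\<in>{0}. 0)"
      using A.brownian_at_0[OF W] A.adapted_measurable[OF adW(1), of 0]
      by (intro distr_cong_AE measurable_restrict) (auto intro!: restrict_ext)
    also have "\<dots> = return ?P (\<lambda>u\<in>{0}. 0)"
      by (rule A.distr_const) (auto simp: space_PiM)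
    also have "\<dots> = distr M' ?P (\<lambda>\<omega>. \<lambda>u\<in>{0}. 0)"
      by (rule B.distr_const[symmetric]) (auto simp: space_PiM)
    also have "\<dots> = distr M' ?P (\<lambda>\<omega>. \<lambda>u\<in>{0}. W' u \<omega>)"
      using B.brownian_at_0[OF W'] B.adapted_measurable[OF adW(2), of 0]
      by (intro distr_cong_AE measurable_restrict) (auto intro!: restrict_ext)
    finally show ?case .
  next
    case (insert b J)
    show ?case
    proof (cases "b = 0")
      case True
      with insert.hyps insert.prems have "J = {}" by fastforce
      with True have eq: "insert 0 (insert b J) = insert 0 J" by simp
      show ?thesis
        unfolding eq using insert.prems by (intro insert.IH) auto
    next
      case False
      with insert.prems have b: "0 < b" by auto
      define s where "s = Max (insert 0 J)"
      have s: "s \<in> insert 0 J" "\<And>u. u \<in> insert 0 J \<Longrightarrow> u \<le> s"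
        unfolding s_def using insert.hyps Max_in[of "insert 0 J"] by (auto simp del: Max_insert)
      have "s < b" using s(1) insert.hyps b by auto
      have J: "finite (insert 0 J)" "insert 0 J \<subseteq> {0..b}"
        using insert.hyps insert.prems b by (force intro: less_imp_le)+
      have J0: "J \<subseteq> {0..}" using insert.prems by simp
      have ins: "insert 0 (insert b J) = insert b (insert 0 J)" by auto
      show ?thesis
        unfolding ins
        by (rule trans[OF A.brownian_extend_law[OF W J s \<open>s < b\<close>]
              trans[OF _ B.brownian_extend_law[OF W' J s \<open>s < b\<close>, symmetric]]])
          (simp_all only: insert.IH[OF J0])
    qed
  qed
qed

text \<open>Cylinder sets determine a law on path space, and each of them depends on finitely many
  times.\<close>

lemma brownian_law_unique:
  assumes "usual_conditions M F" "usual_conditions.brownian_motion M F W"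
    and "usual_conditions M' F'" "usual_conditions.brownian_motion M' F' W'"
  shows "distr M (PiM {0..} (\<lambda>_. borel)) (\<lambda>\<omega>. \<lambda>u\<in>{0..}. W u \<omega>) =
    distr M' (PiM {0..} (\<lambda>_. borel)) (\<lambda>\<omega>. \<lambda>u\<in>{0..}. W' u \<omega>)"
proof -
  interpret A: usual_conditions M F by fact
  interpret B: usual_conditions M' F' by fact
  have ad: "A.adapted W" "B.adapted W'"
    using assms by (auto simp: A.brownian_motion_def B.brownian_motion_def)
  let ?P = "\<lambda>J. PiM J (\<lambda>_. borel :: real measure)"
  \<comment> \<open>The finite-dimensional laws are known on index sets containing 0, so the
    cylinder over \<open>J\<close> is evaluated there.\<close>
  have cyl: "emeasure (distr N (?P {0..}) (\<lambda>\<omega>. \<lambda>u\<in>{0..}. V u \<omega>)) (prod_emb {0..} (\<lambda>_. borel) J (Pi\<^sub>E J E))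
      = emeasure (distr N (?P (insert 0 J)) (\<lambda>\<omega>. \<lambda>u\<in>insert 0 J. V u \<omega>)) (prod_emb (insert 0 J) (\<lambda>_. borel) J (Pi\<^sub>E J E))"
    if V: "\<And>u. 0 \<le> u \<Longrightarrow> V u \<in> borel_measurable N" and J: "finite J" "J \<subseteq> {0..}"
      and E: "\<And>u. u \<in> J \<Longrightarrow> E u \<in> sets borel"
    for N :: "'x measure" and V :: "real \<Rightarrow> 'x \<Rightarrow> real" and J E
  proof -
    have "(\<lambda>\<omega>. \<lambda>u\<in>{0..}. V u \<omega>) \<in> measurable N (?P {0..})"
      "(\<lambda>\<omega>. \<lambda>u\<in>insert 0 J. V u \<omega>) \<in> measurable N (?P (insert 0 J))"
      using V J by (auto intro!: measurable_restrict)
    moreover have "(\<lambda>\<omega>. \<lambda>u\<in>{0..}. V u \<omega>) -` prod_emb {0..} (\<lambda>_. borel) J (Pi\<^sub>E J E)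
      = (\<lambda>\<omega>. \<lambda>u\<in>insert 0 J. V u \<omega>) -` prod_emb (insert 0 J) (\<lambda>_. borel) J (Pi\<^sub>E J E)"
      using J(2) by (auto simp: prod_emb_def PiE_iff extensional_def subset_eq)
    moreover have "prod_emb {0..} (\<lambda>_. borel) J (Pi\<^sub>E J E) \<in> sets (?P {0..})"
      "prod_emb (insert 0 J) (\<lambda>_. borel) J (Pi\<^sub>E J E) \<in> sets (?P (insert 0 J))"
      using J E by (auto intro!: sets_PiM_I)
    ultimately show ?thesis
      by (simp add: emeasure_distr)
  qed
  show ?thesis
  proof (rule measure_eqI_PiM_infinite)
    fix J :: "real set" and E assume J: "finite J" "J \<subseteq> {0..}" and E: "\<And>u. u \<in> J \<Longrightarrow> E u \<in> sets (borel :: real measure)"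
    show "emeasure (distr M (?P {0..}) (\<lambda>\<omega>. \<lambda>u\<in>{0..}. W u \<omega>)) (prod_emb {0..} (\<lambda>_. borel) J (Pi\<^sub>E J E)) =
      emeasure (distr M' (?P {0..}) (\<lambda>\<omega>. \<lambda>u\<in>{0..}. W' u \<omega>)) (prod_emb {0..} (\<lambda>_. borel) J (Pi\<^sub>E J E))"
      using cyl[OF A.adapted_measurable[OF ad(1)] J E] cyl[OF B.adapted_measurable[OF ad(2)] J E]
        brownian_finite_law_unique[OF assms J] by simp
  next
    show "finite_measure (distr M (?P {0..}) (\<lambda>\<omega>. \<lambda>u\<in>{0..}. W u \<omega>))"
    proof -
      have "prob_space (distr M (?P {0..}) (\<lambda>\<omega>. \<lambda>u\<in>{0..}. W u \<omega>))"
        by (intro A.prob_space_distr measurable_restrict A.adapted_measurable[OF ad(1)]) simp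
      then show ?thesis by (simp add: prob_space_def)
    qed
  qed simp_all
qed

text \<open>The density is at most \<open>1 / s\<close> whatever the mean, so an arbitrary drift
  does not affect the bound.\<close>

lemma normal_concentration:
  assumes "0 < s" "0 \<le> C"
  shows "measure (density lborel (normal_density m s)) {-C..C} \<le> 2 * C / s"
proof -
  have bound: "normal_density m s x \<le> 1 / s" for x
  proof -
    have "1 \<le> sqrt (2 * pi)" using pi_gt3 by simp
    then have "s \<le> sqrt (2 * pi * s\<^sup>2)"
      using assms by (simp add: real_sqrt_mult mult_le_cancel_right1)
    moreover have "exp (- (x - m)\<^sup>2 / (2 * s\<^sup>2)) \<le> 1" by simp
    ultimately have "exp (- (x - m)\<^sup>2 / (2 * s\<^sup>2)) / sqrt (2 * pi * s\<^sup>2) \<le> 1 / s"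
      using assms by (intro frac_le) auto
    then show ?thesis by (simp add: normal_density_def)
  qed
  have "emeasure (density lborel (normal_density m s)) {-C..C}
      = (\<integral>\<^sup>+x. ennreal (normal_density m s x) * indicator {-C..C} x \<partial>lborel)"
    by (subst emeasure_density) auto
  also have "\<dots> \<le> (\<integral>\<^sup>+x. ennreal (1 / s) * indicator {-C..C} x \<partial>lborel)"
    by (intro nn_integral_mono mult_right_mono ennreal_leI bound) auto
  also have "\<dots> = ennreal (1 / s) * ennreal (2 * C)"
    using assms by (simp add: nn_integral_cmult_indicator)
  also have "\<dots> = ennreal (2 * C / s)"
    using assms by (simp add: ennreal_mult[symmetric])
  finally show ?thesis
    using assms by (simp add: measure_def enn2real_leI)
qed

section \<open>Ranked systems as solutions of the Skorokhod problem\<close>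

text \<open>Positivity of \<open>z\<close> puts \<open>l\<close> above the regulator. If
  \<open>l\<close> were larger, \<open>z\<close> would stay away from zero while \<open>l\<close>
  grows, which the vanishing collision integral excludes.\<close>

lemma regulator_unique:
  fixes z l f :: "real \<Rightarrow> real"
  assumes S: "S \<subseteq> {0..}" "\<rat> \<inter> {0..} \<subseteq> S"
    and eq: "\<And>s. 0 \<le> s \<Longrightarrow> z s = f s + l s" and z_nonneg: "\<And>s. 0 \<le> s \<Longrightarrow> 0 \<le> z s"
    and cont: "continuous_on {0..} z" "continuous_on {0..} l"
    and l: "l 0 = 0" "mono_on {0..} l"
    and collision: "(\<integral>\<^sup>+s\<in>{0..}. ennreal (z s) \<partial>interval_measure (\<lambda>s. l (max 0 s))) = 0"
  shows "locally_bounded_below S f" and "t \<in> S \<Longrightarrow> l t = regulator S f t"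
proof -
  have mono: "l s \<le> l t" if "0 \<le> s" "s \<le> t" for s t
    using monotone_onD[OF l(2)] that by auto
  show lb: "locally_bounded_below S f"
    unfolding locally_bounded_below_def
  proof
    fix t assume "t \<in> S"
    have "- l t \<le> f s" if "s \<in> S" "s \<le> t" for s
      using eq[of s] z_nonneg[of s] mono[of s t] that S(1) by auto
    then show "\<exists>c. \<forall>s\<in>S. s \<le> t \<longrightarrow> c \<le> f s" by blast
  qed
  assume t: "t \<in> S"
  then have t0: "0 \<le> t" using S by auto
  show "l t = regulator S f t"
  proof (rule antisym)
    have "0 \<le> l t" using mono[of 0 t] l t0 by simp
    moreover have "- f s \<le> l t" if "s \<in> S" "s \<le> t" for s
      using eq[of s] z_nonneg[of s] mono[of s t] that S(1) by auto
    ultimately show "regulator S f t \<le> l t"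
      by (subst regulator_le_iff[OF lb t]) auto
    show "l t \<le> regulator S f t"
    proof (rule ccontr)
      define r where "r = regulator S f t"
      \<comment> \<open>Half of the excess: \<open>l\<close> crosses the level \<open>r + d\<close>
        at some \<open>u\<close> and still gains \<open>d\<close> until \<open>t\<close>, while
        \<open>z\<close> is at least \<open>d\<close> in between.\<close>
      define d where "d = (l t - r) / 2"
      assume "\<not> l t \<le> regulator S f t"
      then have d: "0 < d" by (simp add: d_def r_def)
      have "0 \<le> r" by (simp add: r_def regulator_nonneg)
      then have "l 0 \<le> r + d" "r + d \<le> l t"
        using d l by (auto simp: d_def field_simps)
      then obtain u where u: "0 \<le> u" "u \<le> t" "l u = r + d"
        using IVT'[of l 0 "r + d" t] t0 continuous_on_subset[OF cont(2)] by (metis atLeast_iff atLeastAtMost_iff subsetI)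
      then have ut: "u < t" using d by (cases "u = t") (auto simp: d_def field_simps)
      have z_ge: "d \<le> z s" if s: "u \<le> s" "s \<le> t" for s
      proof (rule ccontr)
        assume "\<not> d \<le> z s"
        then have zs: "z s < d" by simp
        have "s \<in> {0..}" using s u by simp
        with cont(1) zs obtain e where e: "0 < e" "\<And>v. 0 \<le> v \<Longrightarrow> \<bar>v - s\<bar> < e \<Longrightarrow> \<bar>z v - z s\<bar> < d - z s"
          unfolding continuous_on_iff dist_real_def by (metis atLeast_iff diff_gt_0_iff_gt)
        \<comment> \<open>A rational time strictly between \<open>u\<close> and \<open>t\<close> and
          close to \<open>s\<close> belongs to \<open>S\<close>, so the regulator bound applies to
          \<open>f\<close> there.\<close>
        have "max u (s - e) < min t (s + e)" using ut s e by auto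
        then obtain p where p: "p \<in> \<rat>" "max u (s - e) < p" "p < min t (s + e)"
          using Rats_dense_in_real by blast
        then have pS: "p \<in> S" "0 \<le> p" using S u by auto
        have "\<bar>p - s\<bar> < e" using p by auto
        from e(2)[OF pS(2) this] have "z p < d" by linarith
        moreover have "- f p \<le> r"
          unfolding r_def using p by (intro regulator_ge[OF lb t pS(1)]) auto
        moreover have "r + d \<le> l p" using mono[of u p] u p by auto
        ultimately show False using eq[of p] pS by auto
      qed
      let ?m = "interval_measure (\<lambda>s. l (max 0 s))"
      have cont': "continuous_on UNIV (\<lambda>s. l (max 0 s))"
        by (rule continuous_on_compose2[OF cont(2)]) (auto intro!: continuous_intros)
      have "emeasure ?m {u<..t} = l (max 0 t) - l (max 0 u)"
      proof (rule emeasure_interval_measure_Ioc)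
        show "continuous (at_right a) (\<lambda>s. l (max 0 s))" for a
          using cont' by (auto simp: continuous_on_eq_continuous_at intro: continuous_at_imp_continuous_within)
      qed (use ut mono in auto)
      also have "l (max 0 t) - l (max 0 u) = d"
        using u t0 by (simp add: d_def field_simps)
      finally have "emeasure ?m {u<..t} = ennreal d" .
      then have "ennreal d * ennreal d = (\<integral>\<^sup>+s. ennreal d * indicator {u<..t} s \<partial>?m)"
        by (subst nn_integral_cmult_indicator) auto
      also have "\<dots> \<le> (\<integral>\<^sup>+s\<in>{0..}. ennreal (z s) \<partial>?m)"
        using z_ge u by (intro nn_integral_mono) (auto simp: indicator_def intro!: ennreal_leI)
      finally show False
        using collision d by (simp add: ennreal_mult[symmetric])
    qed
  qed
qed

lemma summation_by_parts:
  fixes c x :: "nat \<Rightarrow> real"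
  assumes "1 \<le> n" "c 0 = 0"
  shows "(\<Sum>i\<in>{1..<n}. c i * (x (Suc i) - x i)) = (\<Sum>j\<in>{1..n}. (c (j - 1) - c j) * x j) + c n * x n"
  using assms(1)
proof (induction n rule: dec_induct)
  case base
  then show ?case using assms(2) by simp
next
  case (step n)
  then show ?case by (simp add: algebra_simps)
qed

section \<open>The first particles as a Skorokhod problem\<close>

locale particle_system =
  fixes g \<sigma> qp qm :: "nat \<Rightarrow> real" and n :: nat and S :: "real set" and a :: "nat \<Rightarrow> nat \<Rightarrow> real"
  assumes n_ge_2: "2 \<le> n"
    and q_sum: "\<And>k. k \<ge> 1 \<Longrightarrow> qp (Suc k) + qm k = 1"
    and qm_pos: "\<And>k. k \<ge> 1 \<Longrightarrow> 0 < qm k"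
    and sigma_pos: "\<And>k. k \<ge> 1 \<Longrightarrow> 0 < \<sigma> k"
    and S: "countable S" "S \<subseteq> {0..}" "\<rat> \<inter> {0..} \<subseteq> S"
    and orthant: "skorokhod_orthant {1..<n} (collision_matrix qp qm) a"
    and a_pos: "\<And>k. k \<in> {1..<n} \<Longrightarrow> 0 < a k 1"
begin

sublocale skorokhod_orthant "{1..<n}" S "collision_matrix qp qm" a
  by (rule orthant)

text \<open>The argument \<open>b\<close> is a point of path space, not a process, so that the
  reflection from zero is one fixed functional applicable to the noise of any system.\<close>

definition free :: "(nat \<Rightarrow> real \<Rightarrow> real) \<Rightarrow> nat \<Rightarrow> real \<Rightarrow> real" where
  "free b k s = (g (Suc k) - g k) * s + (\<sigma> (Suc k) * b (Suc k) s - \<sigma> k * b k s)"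

definition noise :: "(nat \<Rightarrow> real \<Rightarrow> 'x \<Rightarrow> real) \<Rightarrow> 'x \<Rightarrow> nat \<Rightarrow> real \<Rightarrow> real" where
  "noise B \<omega> = (\<lambda>k\<in>{1..n}. \<lambda>s\<in>{0..}. B k s \<omega>)"

abbreviation path_space :: "(nat \<Rightarrow> real \<Rightarrow> real) measure" where
  "path_space \<equiv> PiM {1..n} (\<lambda>_. PiM {0..} (\<lambda>_. borel))"

lemma naturals_in_S: "real m \<in> S"
  using S(3) by auto

lemma cofinal_S: "\<exists>s\<in>S. c \<le> s"
  using naturals_in_S real_arch_simple[of c] by blast

lemma free_noise:
  "k \<in> {1..<n} \<Longrightarrow> 0 \<le> s \<Longrightarrow> free (noise B \<omega>) k s =
     (g (Suc k) - g k) * s + (\<sigma> (Suc k) * B (Suc k) s \<omega> - \<sigma> k * B k s \<omega>)"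
  by (simp add: free_def noise_def)

lemma free_measurable:
  assumes "k \<in> {1..<n}" "s \<in> S"
  shows "(\<lambda>b. free b k s) \<in> borel_measurable path_space"
proof -
  have "(\<lambda>b. b j s) \<in> borel_measurable path_space" if "j \<in> {1..n}" for j
  proof -
    have "(\<lambda>b. b j) \<in> measurable path_space (PiM {0..} (\<lambda>_. borel))"
      by (rule measurable_component_singleton[OF that])
    moreover have "(\<lambda>w. w s) \<in> borel_measurable (PiM {0..} (\<lambda>_. borel :: real measure))"
      using assms S by (intro measurable_component_singleton) auto
    ultimately show ?thesis by (rule measurable_compose)
  qed
  then show ?thesis
    unfolding free_def using assms(1) by (intro borel_measurable_add borel_measurable_diff borel_measurable_times) auto
qed

lemma reflected_free_measurable:
  "k \<in> {1..<n} \<Longrightarrow> t \<in> S \<Longrightarrow> (\<lambda>b. reflected (free b) k t) \<in> borel_measurable path_space"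
  by (intro reflected_borel_measurable S free_measurable)

end

text \<open>Covers both the infinite system seen through its first \<open>n\<close> particles and a
  system of exactly \<open>n\<close> particles.\<close>

locale embedded_system = particle_system g \<sigma> qp qm n S a + ranked_system M F N g \<sigma> qp qm B Y L
  for g \<sigma> qp qm :: "nat \<Rightarrow> real" and n :: nat and S :: "real set" and a :: "nat \<Rightarrow> nat \<Rightarrow> real"
    and M :: "'a measure" and F N B Y L +
  assumes n_le: "enat n \<le> N"
begin

abbreviation gap :: "nat \<Rightarrow> real \<Rightarrow> 'a \<Rightarrow> real" where
  "gap k t \<omega> \<equiv> Y (Suc k) t \<omega> - Y k t \<omega>"

definition started :: "'a \<Rightarrow> nat \<Rightarrow> real \<Rightarrow> real" where
  "started \<omega> = (\<lambda>k s. gap k 0 \<omega> + free (noise B \<omega>) k s)"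

lemma particle_index: "k \<in> {1..n} \<Longrightarrow> k \<in> particles N"
  using n_le order_trans[of "enat k" "enat n" N] by (auto simp: particles_def)

lemma gap_index: "k \<in> {1..<n} \<Longrightarrow> k \<in> gaps N"
  using n_le order_trans[of "enat (Suc k)" "enat n" N] by (auto simp: gaps_def)

lemma last_index: "enat n = N \<or> n \<in> gaps N"
  using n_le n_ge_2 by (cases N) (auto simp: gaps_def)

lemma Y_measurable: "k \<in> {1..n} \<Longrightarrow> 0 \<le> t \<Longrightarrow> Y k t \<in> borel_measurable M"
  by (intro adapted_measurable adapted_Y particle_index)

lemma B_measurable: "k \<in> {1..n} \<Longrightarrow> 0 \<le> t \<Longrightarrow> B k t \<in> borel_measurable M"
  using brownian particle_index unfolding brownian_motion_def by (intro adapted_measurable) auto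

lemma gap_measurable:
  "k \<in> {1..<n} \<Longrightarrow> 0 \<le> t \<Longrightarrow> (\<lambda>\<omega>. gap k t \<omega>) \<in> borel_measurable M"
  by (intro borel_measurable_diff Y_measurable) auto

lemma noise_measurable: "noise B \<in> measurable M path_space"
  unfolding noise_def by (intro measurable_restrict B_measurable) auto

text \<open>One almost sure event for all later pathwise arguments. \<open>L n\<close> is a
  collision local time when particle \<open>n + 1\<close> exists, and vanishes by convention
  otherwise.\<close>

lemma AE_regularity:
  "AE \<omega> in M. (\<forall>k\<in>{1..<n}. continuous_on {0..} (\<lambda>t. gap k t \<omega>)
      \<and> (\<forall>t\<ge>0. 0 \<le> gap k t \<omega>)
      \<and> (\<integral>\<^sup>+t\<in>{0..}. ennreal (gap k t \<omega>) \<partial>interval_measure (\<lambda>t. L k (max 0 t) \<omega>)) = 0)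
    \<and> (\<forall>k\<in>{1..n}. continuous_on {0..} (\<lambda>t. L k t \<omega>) \<and> L k 0 \<omega> = 0 \<and> mono_on {0..} (\<lambda>t. L k t \<omega>)
      \<and> (\<forall>t\<ge>0. Y k t \<omega> = Y k 0 \<omega> + g k * t + \<sigma> k * B k t \<omega> + qp k * L (k - 1) t \<omega> - qm k * L k t \<omega>))
    \<and> (\<forall>t\<ge>0. L 0 t \<omega> = 0 \<and> (N = enat n \<longrightarrow> L n t \<omega> = 0))"
proof -
  have 1: "AE \<omega> in M. continuous_on {0..} (\<lambda>t. gap k t \<omega>) \<and> (\<forall>t\<ge>0. 0 \<le> gap k t \<omega>)
      \<and> (\<integral>\<^sup>+t\<in>{0..}. ennreal (gap k t \<omega>) \<partial>interval_measure (\<lambda>t. L k (max 0 t) \<omega>)) = 0"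
    if k: "k \<in> {1..<n}" for k
  proof -
    have "k \<in> {1..n}" "Suc k \<in> {1..n}" using k by auto
    then have "AE \<omega> in M. continuous_on {0..} (\<lambda>t. Y k t \<omega>)" "AE \<omega> in M. continuous_on {0..} (\<lambda>t. Y (Suc k) t \<omega>)"
      using continuous_Y particle_index by blast+
    then show ?thesis
      using ranked[OF gap_index[OF k]] L_collision[OF gap_index[OF k]]
      by eventually_elim (auto intro: continuous_on_diff)
  qed
  have 2: "AE \<omega> in M. continuous_on {0..} (\<lambda>t. L k t \<omega>) \<and> L k 0 \<omega> = 0 \<and> mono_on {0..} (\<lambda>t. L k t \<omega>)
      \<and> (\<forall>t\<ge>0. Y k t \<omega> = Y k 0 \<omega> + g k * t + \<sigma> k * B k t \<omega> + qp k * L (k - 1) t \<omega> - qm k * L k t \<omega>)"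
    if k: "k \<in> {1..n}" for k
  proof -
    have "AE \<omega> in M. continuous_on {0..} (\<lambda>t. L k t \<omega>) \<and> L k 0 \<omega> = 0 \<and> mono_on {0..} (\<lambda>t. L k t \<omega>)"
    proof (cases "k \<in> gaps N")
      case True
      from continuous_L[OF True] L_increasing[OF True] show ?thesis by eventually_elim auto
    next
      case False
      then have "enat k = N" using k last_index gap_index[of k] by force
      then have "AE \<omega> in M. \<forall>t\<ge>0. L k t \<omega> = 0" using L_boundary by blast
      then show ?thesis
      proof eventually_elim
        case (elim \<omega>)
        have "continuous_on {0..} (\<lambda>t. L k t \<omega>)"
          by (rule continuous_on_eq[OF continuous_on_const[of _ "0 :: real"]]) (simp add: elim)
        moreover have "mono_on {0..} (\<lambda>t. L k t \<omega>)"
          by (rule monotone_onI) (simp add: elim)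
        ultimately show ?case by (simp add: elim)
      qed
    qed
    with dynamics[OF particle_index[OF k]] show ?thesis by eventually_elim blast
  qed
  have "AE \<omega> in M. \<forall>t\<ge>0. L 0 t \<omega> = 0" using L_boundary by blast
  moreover have "AE \<omega> in M. \<forall>t\<ge>0. N = enat n \<longrightarrow> L n t \<omega> = 0"
    using L_boundary[of n] by (cases "N = enat n") auto
  moreover have "AE \<omega> in M. \<forall>k\<in>{1..<n}. continuous_on {0..} (\<lambda>t. gap k t \<omega>) \<and> (\<forall>t\<ge>0. 0 \<le> gap k t \<omega>)
      \<and> (\<integral>\<^sup>+t\<in>{0..}. ennreal (gap k t \<omega>) \<partial>interval_measure (\<lambda>t. L k (max 0 t) \<omega>)) = 0"
    by (rule AE_finite_allI) (use 1 in auto)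
  moreover have "AE \<omega> in M. \<forall>k\<in>{1..n}. continuous_on {0..} (\<lambda>t. L k t \<omega>) \<and> L k 0 \<omega> = 0 \<and> mono_on {0..} (\<lambda>t. L k t \<omega>)
      \<and> (\<forall>t\<ge>0. Y k t \<omega> = Y k 0 \<omega> + g k * t + \<sigma> k * B k t \<omega> + qp k * L (k - 1) t \<omega> - qm k * L k t \<omega>)"
    by (rule AE_finite_allI) (use 2 in auto)
  ultimately show ?thesis by eventually_elim blast
qed

text \<open>
  The first \<open>n\<close> particles see the particle \<open>n + 1\<close> only through the term \<open>qm n * L n\<close>, which
  pushes the particle \<open>n\<close> down and hence can only shrink the gaps.
\<close>

lemma AE_gap_comparison:
  "AE \<omega> in M. bounded_forcing (free (noise B \<omega>)) \<and> (\<forall>k\<in>{1..<n}. 0 \<le> gap k 0 \<omega>) \<and>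
    (\<forall>k\<in>{1..<n}. \<forall>t\<in>S. 0 \<le> gap k t \<omega> \<and> gap k t \<omega> \<le> reflected (started \<omega>) k t \<and>
      (N = enat n \<longrightarrow> reflected (free (noise B \<omega>)) k t \<le> gap k t \<omega>))"
  using AE_regularity
proof eventually_elim
  case (elim \<omega>)
  then have gap_cont: "\<And>k. k \<in> {1..<n} \<Longrightarrow> continuous_on {0..} (\<lambda>t. gap k t \<omega>)"
    and gap_nonneg: "\<And>k t. k \<in> {1..<n} \<Longrightarrow> 0 \<le> t \<Longrightarrow> 0 \<le> gap k t \<omega>"
    and collide: "\<And>k. k \<in> {1..<n} \<Longrightarrow>
      (\<integral>\<^sup>+t\<in>{0..}. ennreal (gap k t \<omega>) \<partial>interval_measure (\<lambda>t. L k (max 0 t) \<omega>)) = 0"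
    and L_cont: "\<And>k. k \<in> {1..n} \<Longrightarrow> continuous_on {0..} (\<lambda>t. L k t \<omega>)"
    and L_init: "\<And>k. k \<in> {1..n} \<Longrightarrow> L k 0 \<omega> = 0"
    and L_mono_on: "\<And>k. k \<in> {1..n} \<Longrightarrow> mono_on {0..} (\<lambda>t. L k t \<omega>)"
    and dyn: "\<And>k t. k \<in> {1..n} \<Longrightarrow> 0 \<le> t \<Longrightarrow> Y k t \<omega> =
      Y k 0 \<omega> + g k * t + \<sigma> k * B k t \<omega> + qp k * L (k - 1) t \<omega> - qm k * L k t \<omega>"
    and L_0: "\<And>t. 0 \<le> t \<Longrightarrow> L 0 t \<omega> = 0"
    and L_n: "\<And>t. 0 \<le> t \<Longrightarrow> N = enat n \<Longrightarrow> L n t \<omega> = 0"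
    by blast+
  define l where "l = (\<lambda>k s. L k s \<omega>)"
  \<comment> \<open>Among the first \<open>n - 1\<close> gaps, particle \<open>n\<close> bounds only
    gap \<open>n - 1\<close>, so the outside push appears only where
    \<open>Suc k = n\<close>.\<close>
  define E where "E = (\<lambda>k s. (if Suc k = n then qm n * L n s \<omega> else 0))"
  define X where "X = (\<lambda>k s. started \<omega> k s - E k s)"
  have L_mono: "L k s \<omega> \<le> L k t \<omega>" if "k \<in> {1..n}" "0 \<le> s" "s \<le> t" for k s t
    using monotone_onD[OF L_mono_on] that by auto
  have L_nonneg: "0 \<le> L k t \<omega>" if "k \<in> {1..n}" "0 \<le> t" for k t
    using L_mono[OF that(1), of 0 t] L_init that by auto
  have l: "increasing l"
    unfolding increasing_def l_def
  proof (intro ballI conjI impI)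
    fix k t assume "k \<in> {1..<n}" "t \<in> S"
    then show "0 \<le> L k t \<omega>" using L_nonneg S(2) by auto
    fix s assume "s \<in> S" "s \<le> t"
    then show "L k s \<omega> \<le> L k t \<omega>"
      using L_mono[of k s t] \<open>k \<in> {1..<n}\<close> S(2) by auto
  qed
  have E: "increasing E"
    unfolding increasing_def
  proof (intro ballI conjI impI)
    fix k t assume "k \<in> {1..<n}" "t \<in> S"
    then show "0 \<le> E k t"
      using L_nonneg[of n t] qm_pos[of n] S(2) n_ge_2 by (auto simp: E_def)
    fix s assume "s \<in> S" "s \<le> t"
    then show "E k s \<le> E k t"
      using L_mono[of n s t] qm_pos[of n] S(2) n_ge_2 by (auto simp: E_def)
  qed
  have gap_eq: "gap k s \<omega> = (X k s - push l k s) + l k s" if k: "k \<in> {1..<n}" and s: "0 \<le> s" for k s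
  proof -
    have k': "k \<in> {1..n}" "Suc k \<in> {1..n}" using k by auto
    have push: "push l k s + E k s = qm (Suc k) * L (Suc k) s \<omega> + qp k * L (k - 1) s \<omega>"
    proof -
      have "k = 1 \<or> 1 < k" "Suc k = n \<or> Suc k < n" using k by auto
      then show ?thesis
        unfolding push_def collision_matrix_sum[OF k] using L_0[OF s] by (auto simp: E_def l_def)
    qed
    have "X k s - push l k s = started \<omega> k s - (push l k s + E k s)"
      by (simp add: X_def)
    moreover have "qp (Suc k) * L k s \<omega> + qm k * L k s \<omega> = L k s \<omega>"
      using q_sum[of k] k by (simp add: distrib_right[symmetric])
    moreover have "started \<omega> k s = gap k 0 \<omega> + ((g (Suc k) - g k) * s
        + (\<sigma> (Suc k) * B (Suc k) s \<omega> - \<sigma> k * B k s \<omega>))"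
      unfolding started_def free_noise[OF k s] ..
    ultimately show ?thesis
      using push unfolding dyn[OF k'(1) s] dyn[OF k'(2) s] diff_Suc_1 left_diff_distrib l_def
      by linarith
  qed
  have reg: "locally_bounded_below S (\<lambda>s. X k s - push l k s)"
      "t \<in> S \<Longrightarrow> l k t = regulator S (\<lambda>s. X k s - push l k s) t" if k: "k \<in> {1..<n}" for k t
  proof -
    have lk: "continuous_on {0..} (l k)" "l k 0 = 0" "mono_on {0..} (l k)"
      using L_cont[of k] L_init[of k] L_mono_on[of k] k unfolding l_def by auto
    have col: "(\<integral>\<^sup>+t\<in>{0..}. ennreal (gap k t \<omega>) \<partial>interval_measure (\<lambda>t. l k (max 0 t))) = 0"
      using collide[OF k] unfolding l_def .
    note * = regulator_unique[OF S(2,3) gap_eq[OF k] gap_nonneg[OF k] gap_cont[OF k] lk col]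
    show "locally_bounded_below S (\<lambda>s. X k s - push l k s)"
      by (rule *(1))
    show "t \<in> S \<Longrightarrow> l k t = regulator S (\<lambda>s. X k s - push l k s) t"
      by (rule *(2))
  qed
  \<comment> \<open>\<open>X\<close> exceeds \<open>X - push l\<close>, which is bounded below
    because the gaps are nonnegative.\<close>
  have X: "bounded_forcing X"
    unfolding bounded_forcing_def
  proof
    fix k assume k: "k \<in> {1..<n}"
    show "locally_bounded_below S (X k)"
      by (rule locally_bounded_below_mono[OF reg(1)[OF k]])
        (use push_increasing[OF l, unfolded increasing_def] k in auto)
  qed
  have is_reg: "is_regulator X l"
    unfolding is_regulator_def using l reg(2) by blast
  have free: "bounded_forcing (free (noise B \<omega>))"
    unfolding bounded_forcing_def
  proof
    fix k assume k: "k \<in> {1..<n}"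
    have "locally_bounded_below S (\<lambda>s. X k s - gap k 0 \<omega>)"
      unfolding locally_bounded_below_def
    proof
      fix t assume "t \<in> S"
      then obtain c where "\<forall>s\<in>S. s \<le> t \<longrightarrow> c \<le> X k s"
        using X k unfolding bounded_forcing_def locally_bounded_below_def by blast
      then show "\<exists>c. \<forall>s\<in>S. s \<le> t \<longrightarrow> c \<le> X k s - gap k 0 \<omega>"
        by (intro exI[of _ "c - gap k 0 \<omega>"]) auto
    qed
    then show "locally_bounded_below S (free (noise B \<omega>) k)"
      by (rule locally_bounded_below_mono)
        (use E[unfolded increasing_def] k in \<open>auto simp: X_def started_def\<close>)
  qed
  have upper: "gap k t \<omega> \<le> reflected (started \<omega>) k t" if "k \<in> {1..<n}" "t \<in> S" for k t
  proof -
    have "increasing (\<lambda>k t. started \<omega> k t - X k t)" unfolding X_def using E by simp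
    from comparison(2)[OF X is_reg this that] show ?thesis
      using gap_eq[OF that(1), of t] that S(2) by auto
  qed
  have lower: "reflected (free (noise B \<omega>)) k t \<le> gap k t \<omega>"
    if N: "N = enat n" and k: "k \<in> {1..<n}" and t: "t \<in> S" for k t
  proof -
    have "increasing (\<lambda>k t. X k t - free (noise B \<omega>) k t)"
      unfolding increasing_def
    proof (intro ballI conjI impI)
      fix k t assume k: "k \<in> {1..<n}" and t: "t \<in> S"
      \<comment> \<open>With exactly \<open>n\<close> particles the outside push vanishes, and the
        two forcings differ by the constant initial gap.\<close>
      have diff: "X k s - free (noise B \<omega>) k s = gap k 0 \<omega>" if "s \<in> S" for s
        using L_n[OF _ N, of s] that S(2) by (auto simp: X_def started_def E_def)
      show "0 \<le> X k t - free (noise B \<omega>) k t"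
        using diff[OF t] gap_nonneg[OF k, of 0] by simp
      show "X k s - free (noise B \<omega>) k s \<le> X k t - free (noise B \<omega>) k t" if "s \<in> S" for s
        using diff[OF t] diff[OF that] by simp
    qed
    from comparison(2)[OF free is_regulator_local_time[OF free] this k t]
    have "reflected (free (noise B \<omega>)) k t \<le> reflected X k t"
      unfolding reflected_def[of "free (noise B \<omega>)"] .
    then show ?thesis
      using gap_eq[OF k, of t] t S(2) reflected_of_regulator[OF X is_reg k t] by auto
  qed
  show ?case
    using free gap_nonneg upper lower S(2) by auto
qed

end

section \<open>Comparison with a stationary finite system\<close>

text \<open>Independence turns the joint law into a product of path laws, and the factors agree
  because each one is the law of Brownian motion.\<close>

lemma noise_law_unique:
  assumes sys: "embedded_system g \<sigma> qp qm n S a M F N B Y L"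
    and sys': "embedded_system g \<sigma> qp qm n S a M' F' N' B' Y' L'"
  shows "distr M (PiM {1..n} (\<lambda>_. PiM {0..} (\<lambda>_. borel))) (particle_system.noise n B) =
    distr M' (PiM {1..n} (\<lambda>_. PiM {0..} (\<lambda>_. borel))) (particle_system.noise n B')"
proof -
  interpret A: embedded_system g \<sigma> qp qm n S a M F N B Y L by fact
  interpret B: embedded_system g \<sigma> qp qm n S a M' F' N' B' Y' L' by fact
  let ?P = "PiM {0..} (\<lambda>_. borel) :: (real \<Rightarrow> real) measure"
  have sub: "{1..n} \<subseteq> particles N" "{1..n} \<subseteq> particles N'"
    using A.particle_index B.particle_index by auto
  have ne: "{1..n} \<noteq> {}" using A.n_ge_2 by auto
  have path: "(\<lambda>\<omega>. \<lambda>t\<in>{0..}. B k t \<omega>) \<in> measurable M ?P"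
      "(\<lambda>\<omega>. \<lambda>t\<in>{0..}. B' k t \<omega>) \<in> measurable M' ?P" if "k \<in> {1..n}" for k
    using that A.B_measurable B.B_measurable by (auto intro!: measurable_restrict)
  have "distr M A.path_space (A.noise B) = (\<Pi>\<^sub>M k\<in>{1..n}. distr M ?P (\<lambda>\<omega>. \<lambda>t\<in>{0..}. B k t \<omega>))"
    using A.indep_vars_iff_distr_eq_PiM'[OF ne path(1)] A.indep_vars_subset[OF A.independent sub(1)]
    by (simp add: A.noise_def[abs_def])
  also have "\<dots> = (\<Pi>\<^sub>M k\<in>{1..n}. distr M' ?P (\<lambda>\<omega>. \<lambda>t\<in>{0..}. B' k t \<omega>))"
  proof (rule PiM_cong[OF refl])
    fix k assume "k \<in> {1..n}"
    then show "distr M ?P (\<lambda>\<omega>. \<lambda>t\<in>{0..}. B k t \<omega>) = distr M' ?P (\<lambda>\<omega>. \<lambda>t\<in>{0..}. B' k t \<omega>)"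
      using A.particle_index B.particle_index
      by (intro brownian_law_unique[OF A.usual_conditions_axioms _ B.usual_conditions_axioms]
          A.brownian B.brownian)
  qed
  also have "\<dots> = distr M' A.path_space (A.noise B')"
    using B.indep_vars_iff_distr_eq_PiM'[OF ne path(2)] B.indep_vars_subset[OF B.independent sub(2)]
    by (simp add: A.noise_def[abs_def])
  finally show ?thesis .
qed

context embedded_system
begin

abbreviation gap_space :: "(nat \<Rightarrow> real) measure" where
  "gap_space \<equiv> PiM {1..<n} (\<lambda>_. borel)"

definition reflected_noise :: "real \<Rightarrow> 'a \<Rightarrow> nat \<Rightarrow> real" where
  "reflected_noise t \<omega> = (\<lambda>k\<in>{1..<n}. reflected (free (noise B \<omega>)) k t)"

definition reflected_started :: "real \<Rightarrow> 'a \<Rightarrow> nat \<Rightarrow> real" where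
  "reflected_started t \<omega> = (\<lambda>k\<in>{1..<n}. reflected (started \<omega>) k t)"

lemma reflected_noise_measurable [measurable]:
  "t \<in> S \<Longrightarrow> reflected_noise t \<in> measurable M gap_space"
  unfolding reflected_noise_def
  by (intro measurable_restrict measurable_compose[OF noise_measurable reflected_free_measurable])

lemma started_measurable:
  "k \<in> {1..<n} \<Longrightarrow> s \<in> S \<Longrightarrow> (\<lambda>\<omega>. started \<omega> k s) \<in> borel_measurable M"
  unfolding started_def
  by (intro borel_measurable_add gap_measurable measurable_compose[OF noise_measurable free_measurable]) auto

lemma reflected_started_measurable [measurable]:
  "t \<in> S \<Longrightarrow> reflected_started t \<in> measurable M gap_space"
  unfolding reflected_started_def
  by (intro measurable_restrict reflected_borel_measurable S started_measurable)

lemma gap_process_measurable [measurable]: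
  "0 \<le> t \<Longrightarrow> gap_process {1..<n} Y t \<in> measurable M gap_space"
  unfolding gap_process_def by (intro measurable_restrict gap_measurable)

text \<open>The sandwich behind all probabilistic estimates. Its error term involves only the
  initial gaps, which makes the resulting bounds uniform in time.\<close>

lemma AE_bounds:
  "AE \<omega> in M. \<forall>t\<in>S. \<forall>k\<in>{1..<n}.
    0 \<le> reflected_noise t \<omega> k \<and> 0 \<le> gap k t \<omega> \<and>
    gap k t \<omega> \<le> reflected_started t \<omega> k \<and>
    reflected_noise t \<omega> k \<le> reflected_started t \<omega> k \<and>
    reflected_started t \<omega> k \<le> reflected_noise t \<omega> k + (\<Sum>i\<in>{1..<n}. a k i * gap i 0 \<omega>) \<and>
    (N = enat n \<longrightarrow> reflected_noise t \<omega> k \<le> gap k t \<omega>)"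
  using AE_gap_comparison
proof eventually_elim
  case (elim \<omega>)
  let ?x = "\<lambda>k. gap k 0 \<omega>"
  have free: "bounded_forcing (free (noise B \<omega>))" and x: "\<And>k. k \<in> {1..<n} \<Longrightarrow> 0 \<le> ?x k"
    using elim by auto
  show ?case
    using elim reflected_shift_mono[OF free, of ?x] reflected_shift_le[OF free, of ?x] x reflected_nonneg'[OF free]
    by (auto simp: reflected_noise_def reflected_started_def started_def algebra_simps)
qed

end

text \<open>
  Both sides are compared through the reflected noise, which starts from zero: its law depends
  only on the law of the driving Brownian motions, and it lies below the stationary gap process.
\<close>

lemma noise_dominated_by_stationary:
  assumes sys: "embedded_system g \<sigma> qp qm n S a M F N B Y L"
    and sys': "embedded_system g \<sigma> qp qm n S a M' F' (enat n) B' Y' L'"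
    and t: "t \<in> S"
    and h: "h \<in> borel_measurable (PiM {1..<n} (\<lambda>_. borel))" "\<And>z. 0 \<le> h z \<and> h z \<le> (1 :: real)"
    and mono: "\<And>z z'. (\<And>k. k \<in> {1..<n} \<Longrightarrow> z k \<le> z' k) \<Longrightarrow> h z \<le> h z'"
  shows "(\<integral>\<omega>. h (embedded_system.reflected_noise g \<sigma> qp qm n S B t \<omega>) \<partial>M)
    \<le> (\<integral>z. h z \<partial>gap_law M' {1..<n} Y' t)"
proof -
  interpret A: embedded_system g \<sigma> qp qm n S a M F N B Y L by fact
  interpret B: embedded_system g \<sigma> qp qm n S a M' F' "enat n" B' Y' L' by fact
  define \<Psi> where "\<Psi> b = (\<lambda>k\<in>{1..<n}. A.reflected (A.free b) k t)" for b
  have \<Psi>: "\<Psi> \<in> measurable A.path_space A.gap_space"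
    unfolding \<Psi>_def by (intro measurable_restrict A.reflected_free_measurable t)
  have h\<Psi>: "(\<lambda>b. h (\<Psi> b)) \<in> borel_measurable A.path_space"
    by (rule measurable_compose[OF \<Psi> h(1)])
  have t0: "0 \<le> t" using t A.S by auto
  have "(\<integral>\<omega>. h (A.reflected_noise t \<omega>) \<partial>M) = (\<integral>b. h (\<Psi> b) \<partial>distr M A.path_space (A.noise B))"
    by (subst integral_distr[OF A.noise_measurable h\<Psi>]) (simp add: A.reflected_noise_def \<Psi>_def)
  also have "\<dots> = (\<integral>b. h (\<Psi> b) \<partial>distr M' A.path_space (A.noise B'))"
    using noise_law_unique[OF sys sys'] by simp
  also have "\<dots> = (\<integral>\<omega>. h (B.reflected_noise t \<omega>) \<partial>M')"
    by (subst integral_distr[OF B.noise_measurable h\<Psi>]) (simp add: B.reflected_noise_def \<Psi>_def)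
  also have "\<dots> \<le> (\<integral>\<omega>. h (gap_process {1..<n} Y' t \<omega>) \<partial>M')"
  proof (rule integral_mono_AE)
    show "integrable M' (\<lambda>\<omega>. h (B.reflected_noise t \<omega>))"
      by (rule B.integrable_const_bound[where B=1])
        (use h(2) measurable_compose[OF B.reflected_noise_measurable[OF t] h(1)] in auto)
    show "integrable M' (\<lambda>\<omega>. h (gap_process {1..<n} Y' t \<omega>))"
      by (rule B.integrable_const_bound[where B=1])
        (use h(2) measurable_compose[OF B.gap_process_measurable[OF t0] h(1)] in auto)
    show "AE \<omega> in M'. h (B.reflected_noise t \<omega>) \<le> h (gap_process {1..<n} Y' t \<omega>)"
      using B.AE_bounds
    proof eventually_elim
      case (elim \<omega>)
      then show ?case
        using t by (intro mono) (auto simp: gap_process_def)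
    qed
  qed
  also have "\<dots> = (\<integral>z. h z \<partial>gap_law M' {1..<n} Y' t)"
    unfolding gap_law_def
    by (subst integral_distr[OF B.gap_process_measurable[OF t0] h(1)]) simp
  finally show ?thesis .
qed

section \<open>Gaussian increments of combinations of gaps\<close>

context embedded_system
begin

text \<open>Summation by parts rewrites the combination in terms of independent Brownian increments;
  the contribution of the first particle alone yields the lower bound on the standard
  deviation.\<close>

lemma noise_increment_normal:
  assumes k: "k \<in> {1..<n}" and st: "0 \<le> s" "s < t"
  shows "\<exists>m v. (a k 1 * \<sigma> 1) * sqrt (t - s) \<le> v \<and>
    distributed M lborel (\<lambda>\<omega>. \<Sum>i\<in>{1..<n}. a k i * (free (noise B \<omega>) i t - free (noise B \<omega>) i s))
      (normal_density m v)"
proof -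
  \<comment> \<open>Extension by zero at 0 and \<open>n\<close> removes the boundary terms of the
    summation by parts.\<close>
  define c where "c i = (if i \<in> {1..<n} then a k i else 0)" for i
  define \<beta> where "\<beta> j = (c (j - 1) - c j) * \<sigma> j" for j
  \<comment> \<open>Particles with coefficient 0 are dropped because a normal density requires
    positive standard deviation.\<close>
  define J where "J = {j\<in>{1..n}. \<beta> j \<noteq> 0}"
  define m where "m = (\<Sum>i\<in>{1..<n}. a k i * ((g (Suc i) - g i) * (t - s)))"
  define v where "v = sqrt (\<Sum>j\<in>J. (\<bar>\<beta> j\<bar> * sqrt (t - s))\<^sup>2)"
  have \<beta>1: "\<beta> 1 = - (a k 1 * \<sigma> 1)" using n_ge_2 by (simp add: \<beta>_def c_def)
  have pos: "0 < a k 1 * \<sigma> 1" using a_pos[OF k] sigma_pos[of 1] by simp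
  have J: "finite J" "1 \<in> J" using \<beta>1 pos n_ge_2 by (auto simp: J_def)
  have decomp: "(\<Sum>i\<in>{1..<n}. a k i * (free (noise B \<omega>) i t - free (noise B \<omega>) i s))
      = m + (\<Sum>j\<in>J. 0 + \<beta> j * (B j t \<omega> - B j s \<omega>))" for \<omega>
  proof -
    define x where "x j = \<sigma> j * (B j t \<omega> - B j s \<omega>)" for j
    have "(\<Sum>i\<in>{1..<n}. a k i * (free (noise B \<omega>) i t - free (noise B \<omega>) i s))
        = (\<Sum>i\<in>{1..<n}. a k i * ((g (Suc i) - g i) * (t - s)) + c i * (x (Suc i) - x i))"
      using st by (intro sum.cong refl) (simp add: free_noise c_def x_def algebra_simps)
    also have "\<dots> = m + (\<Sum>j\<in>{1..n}. (c (j - 1) - c j) * x j)"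
      using summation_by_parts[of n c x] n_ge_2 by (simp add: sum.distrib m_def c_def)
    also have "(\<Sum>j\<in>{1..n}. (c (j - 1) - c j) * x j) = (\<Sum>j\<in>{1..n}. 0 + \<beta> j * (B j t \<omega> - B j s \<omega>))"
      by (simp add: \<beta>_def x_def algebra_simps)
    also have "\<dots> = (\<Sum>j\<in>J. 0 + \<beta> j * (B j t \<omega> - B j s \<omega>))"
      by (rule sum.mono_neutral_right) (auto simp: J_def)
    finally show ?thesis .
  qed
  have normal: "distributed M lborel (\<lambda>\<omega>. 0 + \<beta> j * (B j t \<omega> - B j s \<omega>))
      (normal_density (0 + \<beta> j * 0) (\<bar>\<beta> j\<bar> * sqrt (t - s)))" if "j \<in> J" for j
  proof (rule normal_density_affine)
    show "distributed M lborel (\<lambda>\<omega>. B j t \<omega> - B j s \<omega>) (normal_density 0 (sqrt (t - s)))"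
      using brownian[OF particle_index, of j] that st by (auto simp: brownian_motion_def J_def)
  qed (use st that in \<open>auto simp: J_def\<close>)
  have "indep_vars (\<lambda>_. borel) (\<lambda>j \<omega>. 0 + \<beta> j * ((\<lambda>u\<in>{0..}. B j u \<omega>) t - (\<lambda>u\<in>{0..}. B j u \<omega>) s)) J"
  proof (rule indep_vars_compose2[where M'="\<lambda>_. PiM {0..} (\<lambda>_. borel)"
        and X="\<lambda>j \<omega>. \<lambda>u\<in>{0..}. B j u \<omega>" and Y="\<lambda>j w. 0 + \<beta> j * (w t - w s)"])
    show "indep_vars (\<lambda>_. PiM {0..} (\<lambda>_. borel)) (\<lambda>j \<omega>. \<lambda>u\<in>{0..}. B j u \<omega>) J"
      by (rule indep_vars_subset[OF independent]) (auto simp: J_def intro: particle_index)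
    show "(\<lambda>w. 0 + \<beta> j * (w t - w s)) \<in> borel_measurable (PiM {0..} (\<lambda>_. borel))" for j
      using st by (intro borel_measurable_add borel_measurable_times borel_measurable_diff
          borel_measurable_const measurable_component_singleton) auto
  qed
  then have indep: "indep_vars (\<lambda>_. borel) (\<lambda>j \<omega>. 0 + \<beta> j * (B j t \<omega> - B j s \<omega>)) J"
    using st by simp
  have sum: "distributed M lborel (\<lambda>\<omega>. \<Sum>j\<in>J. 0 + \<beta> j * (B j t \<omega> - B j s \<omega>))
      (normal_density (\<Sum>j\<in>J. 0 + \<beta> j * 0) v)"
    unfolding v_def using J st by (intro sum_indep_normal indep normal) (auto simp: J_def)
  have v: "(a k 1 * \<sigma> 1) * sqrt (t - s) \<le> v"
  proof -
    have abs: "\<bar>\<beta> 1\<bar> = a k 1 * \<sigma> 1"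
      unfolding \<beta>1 abs_minus_cancel by (rule abs_of_pos[OF pos])
    have "(a k 1 * \<sigma> 1) * sqrt (t - s) = sqrt ((\<bar>\<beta> 1\<bar> * sqrt (t - s))\<^sup>2)"
      unfolding abs using st
      by (intro real_sqrt_unique[symmetric] refl mult_nonneg_nonneg less_imp_le[OF pos]) simp
    also have "\<dots> \<le> v"
      unfolding v_def using J
      by (intro real_sqrt_le_mono member_le_sum[where f="\<lambda>j. (\<bar>\<beta> j\<bar> * sqrt (t - s))\<^sup>2"]) auto
    finally show ?thesis .
  qed
  have "0 < v"
    using v pos st by (auto intro: less_le_trans[rotated])
  from normal_density_affine[OF sum this, of 1 m]
  have "distributed M lborel (\<lambda>\<omega>. m + 1 * (\<Sum>j\<in>J. 0 + \<beta> j * (B j t \<omega> - B j s \<omega>)))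
      (normal_density (m + 1 * (\<Sum>j\<in>J. 0 + \<beta> j * 0)) (\<bar>1\<bar> * v))"
    by simp
  then show ?thesis
    using v decomp by auto
qed

text \<open>For fixed \<open>C\<close> the bound vanishes as \<open>t\<close> grows: the combination
  cannot remain in a bounded interval.\<close>

lemma noise_increment_concentration:
  assumes k: "k \<in> {1..<n}" and st: "0 \<le> s" "s < t" and C: "0 \<le> C"
  shows "prob {\<omega>\<in>space M. \<bar>\<Sum>i\<in>{1..<n}. a k i * (free (noise B \<omega>) i t - free (noise B \<omega>) i s)\<bar> \<le> C}
    \<le> 2 * C / ((a k 1 * \<sigma> 1) * sqrt (t - s))"
proof -
  let ?U = "\<lambda>\<omega>. \<Sum>i\<in>{1..<n}. a k i * (free (noise B \<omega>) i t - free (noise B \<omega>) i s)"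
  obtain m v where v: "(a k 1 * \<sigma> 1) * sqrt (t - s) \<le> v"
    and U: "distributed M lborel ?U (normal_density m v)"
    using noise_increment_normal[OF k st] by blast
  have pos: "0 < (a k 1 * \<sigma> 1) * sqrt (t - s)"
    using a_pos[OF k] sigma_pos[of 1] st by simp
  have "{\<omega>\<in>space M. \<bar>?U \<omega>\<bar> \<le> C} = ?U -` {-C..C} \<inter> space M"
    by auto
  then have "prob {\<omega>\<in>space M. \<bar>?U \<omega>\<bar> \<le> C} = measure (distr M lborel ?U) {-C..C}"
    using distributed_measurable[OF U] by (simp add: measure_distr)
  also have "\<dots> = measure (density lborel (normal_density m v)) {-C..C}"
    using distributed_distr_eq_density[OF U] by simp
  also have "\<dots> \<le> 2 * C / v"
    using v pos C by (intro normal_concentration) auto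
  also have "\<dots> \<le> 2 * C / ((a k 1 * \<sigma> 1) * sqrt (t - s))"
    using v pos C by (intro divide_left_mono) auto
  finally show ?thesis .
qed

end

section \<open>Asymptotic irrelevance of the initial condition\<close>

text \<open>The estimate covers all larger thresholds, so that two thresholds can be merged into
  their maximum.\<close>

lemma (in prob_space) tail_small:
  fixes f :: "'a \<Rightarrow> real"
  assumes f: "f \<in> borel_measurable M" and e: "0 < e"
  shows "\<exists>c\<ge>0. \<forall>d\<ge>c. prob {\<omega>\<in>space M. d < f \<omega>} < e"
proof -
  let ?A = "\<lambda>i::nat. {\<omega>\<in>space M. real i < f \<omega>}"
  have A: "range ?A \<subseteq> sets M" using f by auto
  have "(\<lambda>i. prob (?A i)) \<longlonglongrightarrow> prob (\<Inter>i. ?A i)"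
    using A by (intro finite_Lim_measure_decseq) (auto simp: decseq_def)
  also have "(\<Inter>i. ?A i) = {}"
  proof -
    have "\<exists>i. \<not> real i < f \<omega>" for \<omega>
      using real_arch_simple[of "f \<omega>"] by (auto simp: not_less)
    then show ?thesis by auto
  qed
  finally have "\<forall>\<^sub>F i in sequentially. prob (?A i) < e"
    using e by (intro order_tendstoD) auto
  then obtain i where i: "prob (?A i) < e" by (auto simp: eventually_sequentially)
  have "prob {\<omega>\<in>space M. d < f \<omega>} < e" if "real i \<le> d" for d
    by (rule le_less_trans[OF finite_measure_mono i]) (use that f in auto)
  then show ?thesis by (intro exI[of _ "real i"]) auto
qed

definition ramp :: "real \<Rightarrow> real \<Rightarrow> real \<Rightarrow> real" where
  "ramp e y x = max 0 (min 1 ((x - y) / e + 1))"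

text \<open>A continuous monotone majorant of the indicator of \<open>z k \<ge> y k\<close> for
  \<open>k\<close> up to \<open>m\<close>, with slope \<open>1 / e\<close> in each coordinate.
  Continuity suits weak convergence, monotonicity suits the path comparisons.\<close>

definition smooth_orthant :: "nat \<Rightarrow> real \<Rightarrow> (nat \<Rightarrow> real) \<Rightarrow> (nat \<Rightarrow> real) \<Rightarrow> real" where
  "smooth_orthant m e y z = (\<Prod>k\<in>{1..m}. ramp e (y k) (z k))"

lemma ramp_bounds: "0 \<le> ramp e y x" "ramp e y x \<le> 1"
  by (auto simp: ramp_def)

lemma ramp_mono: "0 < e \<Longrightarrow> x \<le> x' \<Longrightarrow> ramp e y x \<le> ramp e y x'"
  by (auto simp: ramp_def divide_right_mono max.coboundedI2 min.coboundedI2 intro!: max.mono min.mono)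

lemma ramp_continuous: "0 < e \<Longrightarrow> continuous_on A (ramp e y)"
  unfolding ramp_def[abs_def] by (intro continuous_intros) auto

lemma ramp_lipschitz: "0 < e \<Longrightarrow> \<bar>ramp e y x - ramp e y x'\<bar> \<le> \<bar>x - x'\<bar> / e"
proof -
  assume e: "0 < e"
  have "\<bar>ramp e y x - ramp e y x'\<bar> \<le> \<bar>((x - y) / e + 1) - ((x' - y) / e + 1)\<bar>"
    unfolding ramp_def by linarith
  also have "\<dots> = \<bar>x - x'\<bar> / e"
    using e by (simp add: diff_divide_distrib[symmetric])
  finally show ?thesis .
qed

lemma smooth_orthant_bounds: "0 \<le> smooth_orthant m e y z" "smooth_orthant m e y z \<le> 1"
  unfolding smooth_orthant_def by (auto intro!: prod_nonneg prod_le_1 ramp_bounds)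

lemma smooth_orthant_mono:
  "0 < e \<Longrightarrow> (\<And>k. k \<in> {1..m} \<Longrightarrow> z k \<le> z' k) \<Longrightarrow> smooth_orthant m e y z \<le> smooth_orthant m e y z'"
  unfolding smooth_orthant_def by (intro prod_mono conjI ramp_bounds ramp_mono)

lemma smooth_orthant_cong:
  "(\<And>k. k \<in> {1..m} \<Longrightarrow> z k = z' k) \<Longrightarrow> smooth_orthant m e y z = smooth_orthant m e y z'"
  unfolding smooth_orthant_def by (intro prod.cong) auto

lemma smooth_orthant_diff:
  assumes e: "0 < e"
  shows "\<bar>smooth_orthant m e y z - smooth_orthant m e y z'\<bar> \<le> (\<Sum>k\<in>{1..m}. \<bar>z k - z' k\<bar> / e)"
proof -
  have "norm (smooth_orthant m e y z - smooth_orthant m e y z')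
      \<le> (\<Sum>k\<in>{1..m}. norm (ramp e (y k) (z k) - ramp e (y k) (z' k)))"
    unfolding smooth_orthant_def using ramp_bounds by (intro norm_prod_diff) (auto simp: abs_le_iff intro: order_trans[of _ 0])
  also have "\<dots> \<le> (\<Sum>k\<in>{1..m}. \<bar>z k - z' k\<bar> / e)"
    using ramp_lipschitz[OF e] by (intro sum_mono) auto
  finally show ?thesis by simp
qed

lemma smooth_orthant_continuous:
  assumes "0 < e"
  shows "continuous_on A (smooth_orthant m e y)"
  unfolding smooth_orthant_def[abs_def]
  by (intro continuous_on_prod continuous_on_compose2[OF ramp_continuous[OF assms, of UNIV]]
      continuous_on_subset[OF continuous_on_product_coordinates]) auto

lemma smooth_orthant_measurable:
  assumes "0 < e" "{1..m} \<subseteq> I"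
  shows "smooth_orthant m e y \<in> borel_measurable (PiM I (\<lambda>_. borel))"
  unfolding smooth_orthant_def[abs_def]
proof (rule borel_measurable_prod)
  fix k assume "k \<in> {1..m}"
  then have "(\<lambda>z. z k) \<in> borel_measurable (PiM I (\<lambda>_. borel :: real measure))"
    using assms(2) by (intro measurable_component_singleton) auto
  then show "(\<lambda>z. ramp e (y k) (z k)) \<in> borel_measurable (PiM I (\<lambda>_. borel))"
    by (rule measurable_compose) (rule borel_measurable_continuous_onI[OF ramp_continuous[OF assms(1)]])
qed

text \<open>Keeps of the stationary finite system only its law \<open>\<mu>\<close> and the fact
  that the reflected noise lies below \<open>\<mu>\<close> at every time of \<open>S\<close>; the
  second sample space is no longer mentioned.\<close>

locale dominated_system = embedded_system g \<sigma> qp qm n S a M F N B Y L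
  for g \<sigma> qp qm :: "nat \<Rightarrow> real" and n :: nat and S :: "real set" and a :: "nat \<Rightarrow> nat \<Rightarrow> real"
    and M :: "'a measure" and F N B Y L +
  fixes \<mu> :: "(nat \<Rightarrow> real) measure"
  assumes prob_\<mu>: "prob_space \<mu>" and sets_\<mu>: "sets \<mu> = sets (PiM {1..<n} (\<lambda>_. borel))"
    and noise_dominated: "\<And>h t. t \<in> S \<Longrightarrow> h \<in> borel_measurable (PiM {1..<n} (\<lambda>_. borel)) \<Longrightarrow>
      (\<And>z. 0 \<le> h z \<and> h z \<le> (1 :: real)) \<Longrightarrow>
      (\<And>z z'. (\<And>k. k \<in> {1..<n} \<Longrightarrow> z k \<le> z' k) \<Longrightarrow> h z \<le> h z') \<Longrightarrow>
      (\<integral>\<omega>. h (reflected_noise t \<omega>) \<partial>M) \<le> (\<integral>z. h z \<partial>\<mu>)"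
begin

interpretation \<mu>: prob_space \<mu> by (rule prob_\<mu>)

abbreviation shift_bound :: "nat \<Rightarrow> 'a \<Rightarrow> real" where
  "shift_bound k \<omega> \<equiv> (\<Sum>i\<in>{1..<n}. a k i * gap i 0 \<omega>)"

section \<open>Tail bounds uniform in time\<close>

lemma shift_bound_measurable: "(\<lambda>\<omega>. shift_bound k \<omega>) \<in> borel_measurable M"
  by (intro borel_measurable_sum borel_measurable_times borel_measurable_const gap_measurable) auto

lemma coordinate_measurable:
  "k \<in> {1..<n} \<Longrightarrow> (\<lambda>z. z k) \<in> borel_measurable gap_space"
  by (rule measurable_component_singleton)

lemma reflected_coordinate_measurable:
  assumes "k \<in> {1..<n}" "t \<in> S"
  shows "(\<lambda>\<omega>. reflected_noise t \<omega> k) \<in> borel_measurable M"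
    and "(\<lambda>\<omega>. reflected_started t \<omega> k) \<in> borel_measurable M"
  using measurable_compose[OF reflected_noise_measurable coordinate_measurable]
    measurable_compose[OF reflected_started_measurable coordinate_measurable] assms by auto

lemma noise_tail:
  assumes k: "k \<in> {1..<n}" and t: "t \<in> S"
  shows "prob {\<omega>\<in>space M. c < reflected_noise t \<omega> k} \<le> measure \<mu> {z\<in>space \<mu>. c < z k}"
proof -
  define h :: "(nat \<Rightarrow> real) \<Rightarrow> real" where "h z = indicator {c<..} (z k)" for z
  have h: "h \<in> borel_measurable gap_space"
    unfolding h_def by (rule measurable_compose[OF coordinate_measurable[OF k]]) auto
  have "prob {\<omega>\<in>space M. c < reflected_noise t \<omega> k} =
      (\<integral>\<omega>. indicator {\<omega>\<in>space M. c < reflected_noise t \<omega> k} \<omega> \<partial>M)"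
    using reflected_coordinate_measurable(1)[OF k t] by simp
  also have "\<dots> = (\<integral>\<omega>. h (reflected_noise t \<omega>) \<partial>M)"
    by (intro Bochner_Integration.integral_cong) (auto simp: h_def indicator_def)
  also have "\<dots> \<le> (\<integral>z. h z \<partial>\<mu>)"
    by (rule noise_dominated[OF t h]) (use k in \<open>force simp: h_def indicator_def\<close>)+
  also have "\<dots> = (\<integral>z. indicator {z\<in>space \<mu>. c < z k} z \<partial>\<mu>)"
    by (intro Bochner_Integration.integral_cong) (auto simp: h_def indicator_def)
  also have "\<dots> = measure \<mu> {z\<in>space \<mu>. c < z k}"
    by (simp add: Int_absorb2)
  finally show ?thesis .
qed

text \<open>The threshold doubles because the reflected path is bounded by a sum of two terms, one
  of which must exceed \<open>c\<close>.\<close>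

lemma started_tail:
  assumes k: "k \<in> {1..<n}" and t: "t \<in> S"
  shows "prob {\<omega>\<in>space M. 2 * c < reflected_started t \<omega> k} \<le>
    measure \<mu> {z\<in>space \<mu>. c < z k} + prob {\<omega>\<in>space M. c < shift_bound k \<omega>}"
proof -
  note m [measurable] = reflected_coordinate_measurable[OF k t] shift_bound_measurable[of k]
  have "prob {\<omega>\<in>space M. 2 * c < reflected_started t \<omega> k} \<le>
      prob ({\<omega>\<in>space M. c < reflected_noise t \<omega> k} \<union> {\<omega>\<in>space M. c < shift_bound k \<omega>})"
  proof (rule finite_measure_mono_AE)
    show "AE \<omega> in M. \<omega> \<in> {\<omega>\<in>space M. 2 * c < reflected_started t \<omega> k} \<longrightarrow>
        \<omega> \<in> {\<omega>\<in>space M. c < reflected_noise t \<omega> k} \<union> {\<omega>\<in>space M. c < shift_bound k \<omega>}"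
      using AE_bounds
    proof eventually_elim
      case (elim \<omega>)
      then have "reflected_started t \<omega> k \<le> reflected_noise t \<omega> k + shift_bound k \<omega>"
        using k t by blast
      then show ?case by auto
    qed
  qed measurable
  also have "\<dots> \<le> prob {\<omega>\<in>space M. c < reflected_noise t \<omega> k} + prob {\<omega>\<in>space M. c < shift_bound k \<omega>}"
    by (rule measure_Un_le) measurable
  finally show ?thesis
    using noise_tail[OF k t, of c] by linarith
qed

text \<open>Neither tail involves time, so a single threshold serves all times at once.\<close>

lemma tail_bound_small:
  assumes k: "k \<in> {1..<n}" and e: "0 < e"
  shows "\<exists>c\<ge>0. measure \<mu> {z\<in>space \<mu>. c < z k} + prob {\<omega>\<in>space M. c < shift_bound k \<omega>} \<le> e"
proof -
  have "(\<lambda>z. z k) \<in> borel_measurable \<mu>"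
    using coordinate_measurable[OF k] measurable_cong_sets[OF sets_\<mu> refl] by blast
  from \<mu>.tail_small[OF this, of "e/2"] e obtain c1 where
    c1: "c1 \<ge> 0" "\<forall>d\<ge>c1. measure \<mu> {z\<in>space \<mu>. d < z k} < e/2" by auto
  from tail_small[OF shift_bound_measurable, of "e/2" k] e obtain c2 where
    c2: "c2 \<ge> 0" "\<forall>d\<ge>c2. prob {\<omega>\<in>space M. d < shift_bound k \<omega>} < e/2" by auto
  have "measure \<mu> {z\<in>space \<mu>. max c1 c2 < z k} < e/2"
    "prob {\<omega>\<in>space M. max c1 c2 < shift_bound k \<omega>} < e/2"
    by (rule c1(2)[rule_format] c2(2)[rule_format], simp)+
  then show ?thesis
    using c1(1) by (intro exI[of _ "max c1 c2"]) (simp del: max_less_iff_conj)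
qed

lemma gap_tail:
  assumes k: "k \<in> {1..<n}" and t: "t \<in> S"
  shows "prob {\<omega>\<in>space M. 2 * c < gap k t \<omega>} \<le>
    measure \<mu> {z\<in>space \<mu>. c < z k} + prob {\<omega>\<in>space M. c < shift_bound k \<omega>}"
proof -
  note [measurable] = reflected_coordinate_measurable[OF k t]
  have "prob {\<omega>\<in>space M. 2 * c < gap k t \<omega>} \<le> prob {\<omega>\<in>space M. 2 * c < reflected_started t \<omega> k}"
  proof (rule finite_measure_mono_AE)
    show "AE \<omega> in M. \<omega> \<in> {\<omega>\<in>space M. 2 * c < gap k t \<omega>} \<longrightarrow>
        \<omega> \<in> {\<omega>\<in>space M. 2 * c < reflected_started t \<omega> k}"
      using AE_bounds
    proof eventually_elim
      case (elim \<omega>)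
      then have "gap k t \<omega> \<le> reflected_started t \<omega> k" using k t by blast
      then show ?case by auto
    qed
  qed measurable
  then show ?thesis using started_tail[OF k t, of c] by linarith
qed

text \<open>
  If the local time of a gap stopped growing, then the positive combination of gaps that only
  feels this local time would be a Brownian motion with drift from then on, contradicting
  tightness.
\<close>

lemma AE_local_time_grows:
  assumes k: "k \<in> {1..<n}" and s: "s \<in> S"
  shows "AE \<omega> in M. \<exists>t\<in>S. s \<le> t \<and> local_time (started \<omega>) k s < local_time (started \<omega>) k t"
proof -
  have lt_meas: "(\<lambda>\<omega>. local_time (started \<omega>) k t) \<in> borel_measurable M" for t
    by (intro local_time_borel_measurable S started_measurable k)
  \<comment> \<open>The event that the local time has not grown between \<open>s\<close> and the
    integer time \<open>m\<close>.\<close>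
  define A where "A m = {\<omega>\<in>space M. local_time (started \<omega>) k (real m) \<le> local_time (started \<omega>) k s}" for m
  have A: "A m \<in> sets M" for m
    unfolding A_def by (intro borel_measurable_le lt_meas)
  define D where "D t \<omega> = (\<Sum>i\<in>{1..<n}. a k i * reflected_started t \<omega> i)" for t \<omega>
  have D_meas: "D t \<in> borel_measurable M" if "t \<in> S" for t
    unfolding D_def
    by (intro borel_measurable_sum borel_measurable_times borel_measurable_const reflected_coordinate_measurable that)
  have s0: "0 \<le> s" using s S by auto
  have small: "\<exists>m. s \<le> real m \<and> prob (A m) \<le> e" if e: "0 < e" for e
  proof -
    \<comment> \<open>Three events receive \<open>e / 3\<close> each; for \<open>D\<close> this is
      shared among fewer than \<open>n\<close> coordinates.\<close>
    define e' where "e' = e / (3 * real n)"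
    have e': "0 < e'" "real n * e' = e / 3" using e n_ge_2 by (auto simp: e'_def)
    have "\<forall>i\<in>{1..<n}. \<exists>c\<ge>0. \<forall>t\<in>S. prob {\<omega>\<in>space M. c < reflected_started t \<omega> i} \<le> e'"
    proof
      fix i assume i: "i \<in> {1..<n}"
      obtain c where "c \<ge> 0" "measure \<mu> {z\<in>space \<mu>. c < z i} + prob {\<omega>\<in>space M. c < shift_bound i \<omega>} \<le> e'"
        using tail_bound_small[OF i e'(1)] by blast
      then show "\<exists>c\<ge>0. \<forall>t\<in>S. prob {\<omega>\<in>space M. c < reflected_started t \<omega> i} \<le> e'"
        using started_tail[OF i, of _ c] by (intro exI[of _ "2 * c"]) (auto intro: order_trans)
    qed
    then obtain c where c: "\<And>i. i \<in> {1..<n} \<Longrightarrow> 0 \<le> c i"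
        "\<And>i t. i \<in> {1..<n} \<Longrightarrow> t \<in> S \<Longrightarrow> prob {\<omega>\<in>space M. c i < reflected_started t \<omega> i} \<le> e'"
      by metis
    define C where "C = (\<Sum>i\<in>{1..<n}. a k i * c i)"
    have C: "0 \<le> C"
      unfolding C_def using k c by (intro sum_nonneg mult_nonneg_nonneg a_nonneg) auto
    have D_tail: "prob {\<omega>\<in>space M. C < D t \<omega>} \<le> e / 3" if t: "t \<in> S" for t
    proof -
      have sets: "{\<omega>\<in>space M. c i < reflected_started t \<omega> i} \<in> sets M" if "i \<in> {1..<n}" for i
        by (intro borel_measurable_less borel_measurable_const reflected_coordinate_measurable that t)
      have "{\<omega>\<in>space M. C < D t \<omega>} \<subseteq> (\<Union>i\<in>{1..<n}. {\<omega>\<in>space M. c i < reflected_started t \<omega> i})"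
      proof (rule ccontr)
        assume "\<not> ?thesis"
        then obtain \<omega> where "C < D t \<omega>" "\<And>i. i \<in> {1..<n} \<Longrightarrow> reflected_started t \<omega> i \<le> c i"
          by force
        moreover from this(2) have "D t \<omega> \<le> C"
          unfolding D_def C_def using k by (intro sum_mono mult_left_mono a_nonneg) auto
        ultimately show False by simp
      qed
      then have "prob {\<omega>\<in>space M. C < D t \<omega>} \<le> prob (\<Union>i\<in>{1..<n}. {\<omega>\<in>space M. c i < reflected_started t \<omega> i})"
        using sets by (intro finite_measure_mono sets.finite_UN) auto
      also have "\<dots> \<le> (\<Sum>i\<in>{1..<n}. prob {\<omega>\<in>space M. c i < reflected_started t \<omega> i})"
        using sets by (intro finite_measure_subadditive_finite) auto
      also have "\<dots> \<le> (\<Sum>i\<in>{1..<n}. e')"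
        using c t by (intro sum_mono) auto
      also have "\<dots> \<le> real n * e'"
        using e' by (simp add: mult_right_mono)
      finally show ?thesis using e' by simp
    qed
    define b where "b = a k 1 * \<sigma> 1"
    have b: "0 < b" using a_pos[OF k] sigma_pos[of 1] by (simp add: b_def)
    \<comment> \<open>The first bound turns the concentration estimate into \<open>e / 3\<close>;
      the second ensures that \<open>m\<close> lies strictly after \<open>s\<close>.\<close>
    obtain m where m: "s + (6 * C / (e * b))\<^sup>2 < real m" "s + 1 < real m"
      using reals_Archimedean2[of "max (s + (6 * C / (e * b))\<^sup>2) (s + 1)"] by auto
    then have sm: "s < real m" by simp
    have "6 * C / (e * b) \<le> sqrt (real m - s)"
      using m(1) by (intro real_le_rsqrt) simp
    then have conc: "2 * C / (b * sqrt (real m - s)) \<le> e / 3"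
      using b e sm by (simp add: field_simps)
    let ?U = "\<lambda>\<omega>. \<Sum>i\<in>{1..<n}. a k i * (free (noise B \<omega>) i (real m) - free (noise B \<omega>) i s)"
    let ?G = "{\<omega>\<in>space M. \<bar>?U \<omega>\<bar> \<le> C}"
    have U_meas: "?U \<in> borel_measurable M"
      using s naturals_in_S
      by (intro borel_measurable_sum borel_measurable_times borel_measurable_const borel_measurable_diff
          measurable_compose[OF noise_measurable free_measurable])
    have G: "?G \<in> sets M"
      by (intro borel_measurable_le borel_measurable_abs borel_measurable_const U_meas)
    have Ds: "{\<omega>\<in>space M. C < D t \<omega>} \<in> sets M" if "t \<in> S" for t
      by (intro borel_measurable_less borel_measurable_const D_meas that)
    have "prob (A m) \<le> prob (?G \<union> ({\<omega>\<in>space M. C < D s \<omega>} \<union> {\<omega>\<in>space M. C < D (real m) \<omega>}))"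
    proof (rule finite_measure_mono_AE)
      show "AE \<omega> in M. \<omega> \<in> A m \<longrightarrow> \<omega> \<in> ?G \<union> ({\<omega>\<in>space M. C < D s \<omega>} \<union> {\<omega>\<in>space M. C < D (real m) \<omega>})"
        using AE_gap_comparison
      proof eventually_elim
        case (elim \<omega>)
        have free: "bounded_forcing (free (noise B \<omega>))"
          and x: "\<And>k. k \<in> {1..<n} \<Longrightarrow> 0 \<le> gap k 0 \<omega>"
          using elim by auto
        have st: "bounded_forcing (started \<omega>)"
          unfolding started_def by (rule bounded_forcing_shift[OF free x])
        have D_eq: "D t \<omega> = (\<Sum>i\<in>{1..<n}. a k i * started \<omega> i t) + local_time (started \<omega>) k t" for t
          unfolding weighted_reflected[OF k, symmetric] D_def reflected_started_def by simp
        have D_nonneg: "0 \<le> D t \<omega>" if "t \<in> S" for t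
          unfolding D_def
        proof (intro sum_nonneg mult_nonneg_nonneg a_nonneg k)
          fix i assume "i \<in> {1..<n}"
          then show "0 \<le> reflected_started t \<omega> i"
            using reflected_nonneg'[OF st _ that] by (simp add: reflected_started_def)
        qed
        show ?case
        proof
          assume \<omega>: "\<omega> \<in> A m"
          have "local_time (started \<omega>) k s \<le> local_time (started \<omega>) k (real m)"
            using local_time_increasing[OF st, unfolded increasing_def] k s naturals_in_S sm by auto
          with \<omega> have "local_time (started \<omega>) k (real m) = local_time (started \<omega>) k s"
            by (simp add: A_def)
          \<comment> \<open>Without growth the local time cancels in the increment of
            \<open>D\<close>, which is then the pure noise increment \<open>U\<close>. As
            \<open>D\<close> is nonnegative, a large \<open>U\<close> makes \<open>D\<close> large
            at one of the two times.\<close>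
          then have "D (real m) \<omega> - D s \<omega> = ?U \<omega>"
            unfolding D_eq by (simp add: started_def right_diff_distrib sum_subtractf distrib_left sum.distrib)
          then have "\<bar>?U \<omega>\<bar> \<le> C \<or> C < D s \<omega> \<or> C < D (real m) \<omega>"
            using D_nonneg[OF s] D_nonneg[OF naturals_in_S[of m]] by linarith
          then show "\<omega> \<in> ?G \<union> ({\<omega>\<in>space M. C < D s \<omega>} \<union> {\<omega>\<in>space M. C < D (real m) \<omega>})"
            using \<omega> by (auto simp: A_def)
        qed
      qed
      show "?G \<union> ({\<omega>\<in>space M. C < D s \<omega>} \<union> {\<omega>\<in>space M. C < D (real m) \<omega>}) \<in> sets M"
        by (intro sets.Un G Ds s naturals_in_S)
    qed
    also have "\<dots> \<le> prob ?G + (prob {\<omega>\<in>space M. C < D s \<omega>} + prob {\<omega>\<in>space M. C < D (real m) \<omega>})"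
      using measure_Un_le[OF G sets.Un[OF Ds[OF s] Ds[OF naturals_in_S[of m]]]]
        measure_Un_le[OF Ds[OF s] Ds[OF naturals_in_S[of m]]] by linarith
    also have "\<dots> \<le> e / 3 + (e / 3 + e / 3)"
      using noise_increment_concentration[OF k s0 sm C] conc
      by (intro add_mono D_tail s naturals_in_S) (simp add: b_def)
    finally show ?thesis using sm by (intro exI[of _ m]) auto
  qed
  define bad where "bad = (\<Inter>m\<in>{m. s \<le> real m}. A m)"
  have ne: "{m. s \<le> real m} \<noteq> {}" using real_arch_simple by blast
  have bad: "bad \<in> sets M"
    unfolding bad_def using A ne by (intro sets.countable_INT') auto
  have "prob bad \<le> 0"
  proof (rule field_le_epsilon)
    fix e :: real assume "0 < e"
    then obtain m where "s \<le> real m" "prob (A m) \<le> e" using small by blast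
    moreover have "prob bad \<le> prob (A m)"
      using \<open>s \<le> real m\<close> A by (intro finite_measure_mono) (auto simp: bad_def)
    ultimately show "prob bad \<le> 0 + e" by simp
  qed
  then have "bad \<in> null_sets M"
    using bad by (simp add: null_sets_def emeasure_eq_measure measure_le_0_iff)
  then have "AE \<omega> in M. \<omega> \<notin> bad" by (rule AE_not_in)
  with AE_space show ?thesis
  proof eventually_elim
    case (elim \<omega>)
    then obtain m where "s \<le> real m" "\<omega> \<notin> A m" by (auto simp: bad_def)
    with elim show ?case
      using naturals_in_S[of m] by (intro bexI[of _ "real m"]) (auto simp: A_def)
  qed
qed

lemma AE_reflected_difference_tendsto:
  "AE \<omega> in M. \<forall>k\<in>{1..<n}.
    ((\<lambda>t. reflected_started t \<omega> k - reflected_noise t \<omega> k) \<longlongrightarrow> 0) (inf at_top (principal S))"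
proof -
  have "AE \<omega> in M. \<forall>k\<in>{1..<n}. \<forall>s\<in>S. \<exists>t\<in>S. s \<le> t \<and> local_time (started \<omega>) k s < local_time (started \<omega>) k t"
    by (intro AE_finite_allI finite_I AE_ball_countable[OF S(1), THEN iffD2] ballI AE_local_time_grows)
  with AE_gap_comparison show ?thesis
  proof eventually_elim
    case (elim \<omega>)
    have free: "bounded_forcing (free (noise B \<omega>))"
      and x: "\<And>k. k \<in> {1..<n} \<Longrightarrow> 0 \<le> gap k 0 \<omega>"
      using elim by auto
    show ?case
    proof
      fix k assume k: "k \<in> {1..<n}"
      have "((\<lambda>t. reflected (\<lambda>k s. gap k 0 \<omega> + free (noise B \<omega>) k s) k t - reflected (free (noise B \<omega>)) k t) \<longlongrightarrow> 0)
        (inf at_top (principal S))"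
        by (rule reflected_shift_tendsto[OF free x _ cofinal_S k])
          (use elim in \<open>auto simp: started_def\<close>)
      then show "((\<lambda>t. reflected_started t \<omega> k - reflected_noise t \<omega> k) \<longlongrightarrow> 0) (inf at_top (principal S))"
        using k by (simp add: reflected_started_def reflected_noise_def started_def)
    qed
  qed
qed

text \<open>Expectations are passed along a chain: the gaps lie below the started reflection, that
  one differs from the reflected noise by an error vanishing under dominated convergence, and the
  reflected noise lies below \<open>\<mu>\<close>.\<close>

lemma limit_le_dominating:
  assumes t: "\<And>j. t j \<in> S" "filterlim t at_top sequentially" and m: "m < n" and e: "0 < e"
    and lim: "(\<lambda>j. \<integral>\<omega>. smooth_orthant m e y (gap_process {1..<n} Y (t j) \<omega>) \<partial>M) \<longlonglongrightarrow> l"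
  shows "l \<le> (\<integral>z. smooth_orthant m e y z \<partial>\<mu>)"
proof -
  let ?h = "smooth_orthant m e y"
  have h: "?h \<in> borel_measurable gap_space"
    using m by (intro smooth_orthant_measurable e) auto
  have t0: "0 \<le> t j" for j using t(1)[of j] S by auto
  have int: "integrable M (\<lambda>\<omega>. ?h (X \<omega>))" if "X \<in> measurable M gap_space" for X
    using measurable_compose[OF that h] smooth_orthant_bounds
    by (intro integrable_const_bound[where B=1]) auto
  define d where "d j = (\<integral>\<omega>. ?h (reflected_started (t j) \<omega>) - ?h (reflected_noise (t j) \<omega>) \<partial>M)" for j
  have t_filter: "filterlim t (inf at_top (principal S)) sequentially"
    using t by (auto simp: filterlim_inf filterlim_principal)
  have "d \<longlonglongrightarrow> (\<integral>\<omega>. 0 \<partial>M)"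
    unfolding d_def
  proof (rule integral_dominated_convergence[where w="\<lambda>_. 1"])
    show "AE \<omega> in M. (\<lambda>j. ?h (reflected_started (t j) \<omega>) - ?h (reflected_noise (t j) \<omega>)) \<longlonglongrightarrow> 0"
      using AE_reflected_difference_tendsto
    proof eventually_elim
      case (elim \<omega>)
      have "(\<lambda>j. reflected_started (t j) \<omega> k - reflected_noise (t j) \<omega> k) \<longlonglongrightarrow> 0" if "k \<in> {1..m}" for k
        using elim that m by (intro filterlim_compose[OF _ t_filter]) auto
      then have "(\<lambda>j. \<Sum>k\<in>{1..m}. \<bar>reflected_started (t j) \<omega> k - reflected_noise (t j) \<omega> k\<bar> / e) \<longlonglongrightarrow> (\<Sum>k\<in>{1..m}. \<bar>0\<bar> / e)"
        using e by (intro tendsto_intros) auto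
      then have "(\<lambda>j. \<Sum>k\<in>{1..m}. \<bar>reflected_started (t j) \<omega> k - reflected_noise (t j) \<omega> k\<bar> / e) \<longlonglongrightarrow> 0"
        by simp
      then show ?case
        by (rule Lim_null_comparison[rotated]) (use smooth_orthant_diff[OF e] in auto)
    qed
    show "AE \<omega> in M. norm (?h (reflected_started (t j) \<omega>) - ?h (reflected_noise (t j) \<omega>)) \<le> 1" for j
      using smooth_orthant_bounds by (auto simp: abs_le_iff intro!: AE_I2) (smt (verit) smooth_orthant_bounds)+
    show "(\<lambda>\<omega>. ?h (reflected_started (t j) \<omega>) - ?h (reflected_noise (t j) \<omega>)) \<in> borel_measurable M" for j
      using measurable_compose[OF reflected_started_measurable[OF t(1)] h]
        measurable_compose[OF reflected_noise_measurable[OF t(1)] h] by auto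
  qed auto
  then have d: "d \<longlonglongrightarrow> 0" by simp
  have "(\<integral>\<omega>. ?h (gap_process {1..<n} Y (t j) \<omega>) \<partial>M) \<le> d j + (\<integral>z. ?h z \<partial>\<mu>)" for j
  proof -
    have "(\<integral>\<omega>. ?h (gap_process {1..<n} Y (t j) \<omega>) \<partial>M) \<le> (\<integral>\<omega>. ?h (reflected_started (t j) \<omega>) \<partial>M)"
    proof (rule integral_mono_AE[OF int int])
      show "AE \<omega> in M. ?h (gap_process {1..<n} Y (t j) \<omega>) \<le> ?h (reflected_started (t j) \<omega>)"
        using AE_bounds
      proof eventually_elim
        case (elim \<omega>)
        show ?case
        proof (rule smooth_orthant_mono[OF e])
          fix k assume "k \<in> {1..m}"
          then have "k \<in> {1..<n}" using m by auto
          with elim t(1)[of j] show "gap_process {1..<n} Y (t j) \<omega> k \<le> reflected_started (t j) \<omega> k"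
            by (simp add: gap_process_def)
        qed
      qed
    qed (intro gap_process_measurable t0 reflected_started_measurable t)+
    also have "\<dots> = d j + (\<integral>\<omega>. ?h (reflected_noise (t j) \<omega>) \<partial>M)"
      unfolding d_def
      using int[OF reflected_started_measurable[OF t(1)[of j]]] int[OF reflected_noise_measurable[OF t(1)[of j]]]
      by simp
    also have "(\<integral>\<omega>. ?h (reflected_noise (t j) \<omega>) \<partial>M) \<le> (\<integral>z. ?h z \<partial>\<mu>)"
      using m by (intro noise_dominated t h smooth_orthant_mono e) (auto simp: smooth_orthant_bounds)
    finally show ?thesis by simp
  qed
  then have "l \<le> 0 + (\<integral>z. ?h z \<partial>\<mu>)"
    by (intro LIMSEQ_le[OF lim tendsto_add[OF d tendsto_const]]) auto
  then show ?thesis by simp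
qed

end

section \<open>Passage to the limit\<close>

text \<open>The matrix \<open>a\<close> is chosen before \<open>S\<close>, so that constants
  depending on \<open>a\<close> remain valid when the time set is changed to include a new
  time.\<close>

lemma dominated_system_exists:
  assumes sigma_pos: "\<And>k. k \<ge> 1 \<Longrightarrow> 0 < \<sigma> k"
    and q_sum: "\<And>k. k \<ge> 1 \<Longrightarrow> qp (Suc k) + qm k = 1"
    and qp: "\<And>k. k \<ge> 1 \<Longrightarrow> 0 < qp k" and qm: "\<And>k. k \<ge> 1 \<Longrightarrow> 0 < qm k"
    and n: "2 \<le> n" and sys: "ranked_system M F \<infinity> g \<sigma> qp qm B Y L"
    and stationary: "stationary_gap_distribution TYPE('b) (enat n) g \<sigma> qp qm \<mu>"
  shows "\<exists>a. \<forall>S. countable S \<and> S \<subseteq> {0..} \<and> \<rat> \<inter> {0..} \<subseteq> S \<longrightarrow>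
    dominated_system g \<sigma> qp qm n S a M F \<infinity> B Y L \<mu>"
proof -
  obtain a where a: "\<And>k. k \<in> {1..<n} \<Longrightarrow> 0 < a k 1"
      "skorokhod_orthant {1..<n} (collision_matrix qp qm) a"
    using collision_matrix_inverse[of qp qm n] q_sum qp qm by blast
  obtain M' :: "'b measure" and F' B' Y' L' where
    sys': "ranked_system M' F' (enat n) g \<sigma> qp qm B' Y' L'"
    and law: "\<And>t. 0 \<le> t \<Longrightarrow> gap_law M' {1..<n} Y' t = \<mu>"
    using stationary unfolding stationary_gap_distribution_def gaps_finite by blast
  have \<mu>: "prob_space \<mu>" "sets \<mu> = sets (PiM {1..<n} (\<lambda>_. borel))"
    using stationary by (auto simp: stationary_gap_distribution_def orthant_distribution_def gaps_finite)
  show ?thesis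
  proof (intro exI[of _ a] allI impI)
    fix S :: "real set" assume S: "countable S \<and> S \<subseteq> {0..} \<and> \<rat> \<inter> {0..} \<subseteq> S"
    have ps: "particle_system \<sigma> qp qm n S a"
      using n q_sum qm sigma_pos S a by (simp add: particle_system_def)
    have es: "embedded_system g \<sigma> qp qm n S a M F \<infinity> B Y L"
      using ps sys by (simp add: embedded_system_def embedded_system_axioms_def)
    have es': "embedded_system g \<sigma> qp qm n S a M' F' (enat n) B' Y' L'"
      using ps sys' by (simp add: embedded_system_def embedded_system_axioms_def)
    show "dominated_system g \<sigma> qp qm n S a M F \<infinity> B Y L \<mu>"
    proof (intro dominated_system.intro es dominated_system_axioms.intro \<mu>)
      fix h :: "(nat \<Rightarrow> real) \<Rightarrow> real" and t
      assume t: "t \<in> S" and h: "h \<in> borel_measurable (PiM {1..<n} (\<lambda>_. borel))"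
        "\<And>z. 0 \<le> h z \<and> h z \<le> 1"
        "\<And>z z'. (\<And>k. k \<in> {1..<n} \<Longrightarrow> z k \<le> z' k) \<Longrightarrow> h z \<le> h z'"
      have "0 \<le> t" using S t by auto
      then show "(\<integral>\<omega>. h (embedded_system.reflected_noise g \<sigma> qp qm n S B t \<omega>) \<partial>M) \<le> (\<integral>z. h z \<partial>\<mu>)"
        using noise_dominated_by_stationary[OF es es' t h] law by simp
    qed
  qed
qed

section \<open>Orthant distributions, marginals and smooth test functions\<close>

lemma orthant_measurable:
  assumes "countable I"
  shows "orthant I \<in> sets (PiM I (\<lambda>_. borel))"
  unfolding orthant_def using assms by (intro sets_PiM_I_countable) auto

lemma upper_orthant_measurable:
  assumes "countable I"
  shows "upper_orthant I y \<in> sets (PiM I (\<lambda>_. borel))"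
  unfolding upper_orthant_def using assms by (intro sets_PiM_I_countable) auto

lemma set_integral_orthant:
  fixes f :: "(nat \<Rightarrow> real) \<Rightarrow> real"
  assumes "sets \<mu> = sets (PiM I (\<lambda>_. borel))" "AE z in \<mu>. z \<in> orthant I"
    and "f \<in> borel_measurable (PiM I (\<lambda>_. borel))"
  shows "(LINT z:orthant I|\<mu>. f z) = (\<integral>z. f z \<partial>\<mu>)"
proof -
  have f: "f \<in> borel_measurable \<mu>"
    using assms(3) measurable_cong_sets[OF assms(1) refl] by blast
  have "orthant I \<in> sets \<mu>"
    using orthant_measurable[of I] assms(1) by (simp add: countableI_type)
  then show ?thesis
    unfolding set_lebesgue_integral_def using assms(2) f
    by (intro integral_cong_AE) (auto simp: indicator_def)
qed

lemma smooth_orthant_integrable: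
  assumes "finite_measure \<mu>" "sets \<mu> = sets (PiM I (\<lambda>_. borel))" "{1..m} \<subseteq> I" "0 < e"
  shows "integrable \<mu> (smooth_orthant m e y)"
  using smooth_orthant_measurable[OF assms(4,3)] measurable_cong_sets[OF assms(2) refl] smooth_orthant_bounds
  by (intro finite_measure.integrable_const_bound[OF assms(1), where B=1]) auto

lemma marginal_orthant_distribution:
  assumes \<mu>: "orthant_distribution I \<mu>" and I: "{1..m} \<subseteq> I"
  shows "orthant_distribution {1..m} (marginal \<mu> m)"
proof -
  have prob: "prob_space \<mu>" and sets: "sets \<mu> = sets (PiM I (\<lambda>_. borel))" and AE: "AE z in \<mu>. z \<in> orthant I"
    using \<mu> by (auto simp: orthant_distribution_def)
  have meas: "(\<lambda>z. restrict z {1..m}) \<in> measurable \<mu> (PiM {1..m} (\<lambda>_. borel))"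
    unfolding measurable_cong_sets[OF sets refl] using I by (rule measurable_restrict_subset)
  have "AE z in \<mu>. restrict z {1..m} \<in> orthant {1..m}"
    using AE by eventually_elim (use I in \<open>auto simp: orthant_def PiE_iff\<close>)
  then show ?thesis
    unfolding orthant_distribution_def marginal_def
    using prob_space.prob_space_distr[OF prob meas] orthant_measurable[of "{1..m}"]
    by (auto simp: AE_distr_iff[OF meas] countableI_type)
qed

lemma smooth_orthant_marginal:
  assumes \<mu>: "orthant_distribution I \<mu>" and I: "{1..m} \<subseteq> I" and e: "0 < e"
  shows "(LINT z:orthant {1..m}|marginal \<mu> m. smooth_orthant m e y z) = (\<integral>z. smooth_orthant m e y z \<partial>\<mu>)"
proof -
  have sets: "sets \<mu> = sets (PiM I (\<lambda>_. borel))"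
    using \<mu> by (auto simp: orthant_distribution_def)
  have meas: "(\<lambda>z. restrict z {1..m}) \<in> measurable \<mu> (PiM {1..m} (\<lambda>_. borel))"
    unfolding measurable_cong_sets[OF sets refl] using I by (rule measurable_restrict_subset)
  have h: "smooth_orthant m e y \<in> borel_measurable (PiM {1..m} (\<lambda>_. borel))"
    by (rule smooth_orthant_measurable[OF e]) simp
  have "(LINT z:orthant {1..m}|marginal \<mu> m. smooth_orthant m e y z) = (\<integral>z. smooth_orthant m e y z \<partial>marginal \<mu> m)"
    using marginal_orthant_distribution[OF \<mu> I] h
    by (intro set_integral_orthant) (auto simp: orthant_distribution_def)
  also have "\<dots> = (\<integral>z. smooth_orthant m e y (restrict z {1..m}) \<partial>\<mu>)"
    unfolding marginal_def by (rule integral_distr[OF meas h])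
  also have "\<dots> = (\<integral>z. smooth_orthant m e y z \<partial>\<mu>)"
    by (intro Bochner_Integration.integral_cong refl smooth_orthant_cong) simp
  finally show ?thesis .
qed

text \<open>The smooth majorants converge to the indicator of the upper orthant. Convergence is
  needed under \<open>\<pi>\<close> only; under \<open>\<nu>\<close> the majorant property
  suffices.\<close>

lemma stochastically_dominated_of_smooth:
  assumes \<nu>: "orthant_distribution {1..} \<nu>" and \<pi>: "orthant_distribution {1..} \<pi>"
    and le: "\<And>m e y. 1 \<le> m \<Longrightarrow> 0 < e \<Longrightarrow> (\<integral>z. smooth_orthant m e y z \<partial>\<nu>) \<le> (\<integral>z. smooth_orthant m e y z \<partial>\<pi>)"
  shows "stochastically_dominated {1..} \<nu> \<pi>"
  unfolding stochastically_dominated_def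
proof
  fix y :: "nat \<Rightarrow> real"
  let ?U = "upper_orthant {1..} y"
  interpret \<nu>: prob_space \<nu> using \<nu> by (simp add: orthant_distribution_def)
  interpret \<pi>: prob_space \<pi> using \<pi> by (simp add: orthant_distribution_def)
  have sets: "sets \<nu> = sets (PiM {1..} (\<lambda>_. borel))" "sets \<pi> = sets (PiM {1..} (\<lambda>_. borel))"
    using \<nu> \<pi> by (auto simp: orthant_distribution_def)
  have U: "?U \<in> sets \<nu>" "?U \<in> sets \<pi>"
    unfolding sets by (rule upper_orthant_measurable, simp)+
  \<comment> \<open>One index drives both limits: more coordinates and steeper ramps.\<close>
  define h where "h i = smooth_orthant (Suc i) (1 / real (Suc i)) y" for i
  have h_meas: "h i \<in> borel_measurable \<pi>" for i
    unfolding h_def measurable_cong_sets[OF sets(2) refl] by (rule smooth_orthant_measurable) auto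
  have on_U: "h i z = 1" if "z \<in> ?U" for i z
    unfolding h_def smooth_orthant_def using that
    by (intro prod.neutral) (auto simp: upper_orthant_def PiE_iff ramp_def)
  have "(\<lambda>i. \<integral>z. h i z \<partial>\<pi>) \<longlonglongrightarrow> (\<integral>z. indicator ?U z \<partial>\<pi>)"
  proof (rule integral_dominated_convergence[where w="\<lambda>_. 1"])
    have "(\<lambda>i. h i z) \<longlonglongrightarrow> indicator ?U z" if z: "z \<in> space \<pi>" for z
    proof (cases "z \<in> ?U")
      case True
      then show ?thesis using on_U by simp
    next
      case False
      have "z \<in> extensional {1..}"
        using z sets_eq_imp_space_eq[OF sets(2)] by (auto simp: space_PiM PiE_def)
      with False obtain k where k: "1 \<le> k" "z k < y k"
        by (auto simp: upper_orthant_def PiE_iff not_le)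
      then obtain i0 where i0: "1 / real (Suc i0) < y k - z k"
        using reals_Archimedean[of "y k - z k"] by (auto simp: inverse_eq_divide)
      \<comment> \<open>From \<open>k\<close> on, the violated coordinate takes part in the product;
        from \<open>i0\<close> on, its ramp is narrower than the violation.\<close>
      have "h i z = 0" if i: "max k i0 \<le> i" for i
      proof -
        have "1 / real (Suc i) \<le> 1 / real (Suc i0)"
          using i by (intro divide_left_mono) auto
        then have "1 / real (Suc i) \<le> y k - z k" using i0 by linarith
        then have "1 \<le> (y k - z k) * real (Suc i)"
          by (simp add: pos_divide_le_eq)
        then have "ramp (1 / real (Suc i)) (y k) (z k) = 0"
          by (simp add: ramp_def algebra_simps del: of_nat_Suc)
        then show ?thesis
          unfolding h_def smooth_orthant_def using k i by (intro prod_zero) auto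
      qed
      then have "\<forall>\<^sub>F i in sequentially. h i z = 0"
        unfolding eventually_sequentially by blast
      then show ?thesis using False by (simp add: tendsto_eventually)
    qed
    then show "AE z in \<pi>. (\<lambda>i. h i z) \<longlonglongrightarrow> indicator ?U z" by auto
    show "AE z in \<pi>. norm (h i z) \<le> 1" for i
      using smooth_orthant_bounds by (simp add: h_def)
  qed (use U h_meas in auto)
  then have lim: "(\<lambda>i. \<integral>z. h i z \<partial>\<pi>) \<longlonglongrightarrow> measure \<pi> ?U"
    using U sets.sets_into_space[OF U(2)] by (simp add: Int_absorb2)
  have "measure \<nu> ?U \<le> (\<integral>z. h i z \<partial>\<pi>)" for i
  proof -
    have "measure \<nu> ?U = (\<integral>z. indicator ?U z \<partial>\<nu>)"
      using U sets.sets_into_space[OF U(1)] by (simp add: Int_absorb2)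
    also have "\<dots> \<le> (\<integral>z. h i z \<partial>\<nu>)"
    proof (rule integral_mono)
      show "integrable \<nu> (h i)"
        unfolding h_def by (rule smooth_orthant_integrable[OF \<nu>.finite_measure_axioms sets(1)]) auto
      show "indicator ?U z \<le> h i z" for z
        using on_U[of z i] smooth_orthant_bounds by (auto simp: indicator_def h_def)
    qed (use U in \<open>auto simp: \<nu>.emeasure_finite less_top[symmetric]\<close>)
    also have "\<dots> \<le> (\<integral>z. h i z \<partial>\<pi>)"
      unfolding h_def by (rule le) auto
    finally show ?thesis .
  qed
  then show "measure \<nu> ?U \<le> measure \<pi> ?U"
    by (intro LIMSEQ_le_const[OF lim]) auto
qed

text \<open>
  The parameter \<open>type_b\<close> only serves to fix the type of the sample spaces on which the finite
  stationary systems live.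
\<close>

locale stationary_sequence =
  fixes g \<sigma> qp qm :: "nat \<Rightarrow> real" and N :: "nat \<Rightarrow> nat"
    and \<pi>s :: "nat \<Rightarrow> (nat \<Rightarrow> real) measure" and \<pi> :: "(nat \<Rightarrow> real) measure" and type_b :: "'b itself"
  assumes sigma_pos: "\<And>n. n \<ge> 1 \<Longrightarrow> \<sigma> n > 0"
    and q_sum: "\<And>n. n \<ge> 1 \<Longrightarrow> qp (Suc n) + qm n = 1"
    and qp_range: "\<And>n. n \<ge> 1 \<Longrightarrow> 0 < qp n \<and> qp n < 1"
    and qm_range: "\<And>n. n \<ge> 1 \<Longrightarrow> 0 < qm n \<and> qm n < 1"
    and N_ge_2: "\<And>j. N j \<ge> 2"
    and N_tendsto: "filterlim N at_top sequentially"
    and stationary: "\<And>j. stationary_gap_distribution TYPE('b) (enat (N j)) g \<sigma> qp qm (\<pi>s j)"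
    and pi_distribution: "orthant_distribution {1..} \<pi>"
    and pi_limit: "\<And>m. m \<ge> 1 \<Longrightarrow>
      weakly_converges (orthant {1..m}) (\<lambda>j. marginal (\<pi>s j) m) (marginal \<pi> m)"
begin

lemma dominated_system:
  assumes "ranked_system M F \<infinity> g \<sigma> qp qm B Y L"
  shows "\<exists>a. \<forall>S. countable S \<and> S \<subseteq> {0..} \<and> \<rat> \<inter> {0..} \<subseteq> S \<longrightarrow>
    dominated_system g \<sigma> qp qm (N j) S a M F \<infinity> B Y L (\<pi>s j)"
  using sigma_pos q_sum qp_range qm_range
  by (intro dominated_system_exists[OF _ _ _ _ N_ge_2 assms stationary]) auto

lemma eventually_N_greater: "\<forall>\<^sub>F j in sequentially. m < N j"
  using N_tendsto[unfolded filterlim_at_top, rule_format, of "Suc m"] by (simp add: Suc_le_eq)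

lemma gap_process_infinite_measurable:
  assumes sys: "ranked_system M F \<infinity> g \<sigma> qp qm B Y L" and t: "0 \<le> t"
  shows "gap_process {1..} Y t \<in> measurable M (PiM {1..} (\<lambda>_. borel))"
proof -
  interpret ranked_system M F \<infinity> g \<sigma> qp qm B Y L by fact
  have "Y k t \<in> borel_measurable M" if "1 \<le> k" for k
    using that by (intro adapted_measurable[OF adapted_Y t]) (auto simp: particles_def)
  then show ?thesis
    unfolding gap_process_def by (intro measurable_restrict borel_measurable_diff) auto
qed

lemma AE_gap_nonneg:
  assumes sys: "ranked_system M F \<infinity> g \<sigma> qp qm B Y L"
  shows "AE \<omega> in M. \<forall>k\<in>{1..}. \<forall>t\<ge>0. Y k t \<omega> \<le> Y (Suc k) t \<omega>"
proof -
  interpret ranked_system M F \<infinity> g \<sigma> qp qm B Y L by fact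
  show ?thesis
    by (subst AE_ball_countable) (auto intro!: ranked simp: gaps_infinity)
qed

lemma gap_law_orthant_distribution:
  assumes sys: "ranked_system M F \<infinity> g \<sigma> qp qm B Y L" and t: "0 \<le> t"
  shows "orthant_distribution {1..} (gap_law M {1..} Y t)"
proof -
  interpret ranked_system M F \<infinity> g \<sigma> qp qm B Y L by fact
  note meas = gap_process_infinite_measurable[OF sys t]
  have "AE \<omega> in M. gap_process {1..} Y t \<omega> \<in> orthant {1..}"
    using AE_gap_nonneg[OF sys] by eventually_elim (use t in \<open>auto simp: gap_process_def orthant_def\<close>)
  then show ?thesis
    unfolding orthant_distribution_def gap_law_def
    using prob_space_distr[OF meas] orthant_measurable[of "{1::nat..}"]
    by (auto simp: AE_distr_iff[OF meas] countableI_type)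
qed

text \<open>Any finite system with more than \<open>k\<close> particles controls gap
  \<open>k\<close>. The time set is enlarged by each \<open>t\<close> in turn, while the threshold
  depends only on \<open>a\<close> and the initial gaps.\<close>

lemma uniform_tail:
  assumes sys: "ranked_system M F \<infinity> g \<sigma> qp qm B Y L" and k: "1 \<le> k" and e: "0 < e"
  shows "\<exists>c\<ge>0. \<forall>t\<ge>0. measure M {\<omega>\<in>space M. c < Y (Suc k) t \<omega> - Y k t \<omega>} \<le> e"
proof -
  obtain j where j: "k < N j"
    using eventually_N_greater[of k] unfolding eventually_sequentially by blast
  obtain a where a: "\<forall>S. countable S \<and> S \<subseteq> {0..} \<and> \<rat> \<inter> {0..} \<subseteq> S \<longrightarrow>
      dominated_system g \<sigma> qp qm (N j) S a M F \<infinity> B Y L (\<pi>s j)"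
    using dominated_system[OF sys, of j] ..
  have rat: "countable (insert t (\<rat> \<inter> {0..}))" for t :: real
    using countable_rat by auto
  have k': "k \<in> {1..<N j}" using k j by simp
  interpret D0: dominated_system g \<sigma> qp qm "N j" "insert 0 (\<rat> \<inter> {0..})" a M F \<infinity> B Y L "\<pi>s j"
    by (rule a[rule_format]) (use rat in auto)
  obtain c where c: "c \<ge> 0" "measure (\<pi>s j) {z\<in>space (\<pi>s j). c < z k} +
      measure M {\<omega>\<in>space M. c < D0.shift_bound k \<omega>} \<le> e"
    using D0.tail_bound_small[OF k' e] by blast
  have "measure M {\<omega>\<in>space M. 2 * c < Y (Suc k) t \<omega> - Y k t \<omega>} \<le> e" if "0 \<le> t" for t
  proof -
    interpret D: dominated_system g \<sigma> qp qm "N j" "insert t (\<rat> \<inter> {0..})" a M F \<infinity> B Y L "\<pi>s j"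
      by (rule a[rule_format]) (use that rat in auto)
    show ?thesis
      by (rule order_trans[OF D.gap_tail[OF k'] c(2)]) simp
  qed
  then show ?thesis using c(1) by (intro exI[of _ "2 * c"]) auto
qed

text \<open>Coordinates receive failure probabilities from a geometric series with sum
  \<open>\<epsilon>\<close>; the product of the resulting intervals is compact.\<close>

lemma tight_gap_laws:
  assumes sys: "ranked_system M F \<infinity> g \<sigma> qp qm B Y L"
  shows "tight_on (orthant {1..}) {0..} (gap_law M {1..} Y)"
  unfolding tight_on_def
proof (intro allI impI)
  interpret ranked_system M F \<infinity> g \<sigma> qp qm B Y L by fact
  fix \<epsilon> :: real assume \<epsilon>: "0 < \<epsilon>"
  have "\<exists>c\<ge>0. \<forall>t\<ge>0. prob {\<omega>\<in>space M. c < Y (Suc (Suc i)) t \<omega> - Y (Suc i) t \<omega>} \<le> \<epsilon> * (1/2) ^ Suc i" for i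
    using \<epsilon> by (intro uniform_tail[OF sys]) auto
  then obtain c where c: "\<And>i t. 0 \<le> t \<Longrightarrow>
      prob {\<omega>\<in>space M. c i < Y (Suc (Suc i)) t \<omega> - Y (Suc i) t \<omega>} \<le> \<epsilon> * (1/2) ^ Suc i"
    by metis
  define K where "K = (\<Pi>\<^sub>E k\<in>{1..}. {0..c (k - 1)})"
  \<comment> \<open>Coordinate 0 lies outside the index set and is frozen at
    \<open>undefined\<close>, so that compactness of products over the full index type
    applies.\<close>
  have "compactin (product_topology (\<lambda>_. euclidean) UNIV)
      (\<Pi>\<^sub>E k\<in>UNIV. if 1 \<le> k then {0..c (k - 1)} else {undefined})"
    unfolding compactin_PiE by auto
  also have "(\<Pi>\<^sub>E k\<in>UNIV. if 1 \<le> k then {0..c (k - 1)} else {undefined}) = K"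
    by (auto simp: K_def PiE_iff extensional_def split: if_splits)
  finally have "compact K"
    by (simp add: euclidean_product_topology)
  moreover have "K \<subseteq> orthant {1..}"
    by (auto simp: K_def orthant_def PiE_iff)
  moreover have "1 - \<epsilon> \<le> measure (gap_law M {1..} Y t) K" if t: "t \<in> {0..}" for t
  proof -
    have t0: "0 \<le> t" using t by simp
    note meas = gap_process_infinite_measurable[OF sys t0]
    define A where "A i = {\<omega>\<in>space M. c i < Y (Suc (Suc i)) t \<omega> - Y (Suc i) t \<omega>}" for i
    have "Y k t \<in> borel_measurable M" if "1 \<le> k" for k
      using that by (intro adapted_measurable[OF adapted_Y t0]) (auto simp: particles_def)
    then have A: "A i \<in> sets M" for i
      unfolding A_def by (intro borel_measurable_less borel_measurable_const borel_measurable_diff) auto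
    have K: "K \<in> sets (PiM {1..} (\<lambda>_. borel))"
      unfolding K_def by (intro sets_PiM_I_countable) auto
    let ?E = "gap_process {1..} Y t -` K \<inter> space M"
    have E: "?E \<in> sets M" by (rule measurable_sets[OF meas K])
    have geo: "(\<lambda>i. \<epsilon> * (1/2) ^ Suc i) sums \<epsilon>"
      using sums_mult[OF power_half_series, of \<epsilon>] by simp
    have summ: "summable (\<lambda>i. prob (A i))"
      by (rule summable_comparison_test'[OF sums_summable[OF geo], of 0]) (use c[OF t0] in \<open>auto simp: A_def\<close>)
    have "prob (space M - ?E) \<le> prob (\<Union>i. A i)"
    proof (rule finite_measure_mono_AE)
      show "AE \<omega> in M. \<omega> \<in> space M - ?E \<longrightarrow> \<omega> \<in> (\<Union>i. A i)"
        using AE_gap_nonneg[OF sys]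
      proof eventually_elim
        case (elim \<omega>)
        show ?case
        proof
          assume "\<omega> \<in> space M - ?E"
          then have \<omega>: "\<omega> \<in> space M" "gap_process {1..} Y t \<omega> \<notin> K" by auto
          then obtain k where k: "1 \<le> k" "\<not> (Y (Suc k) t \<omega> - Y k t \<omega> \<in> {0..c (k - 1)})"
            by (auto simp: K_def gap_process_def PiE_iff)
          have "0 \<le> Y (Suc k) t \<omega> - Y k t \<omega>" using elim k(1) t0 by simp
          with k(2) have "c (k - 1) < Y (Suc k) t \<omega> - Y k t \<omega>" by simp
          then have "\<omega> \<in> A (k - 1)" using \<omega>(1) k(1) by (simp add: A_def)
          then show "\<omega> \<in> (\<Union>i. A i)" by blast
        qed
      qed
    qed (use A in auto)
    also have "\<dots> \<le> (\<Sum>i. prob (A i))"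
      using A summ by (intro finite_measure_subadditive_countably) auto
    also have "\<dots> \<le> (\<Sum>i. \<epsilon> * (1/2) ^ Suc i)"
      using c[OF t0] summ sums_summable[OF geo] by (intro suminf_le) (auto simp: A_def)
    also have "\<dots> = \<epsilon>" using geo by (rule sums_unique[symmetric])
    finally show ?thesis
      using prob_compl[OF E] measure_distr[OF meas K] by (simp add: gap_law_def)
  qed
  ultimately show "\<exists>K. compact K \<and> K \<subseteq> orthant {1..} \<and> (\<forall>t\<in>{0..}. measure (gap_law M {1..} Y t) K \<ge> 1 - \<epsilon>)"
    by blast
qed

text \<open>The two limits are taken one after the other: with a finite system fixed, time tends to
  infinity; then the number of particles does.\<close>

lemma limit_dominated:
  assumes sys: "ranked_system M F \<infinity> g \<sigma> qp qm B Y L"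
    and t: "\<And>j. 0 \<le> t j" "filterlim t at_top sequentially"
    and \<nu>: "orthant_distribution {1..} \<nu>"
    and conv: "weakly_converges (orthant {1..}) (\<lambda>j. gap_law M {1..} Y (t j)) \<nu>"
  shows "stochastically_dominated {1..} \<nu> \<pi>"
proof (rule stochastically_dominated_of_smooth[OF \<nu> pi_distribution])
  fix m :: nat and e :: real and y :: "nat \<Rightarrow> real" assume m: "1 \<le> m" and e: "0 < e"
  let ?h = "smooth_orthant m e y"
  have cont: "continuous_on A ?h \<and> bounded (?h ` A)" for A
    using smooth_orthant_continuous[OF e] smooth_orthant_bounds
    by (auto simp: bounded_iff intro!: exI[of _ 1])
  have h: "?h \<in> borel_measurable (PiM {1..} (\<lambda>_. borel))"
    by (rule smooth_orthant_measurable[OF e]) auto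
  have full: "(LINT z:orthant {1..}|\<mu>. ?h z) = (\<integral>z. ?h z \<partial>\<mu>)" if "orthant_distribution {1..} \<mu>" for \<mu>
    using that h by (intro set_integral_orthant) (auto simp: orthant_distribution_def)
  have lim: "(\<lambda>j. \<integral>z. ?h z \<partial>gap_law M {1..} Y (t j)) \<longlonglongrightarrow> (\<integral>z. ?h z \<partial>\<nu>)"
    using conv cont[of "orthant {1..}"] full[OF \<nu>] full[OF gap_law_orthant_distribution[OF sys t(1)]]
    unfolding weakly_converges_def by auto
  have lim_\<pi>: "(\<lambda>i. LINT z:orthant {1..m}|marginal (\<pi>s i) m. ?h z) \<longlonglongrightarrow> (\<integral>z. ?h z \<partial>\<pi>)"
    using pi_limit[OF m] cont[of "orthant {1..m}"] smooth_orthant_marginal[OF pi_distribution, of m e y] e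
    unfolding weakly_converges_def by auto
  have le: "(\<integral>z. ?h z \<partial>\<nu>) \<le> (LINT z:orthant {1..m}|marginal (\<pi>s i) m. ?h z)" if i: "m < N i" for i
  proof -
    obtain a where a: "\<forall>S. countable S \<and> S \<subseteq> {0..} \<and> \<rat> \<inter> {0..} \<subseteq> S \<longrightarrow>
        dominated_system g \<sigma> qp qm (N i) S a M F \<infinity> B Y L (\<pi>s i)"
      using dominated_system[OF sys, of i] ..
    \<comment> \<open>The time set contains the given sequence, so the almost sure comparison holds
      along it simultaneously.\<close>
    interpret D: dominated_system g \<sigma> qp qm "N i" "range t \<union> (\<rat> \<inter> {0..})" a M F \<infinity> B Y L "\<pi>s i"
      by (rule a[rule_format]) (use countable_rat t(1) in auto)
    have eq: "(\<integral>z. ?h z \<partial>gap_law M {1..} Y (t j)) = (\<integral>\<omega>. ?h (gap_process {1..<N i} Y (t j) \<omega>) \<partial>M)" for j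
      unfolding gap_law_def
      by (subst integral_distr[OF gap_process_infinite_measurable[OF sys t(1)] h])
        (intro Bochner_Integration.integral_cong refl smooth_orthant_cong, use i in \<open>auto simp: gap_process_def\<close>)
    have "(\<integral>z. ?h z \<partial>\<nu>) \<le> (\<integral>z. ?h z \<partial>\<pi>s i)"
      using lim unfolding eq by (intro D.limit_le_dominating[OF _ t(2) i e]) auto
    also have "orthant_distribution {1..<N i} (\<pi>s i)"
      using stationary[of i] by (simp add: stationary_gap_distribution_def gaps_finite)
    then have "(\<integral>z. ?h z \<partial>\<pi>s i) = (LINT z:orthant {1..m}|marginal (\<pi>s i) m. ?h z)"
      using i e by (intro smooth_orthant_marginal[symmetric]) auto
    finally show ?thesis .
  qed
  show "(\<integral>z. ?h z \<partial>\<nu>) \<le> (\<integral>z. ?h z \<partial>\<pi>)"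
    by (rule tendsto_lowerbound[OF lim_\<pi>])
      (use eventually_N_greater[of m] le in \<open>auto elim: eventually_mono\<close>)
qed

end

theorem theorem4p6:
  fixes g \<sigma> qp qm :: "nat \<Rightarrow> real"
    and M :: "'a measure" and F :: "real \<Rightarrow> 'a measure"
    and B Y L :: "nat \<Rightarrow> real \<Rightarrow> 'a \<Rightarrow> real"
    and N :: "nat \<Rightarrow> nat"
    and \<pi>s :: "nat \<Rightarrow> (nat \<Rightarrow> real) measure"
    and \<pi> :: "(nat \<Rightarrow> real) measure"
  assumes sigma_pos: "\<And>n. n \<ge> 1 \<Longrightarrow> \<sigma> n > 0"
    and q_sum: "\<And>n. n \<ge> 1 \<Longrightarrow> qp (Suc n) + qm n = 1"
    and qp_range: "\<And>n. n \<ge> 1 \<Longrightarrow> 0 < qp n \<and> qp n < 1"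
    and qm_range: "\<And>n. n \<ge> 1 \<Longrightarrow> 0 < qm n \<and> qm n < 1"
    and version: "ranked_system M F \<infinity> g \<sigma> qp qm B Y L"
    and N_ge_2: "\<And>j. N j \<ge> 2"
    and N_tendsto: "filterlim N at_top sequentially"
    and stationary:
      "\<And>j. stationary_gap_distribution TYPE('b) (enat (N j)) g \<sigma> qp qm (\<pi>s j)"
    and pi_distribution: "orthant_distribution {1..} \<pi>"
    and pi_limit:
      "\<And>m. m \<ge> 1 \<Longrightarrow> weakly_converges (orthant {1..m}) (\<lambda>j. marginal (\<pi>s j) m) (marginal \<pi> m)"
  shows "tight_on (orthant {1..}) {0..} (gap_law M {1..} Y) \<and>
    (\<forall>(t :: nat \<Rightarrow> real) \<nu>.
       (\<forall>j. t j \<ge> 0) \<and> incseq t \<and> filterlim t at_top sequentially \<and>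
       orthant_distribution {1..} \<nu> \<and>
       weakly_converges (orthant {1..}) (\<lambda>j. gap_law M {1..} Y (t j)) \<nu>
       \<longrightarrow> stochastically_dominated {1..} \<nu> \<pi>) \<and>
    (bdd_below (g ` {1..}) \<and> bdd_above ((\<lambda>n. (\<sigma> n)\<^sup>2) ` {1..}) \<and>
       (\<exists>n0\<ge>1. \<forall>n\<ge>n0. qp n \<ge> 1/2) \<and>
       (AE z in \<pi>. \<forall>\<alpha>>0. summable (\<lambda>n. exp (- \<alpha> * (\<Sum>i=1..Suc n. z i)\<^sup>2)))
       \<longrightarrow> (\<forall>\<pi>'. stationary_gap_distribution TYPE('c) \<infinity> g \<sigma> qp qm \<pi>'
              \<longrightarrow> stochastically_dominated {1..} \<pi>' \<pi>))"
proof (intro conjI allI impI)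
  interpret stationary_sequence g \<sigma> qp qm N \<pi>s \<pi> "TYPE('b)"
    by unfold_locales (fact assms)+
  show "tight_on (orthant {1..}) {0..} (gap_law M {1..} Y)"
    by (rule tight_gap_laws[OF version])
  show "stochastically_dominated {1..} \<nu> \<pi>"
    if "(\<forall>j. t j \<ge> 0) \<and> incseq t \<and> filterlim t at_top sequentially \<and>
       orthant_distribution {1..} \<nu> \<and>
       weakly_converges (orthant {1..}) (\<lambda>j. gap_law M {1..} Y (t j)) \<nu>"
    for t :: "nat \<Rightarrow> real" and \<nu>
    using that by (intro limit_dominated[OF version, of t]) auto
  show "stochastically_dominated {1..} \<pi>' \<pi>"
    if \<pi>': "stationary_gap_distribution TYPE('c) \<infinity> g \<sigma> qp qm \<pi>'" for \<pi>'
  proof -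
    obtain M' :: "'c measure" and F' B' Y' L' where
      sys': "ranked_system M' F' \<infinity> g \<sigma> qp qm B' Y' L'"
      and law: "\<forall>t\<ge>0. gap_law M' {1..} Y' t = \<pi>'"
      using \<pi>' unfolding stationary_gap_distribution_def gaps_infinity by blast
    show ?thesis
    \<comment> \<open>The laws are constant in time, so any times tending to infinity serve; the
      integers are taken.\<close>
    proof (rule limit_dominated[OF sys', of real])
      show "orthant_distribution {1..} \<pi>'"
        using \<pi>' by (simp add: stationary_gap_distribution_def gaps_infinity)
      show "weakly_converges (orthant {1..}) (\<lambda>j. gap_law M' {1..} Y' (real j)) \<pi>'"
        using law by (simp add: weakly_converges_def)
      show "filterlim real at_top sequentially"
        by (rule filterlim_real_sequentially)
    qed simp
  qed
qed

end
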